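(* Let $(a_{ij})_{1\leq i,j\leq N}$ be a symmetrizable generalized Cartan matrix with symmetrization $\mathrm{diag}(d_1,\ldots,d_N)$, let $U_q^+$ be the positive part of the associated quantum enveloping algebra, with generators $e_1,\ldots,e_N$, and let $\sigma$ be the braiding on the vector space $V$ with basis $v_1,\ldots,v_N$ defined by $\sigma(v_i\otimes v_j)=-q^{d_ia_{ij}+1}v_j\otimes v_i$. Let $\mathcal{A}(\sigma)$ be the FRT algebra associated to $\sigma$, with generators $T^i_j$. Then the algebra $U_q^+$ is a right $\mathcal{A}(\sigma)$-comodule algebra whose comodule map is induced by the map $e_i\mapsto \sum_{j=1}^N e_j\otimes T^j_i$.
   Context: Everything is over $\mathbb{C}$; $q\in\mathbb{C}$ is nonzero with $q^{-2}$ not a root of unity. The $d_i$ are positive integers such that $(d_ia_{ij})$ is symmetric. $U_q^+$ is the unital associative algebra generated by $e_1,\ldots,e_N$ subject to the quantum Serre relations, for $1\le i\neq j\le N$, $$\sum_{k=0}^{1-a_{ij}}(-1)^k\left[\begin{array}{c} 1-a_{ij} \\ k \end{array}\right]_i e_i^k\,e_j\,e_i^{1-a_{ij}-k}=0,$$ where $[n]_i=\frac{q^{d_in}-q^{-d_in}}{q^{d_i}-q^{-d_i}}$ and $\left[\begin{array}{c} m \\ n \end{array}\right]_i=\frac{[m]_i[m-1]_i\cdots[m-n+1]_i}{[n]_i[n-1]_i\cdots[1]_i}$ for $0\le n\le m$. For a braiding $\sigma$ on $V$ (an invertible endomorphism of $V\otimes V$ satisfying the braid relation $(\sigma\otimes\mathrm{id})(\mathrm{id}\otimes\sigma)(\sigma\otimes\mathrm{id})=(\mathrm{id}\otimes\sigma)(\sigma\otimes\mathrm{id})(\mathrm{id}\otimes\sigma)$),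 write $\sigma(v_i\otimes v_j)=\sum_{k,l}\sigma_{ij}^{kl}v_k\otimes v_l$. The FRT algebra $\mathcal{A}(\sigma)$ is the unital associative algebra generated by $\{T^i_j\}_{1\le i,j\le N}$ subject to the relations $\sum_{k,l}\sigma_{ij}^{kl}T^m_kT^n_l=\sum_{k,l}T^k_iT^l_j\sigma_{kl}^{mn}$ for all $1\le i,j,m,n\le N$; it is a bialgebra with coproduct $T^i_j\mapsto\sum_kT^i_k\otimes T^k_j$ and counit $T^i_j\mapsto\delta^i_j$. "Comodule map induced by" means: the unique algebra homomorphism $U_q^+\to U_q^+\otimes\mathcal{A}(\sigma)$ extending the given assignment on generators. *)

theory Defs
  imports
    "HOL-Analysis.Cartesian_Space"
    "HOL-Algebra.QuotRing"
    "HOL-Algebra.Module"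
    "HOL-Library.Poly_Mapping"
    "HOL-Library.FuncSet"
begin

section \<open>Associative unital algebras over the complex numbers\<close>

text \<open>The library locale \<open>algebra\<close> is restricted to commutative algebras. An algebra is
  represented by the record type \<open>(complex, 'a) module\<close>, with an explicit carrier. The complex
  numbers themselves serve both as the ring of scalars and as an algebra.\<close>

definition complex_alg :: "(complex, complex) module" where
  "complex_alg = \<lparr>carrier = UNIV, mult = (*), one = 1, zero = 0, add = (+), smult = (*)\<rparr>"

locale complex_algebra = Module.module complex_alg A + ring A for A (structure) +
  assumes smult_mult_left:
      "\<lbrakk>x \<in> carrier A; y \<in> carrier A\<rbrakk> \<Longrightarrow> (c \<odot> x) \<otimes> y = c \<odot> (x \<otimes> y)"
    and smult_mult_right:
      "\<lbrakk>x \<in> carrier A; y \<in> carrier A\<rbrakk> \<Longrightarrow> x \<otimes> (c \<odot> y) = c \<odot> (x \<otimes> y)"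

definition alg_hom :: "(complex, 'a) module \<Rightarrow> (complex, 'b) module \<Rightarrow> ('a \<Rightarrow> 'b) set" where
  "alg_hom A B = {f \<in> ring_hom A B.
     \<forall>c. \<forall>x \<in> carrier A. f (c \<odot>\<^bsub>A\<^esub> x) = c \<odot>\<^bsub>B\<^esub> f x}"

text \<open>\<open>f\<close> is an algebra homomorphism from \<open>A\<close> to \<open>B\<close> that extends the assignment
  \<open>g x \<mapsto> h x\<close>. It is required to be \<^const>\<open>undefined\<close> outside the carrier of \<open>A\<close>, so that
  uniqueness of such a homomorphism is equality of functions.\<close>

definition extends_to_hom ::
  "(complex, 'a) module \<Rightarrow> (complex, 'b) module \<Rightarrow> ('x \<Rightarrow> 'a) \<Rightarrow> ('x \<Rightarrow> 'b) \<Rightarrow> ('a \<Rightarrow> 'b) \<Rightarrow> bool" where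
  "extends_to_hom A B g h f \<longleftrightarrow>
     f \<in> alg_hom A B \<and> f \<in> extensional (carrier A) \<and> (\<forall>x. f (g x) = h x)"

definition induced_hom ::
  "(complex, 'a) module \<Rightarrow> (complex, 'b) module \<Rightarrow> ('x \<Rightarrow> 'a) \<Rightarrow> ('x \<Rightarrow> 'b) \<Rightarrow> 'a \<Rightarrow> 'b" where
  "induced_hom A B g h = (THE f. extends_to_hom A B g h f)"

text \<open>Quotient by a two-sided ideal, or, for the underlying vector space alone, by a linear
  subspace. This is \<^const>\<open>FactRing\<close> together with the induced scalar multiplication.\<close>

definition quot_alg :: "(complex, 'a) module \<Rightarrow> 'a set \<Rightarrow> (complex, 'a set) module" where
  "quot_alg A I =
     \<lparr>carrier = carrier (A Quot I), mult = mult (A Quot I), one = one (A Quot I),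
      zero = zero (A Quot I), add = add (A Quot I),
      smult = (\<lambda>c X. \<Union>x\<in>X. I +>\<^bsub>A\<^esub> (c \<odot>\<^bsub>A\<^esub> x))\<rparr>"

definition linear_span :: "(complex, 'a) module \<Rightarrow> 'a set \<Rightarrow> 'a set" where
  "linear_span A S = \<Inter>{W. submodule W complex_alg A \<and> S \<subseteq> W}"

text \<open>The vector space with basis the carrier of a monoid, with the multiplication of the monoid
  extended bilinearly.\<close>

definition monoid_alg :: "('m, 'z) monoid_scheme \<Rightarrow> (complex, 'm \<Rightarrow>\<^sub>0 complex) module" where
  "monoid_alg M =
     \<lparr>carrier = {f. Poly_Mapping.keys f \<subseteq> carrier M},
      mult = (\<lambda>f g. \<Sum>x\<in>Poly_Mapping.keys f. \<Sum>y\<in>Poly_Mapping.keys g.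
                Poly_Mapping.single (x \<otimes>\<^bsub>M\<^esub> y)
                  (Poly_Mapping.lookup f x * Poly_Mapping.lookup g y)),
      one = Poly_Mapping.single \<one>\<^bsub>M\<^esub> 1,
      zero = 0,
      add = (+),
      smult = (\<lambda>c. Poly_Mapping.map ((*) c))\<rparr>"


section \<open>Tensor products\<close>

text \<open>\<open>A \<otimes> B\<close> is the vector space on the set \<open>A \<times> B\<close> modulo the span of the bilinearity
  relations, with \<open>(x \<otimes> y) (x' \<otimes> y') = x x' \<otimes> y y'\<close>.\<close>

definition bilinear_rels ::
  "(complex, 'a) module \<Rightarrow> (complex, 'b) module \<Rightarrow> ('a \<times> 'b \<Rightarrow>\<^sub>0 complex) set" where
  "bilinear_rels A B =
     {Poly_Mapping.single (x \<oplus>\<^bsub>A\<^esub> x', y) 1 - Poly_Mapping.single (x, y) 1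
        - Poly_Mapping.single (x', y) 1
      | x x' y. x \<in> carrier A \<and> x' \<in> carrier A \<and> y \<in> carrier B} \<union>
     {Poly_Mapping.single (x, y \<oplus>\<^bsub>B\<^esub> y') 1 - Poly_Mapping.single (x, y) 1
        - Poly_Mapping.single (x, y') 1
      | x y y'. x \<in> carrier A \<and> y \<in> carrier B \<and> y' \<in> carrier B} \<union>
     {Poly_Mapping.single (c \<odot>\<^bsub>A\<^esub> x, y) 1 - Poly_Mapping.single (x, y) c
      | c x y. x \<in> carrier A \<and> y \<in> carrier B} \<union>
     {Poly_Mapping.single (x, c \<odot>\<^bsub>B\<^esub> y) 1 - Poly_Mapping.single (x, y) c
      | c x y. x \<in> carrier A \<and> y \<in> carrier B}"

definition tensor_null ::
  "(complex, 'a) module \<Rightarrow> (complex, 'b) module \<Rightarrow> ('a \<times> 'b \<Rightarrow>\<^sub>0 complex) set" where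
  "tensor_null A B = linear_span (monoid_alg (A \<times>\<times> B)) (bilinear_rels A B)"

definition tensor_alg ::
  "(complex, 'a) module \<Rightarrow> (complex, 'b) module \<Rightarrow> (complex, ('a \<times> 'b \<Rightarrow>\<^sub>0 complex) set) module"
  where "tensor_alg A B = quot_alg (monoid_alg (A \<times>\<times> B)) (tensor_null A B)"

definition pure_tensor ::
  "(complex, 'a) module \<Rightarrow> (complex, 'b) module \<Rightarrow> 'a \<Rightarrow> 'b \<Rightarrow> ('a \<times> 'b \<Rightarrow>\<^sub>0 complex) set" where
  "pure_tensor A B x y =
     tensor_null A B +>\<^bsub>monoid_alg (A \<times>\<times> B)\<^esub> Poly_Mapping.single (x, y) 1"

text \<open>The linear map on \<open>A \<otimes> B\<close> with \<open>x \<otimes> y \<mapsto> \<beta> x y\<close>, for \<open>\<beta>\<close> bilinear: bilinearity makes the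
  image of a coset under the linear extension of \<open>\<beta>\<close> a singleton.\<close>

definition tensor_lift ::
  "(complex, 'a) module \<Rightarrow> (complex, 'b) module \<Rightarrow> (complex, 'c) module \<Rightarrow>
   ('a \<Rightarrow> 'b \<Rightarrow> 'c) \<Rightarrow> ('a \<times> 'b \<Rightarrow>\<^sub>0 complex) set \<Rightarrow> 'c" where
  "tensor_lift A B M \<beta> X =
     the_elem ((\<lambda>f. \<Oplus>\<^bsub>M\<^esub>p\<in>Poly_Mapping.keys f.
                       Poly_Mapping.lookup f p \<odot>\<^bsub>M\<^esub> \<beta> (fst p) (snd p)) ` X)"

definition tensor_map ::
  "(complex, 'a) module \<Rightarrow> (complex, 'b) module \<Rightarrow> (complex, 'c) module \<Rightarrow> (complex, 'd) module \<Rightarrow>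
   ('a \<Rightarrow> 'c) \<Rightarrow> ('b \<Rightarrow> 'd) \<Rightarrow> ('a \<times> 'b \<Rightarrow>\<^sub>0 complex) set \<Rightarrow> ('c \<times> 'd \<Rightarrow>\<^sub>0 complex) set" where
  "tensor_map A B C D f g =
     tensor_lift A B (tensor_alg C D) (\<lambda>x y. pure_tensor C D (f x) (g y))"

text \<open>The canonical map from \<open>(A \<otimes> B) \<otimes> C\<close> to \<open>A \<otimes> (B \<otimes> C)\<close>.\<close>

definition tensor_assoc ::
  "(complex, 'a) module \<Rightarrow> (complex, 'b) module \<Rightarrow> (complex, 'c) module \<Rightarrow>
   (('a \<times> 'b \<Rightarrow>\<^sub>0 complex) set \<times> 'c \<Rightarrow>\<^sub>0 complex) set \<Rightarrow>
   ('a \<times> ('b \<times> 'c \<Rightarrow>\<^sub>0 complex) set \<Rightarrow>\<^sub>0 complex) set" where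
  "tensor_assoc A B C =
     tensor_lift (tensor_alg A B) C (tensor_alg A (tensor_alg B C))
       (\<lambda>u z. tensor_lift A B (tensor_alg A (tensor_alg B C))
          (\<lambda>x y. pure_tensor A (tensor_alg B C) x (pure_tensor B C y z)) u)"


section \<open>Bialgebras and comodule algebras\<close>

text \<open>In the counit axioms below, the scalars are absorbed via \<open>A \<otimes> \<complex> \<cong> A\<close> and \<open>\<complex> \<otimes> A \<cong> A\<close>:
  \<open>x \<otimes> h \<mapsto> \<epsilon>(h) x\<close> is the map \<open>id \<otimes> \<epsilon>\<close>.\<close>

definition bialgebra ::
  "(complex, 'h) module \<Rightarrow> ('h \<Rightarrow> ('h \<times> 'h \<Rightarrow>\<^sub>0 complex) set) \<Rightarrow> ('h \<Rightarrow> complex) \<Rightarrow> bool" where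
  "bialgebra H \<Delta> \<epsilon> \<longleftrightarrow>
     complex_algebra H \<and>
     \<Delta> \<in> alg_hom H (tensor_alg H H) \<and>
     \<epsilon> \<in> alg_hom H complex_alg \<and>
     (\<forall>x \<in> carrier H.
        tensor_assoc H H H (tensor_map H H (tensor_alg H H) H \<Delta> (\<lambda>y. y) (\<Delta> x)) =
        tensor_map H H H (tensor_alg H H) (\<lambda>y. y) \<Delta> (\<Delta> x)) \<and>
     (\<forall>x \<in> carrier H. tensor_lift H H H (\<lambda>y z. \<epsilon> y \<odot>\<^bsub>H\<^esub> z) (\<Delta> x) = x) \<and>
     (\<forall>x \<in> carrier H. tensor_lift H H H (\<lambda>y z. \<epsilon> z \<odot>\<^bsub>H\<^esub> y) (\<Delta> x) = x)"

definition right_comodule_algebra ::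
  "(complex, 'a) module \<Rightarrow> (complex, 'h) module \<Rightarrow> ('h \<Rightarrow> ('h \<times> 'h \<Rightarrow>\<^sub>0 complex) set) \<Rightarrow>
   ('h \<Rightarrow> complex) \<Rightarrow> ('a \<Rightarrow> ('a \<times> 'h \<Rightarrow>\<^sub>0 complex) set) \<Rightarrow> bool" where
  "right_comodule_algebra A H \<Delta> \<epsilon> \<delta> \<longleftrightarrow>
     complex_algebra A \<and>
     bialgebra H \<Delta> \<epsilon> \<and>
     \<delta> \<in> alg_hom A (tensor_alg A H) \<and>
     (\<forall>x \<in> carrier A.
        tensor_assoc A H H (tensor_map A H (tensor_alg A H) H \<delta> (\<lambda>h. h) (\<delta> x)) =
        tensor_map A H A (tensor_alg H H) (\<lambda>y. y) \<Delta> (\<delta> x)) \<and>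
     (\<forall>x \<in> carrier A. tensor_lift A H A (\<lambda>y h. \<epsilon> h \<odot>\<^bsub>A\<^esub> y) (\<delta> x) = x)"


section \<open>Algebras given by generators and relations\<close>

definition free_alg :: "(complex, 'x list \<Rightarrow>\<^sub>0 complex) module" where
  "free_alg = monoid_alg \<lparr>carrier = UNIV, mult = (@), one = []\<rparr>"

definition free_gen :: "'x \<Rightarrow> 'x list \<Rightarrow>\<^sub>0 complex" where
  "free_gen x = Poly_Mapping.single [x] 1"

definition presented_alg ::
  "('x list \<Rightarrow>\<^sub>0 complex) set \<Rightarrow> (complex, ('x list \<Rightarrow>\<^sub>0 complex) set) module" where
  "presented_alg S = quot_alg free_alg (Idl\<^bsub>free_alg\<^esub> S)"

definition presented_gen ::
  "('x list \<Rightarrow>\<^sub>0 complex) set \<Rightarrow> 'x \<Rightarrow> ('x list \<Rightarrow>\<^sub>0 complex) set" where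
  "presented_gen S x = (Idl\<^bsub>free_alg\<^esub> S) +>\<^bsub>free_alg\<^esub> free_gen x"


section \<open>The positive part of a quantum enveloping algebra\<close>

text \<open>The index set \<open>{1, \<dots>, N}\<close> is an arbitrary finite type \<open>'n\<close>.\<close>

definition generalized_cartan_matrix :: "('n::finite \<Rightarrow> 'n \<Rightarrow> int) \<Rightarrow> bool" where
  "generalized_cartan_matrix a \<longleftrightarrow>
     (\<forall>i. a i i = 2) \<and>
     (\<forall>i j. i \<noteq> j \<longrightarrow> a i j \<le> 0) \<and>
     (\<forall>i j. a i j = 0 \<longleftrightarrow> a j i = 0)"

definition symmetrization :: "('n::finite \<Rightarrow> 'n \<Rightarrow> int) \<Rightarrow> ('n \<Rightarrow> int) \<Rightarrow> bool" where
  "symmetrization a d \<longleftrightarrow> (\<forall>i. d i > 0) \<and> (\<forall>i j. d i * a i j = d j * a j i)"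

text \<open>The argument \<open>D\<close> of the next two constants is the integer \<open>d\<^sub>i\<close>.\<close>

definition q_number :: "complex \<Rightarrow> int \<Rightarrow> nat \<Rightarrow> complex" where
  "q_number q D n =
     (q powi (D * int n) - q powi (- (D * int n))) / (q powi D - q powi (- D))"

definition q_binomial :: "complex \<Rightarrow> int \<Rightarrow> nat \<Rightarrow> nat \<Rightarrow> complex" where
  "q_binomial q D m n = (\<Prod>k<n. q_number q D (m - k)) / (\<Prod>k=1..n. q_number q D k)"

definition serre_element ::
  "('n::finite \<Rightarrow> 'n \<Rightarrow> int) \<Rightarrow> ('n \<Rightarrow> int) \<Rightarrow> complex \<Rightarrow> 'n \<Rightarrow> 'n \<Rightarrow> 'n list \<Rightarrow>\<^sub>0 complex" where
  "serre_element a d q i j =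
     (let m = nat (1 - a i j) in
      \<Oplus>\<^bsub>free_alg\<^esub>k\<in>{0..m}.
        ((-1) ^ k * q_binomial q (d i) m k) \<odot>\<^bsub>free_alg\<^esub>
          ((free_gen i [^]\<^bsub>free_alg\<^esub> k) \<otimes>\<^bsub>free_alg\<^esub> free_gen j
             \<otimes>\<^bsub>free_alg\<^esub> (free_gen i [^]\<^bsub>free_alg\<^esub> (m - k))))"

definition serre_rels ::
  "('n::finite \<Rightarrow> 'n \<Rightarrow> int) \<Rightarrow> ('n \<Rightarrow> int) \<Rightarrow> complex \<Rightarrow> ('n list \<Rightarrow>\<^sub>0 complex) set" where
  "serre_rels a d q = {serre_element a d q i j | i j. i \<noteq> j}"

definition Uq_plus ::
  "('n::finite \<Rightarrow> 'n \<Rightarrow> int) \<Rightarrow> ('n \<Rightarrow> int) \<Rightarrow> complex \<Rightarrow> (complex, ('n list \<Rightarrow>\<^sub>0 complex) set) module"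
  where "Uq_plus a d q = presented_alg (serre_rels a d q)"

definition Uq_gen ::
  "('n::finite \<Rightarrow> 'n \<Rightarrow> int) \<Rightarrow> ('n \<Rightarrow> int) \<Rightarrow> complex \<Rightarrow> 'n \<Rightarrow> ('n list \<Rightarrow>\<^sub>0 complex) set" where
  "Uq_gen a d q = presented_gen (serre_rels a d q)"


section \<open>Braidings and their FRT algebras\<close>

text \<open>\<open>V\<close> has basis \<open>v\<^sub>i\<close> (\<open>i :: 'n\<close>), so \<open>V \<otimes> V\<close> is \<open>complex^('n \<times> 'n)\<close> with
  \<open>v\<^sub>i \<otimes> v\<^sub>j = axis (i, j) 1\<close>, and \<open>V \<otimes> V \<otimes> V\<close> is \<open>complex^('n \<times> 'n \<times> 'n)\<close>. The maps
  \<open>leg12 \<sigma>\<close> and \<open>leg23 \<sigma>\<close> are \<open>\<sigma> \<otimes> id\<close> and \<open>id \<otimes> \<sigma>\<close>.\<close>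

definition leg12 ::
  "(complex^('n::finite \<times> 'n) \<Rightarrow> complex^('n \<times> 'n)) \<Rightarrow>
   complex^('n \<times> 'n \<times> 'n) \<Rightarrow> complex^('n \<times> 'n \<times> 'n)" where
  "leg12 \<sigma> x = (\<chi> p. case p of (i, j, k) \<Rightarrow> \<sigma> (\<chi> r. x $ (fst r, snd r, k)) $ (i, j))"

definition leg23 ::
  "(complex^('n::finite \<times> 'n) \<Rightarrow> complex^('n \<times> 'n)) \<Rightarrow>
   complex^('n \<times> 'n \<times> 'n) \<Rightarrow> complex^('n \<times> 'n \<times> 'n)" where
  "leg23 \<sigma> x = (\<chi> p. case p of (i, j, k) \<Rightarrow> \<sigma> (\<chi> r. x $ (i, fst r, snd r)) $ (j, k))"

definition braiding :: "(complex^('n::finite \<times> 'n) \<Rightarrow> complex^('n \<times> 'n)) \<Rightarrow> bool" where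
  "braiding \<sigma> \<longleftrightarrow>
     Vector_Spaces.linear (*s) (*s) \<sigma> \<and> bij \<sigma> \<and>
     leg12 \<sigma> \<circ> leg23 \<sigma> \<circ> leg12 \<sigma> = leg23 \<sigma> \<circ> leg12 \<sigma> \<circ> leg23 \<sigma>"

text \<open>The coefficient \<open>\<sigma>\<^sub>i\<^sub>j\<^sup>k\<^sup>l\<close> in \<open>\<sigma>(v\<^sub>i \<otimes> v\<^sub>j) = (\<Sum>k l. \<sigma>\<^sub>i\<^sub>j\<^sup>k\<^sup>l v\<^sub>k \<otimes> v\<^sub>l)\<close>.\<close>

definition braid_coeff ::
  "(complex^('n::finite \<times> 'n) \<Rightarrow> complex^('n \<times> 'n)) \<Rightarrow> 'n \<Rightarrow> 'n \<Rightarrow> 'n \<Rightarrow> 'n \<Rightarrow> complex" where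
  "braid_coeff \<sigma> i j k l = \<sigma> (axis (i, j) 1) $ (k, l)"

text \<open>The linear map with \<open>v\<^sub>i \<otimes> v\<^sub>j \<mapsto> - q\<^bsup>d\<^sub>i a\<^sub>i\<^sub>j + 1\<^esup> v\<^sub>j \<otimes> v\<^sub>i\<close>.\<close>

definition cartan_braiding ::
  "('n::finite \<Rightarrow> 'n \<Rightarrow> int) \<Rightarrow> ('n \<Rightarrow> int) \<Rightarrow> complex \<Rightarrow>
   complex^('n \<times> 'n) \<Rightarrow> complex^('n \<times> 'n)" where
  "cartan_braiding a d q x =
     (\<Sum>i\<in>UNIV. \<Sum>j\<in>UNIV. (x $ (i, j)) *s (- (q powi (d i * a i j + 1)) *s axis (j, i) 1))"

text \<open>The generator \<open>T\<^sup>i\<^sub>j\<close> of the free algebra is \<open>free_gen (i, j)\<close>: the upper index comes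
  first.\<close>

definition frt_rel ::
  "(complex^('n::finite \<times> 'n) \<Rightarrow> complex^('n \<times> 'n)) \<Rightarrow> 'n \<Rightarrow> 'n \<Rightarrow> 'n \<Rightarrow> 'n \<Rightarrow>
   ('n \<times> 'n) list \<Rightarrow>\<^sub>0 complex" where
  "frt_rel \<sigma> i j m n =
     (\<Oplus>\<^bsub>free_alg\<^esub>k\<in>UNIV. \<Oplus>\<^bsub>free_alg\<^esub>l\<in>UNIV.
        braid_coeff \<sigma> i j k l \<odot>\<^bsub>free_alg\<^esub> (free_gen (m, k) \<otimes>\<^bsub>free_alg\<^esub> free_gen (n, l)))
     \<ominus>\<^bsub>free_alg\<^esub>
     (\<Oplus>\<^bsub>free_alg\<^esub>k\<in>UNIV. \<Oplus>\<^bsub>free_alg\<^esub>l\<in>UNIV.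
        braid_coeff \<sigma> k l m n \<odot>\<^bsub>free_alg\<^esub> (free_gen (k, i) \<otimes>\<^bsub>free_alg\<^esub> free_gen (l, j)))"

definition frt_rels ::
  "(complex^('n::finite \<times> 'n) \<Rightarrow> complex^('n \<times> 'n)) \<Rightarrow> (('n \<times> 'n) list \<Rightarrow>\<^sub>0 complex) set" where
  "frt_rels \<sigma> = {frt_rel \<sigma> i j m n | i j m n. True}"

definition frt_alg ::
  "(complex^('n::finite \<times> 'n) \<Rightarrow> complex^('n \<times> 'n)) \<Rightarrow>
   (complex, (('n \<times> 'n) list \<Rightarrow>\<^sub>0 complex) set) module" where
  "frt_alg \<sigma> = presented_alg (frt_rels \<sigma>)"

definition frt_gen ::
  "(complex^('n::finite \<times> 'n) \<Rightarrow> complex^('n \<times> 'n)) \<Rightarrow> 'n \<Rightarrow> 'n \<Rightarrow>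
   (('n \<times> 'n) list \<Rightarrow>\<^sub>0 complex) set" where
  "frt_gen \<sigma> i j = presented_gen (frt_rels \<sigma>) (i, j)"

definition frt_comult ::
  "(complex^('n::finite \<times> 'n) \<Rightarrow> complex^('n \<times> 'n)) \<Rightarrow>
   (('n \<times> 'n) list \<Rightarrow>\<^sub>0 complex) set \<Rightarrow>
   ((('n \<times> 'n) list \<Rightarrow>\<^sub>0 complex) set \<times> (('n \<times> 'n) list \<Rightarrow>\<^sub>0 complex) set \<Rightarrow>\<^sub>0 complex) set" where
  "frt_comult \<sigma> =
     (let A = frt_alg \<sigma> in
      induced_hom A (tensor_alg A A)
        (\<lambda>(i, j). frt_gen \<sigma> i j)
        (\<lambda>(i, j). \<Oplus>\<^bsub>tensor_alg A A\<^esub>k\<in>UNIV. pure_tensor A A (frt_gen \<sigma> i k) (frt_gen \<sigma> k j)))"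

definition frt_counit ::
  "(complex^('n::finite \<times> 'n) \<Rightarrow> complex^('n \<times> 'n)) \<Rightarrow>
   (('n \<times> 'n) list \<Rightarrow>\<^sub>0 complex) set \<Rightarrow> complex" where
  "frt_counit \<sigma> =
     induced_hom (frt_alg \<sigma>) complex_alg
       (\<lambda>(i, j). frt_gen \<sigma> i j) (\<lambda>(i, j). if i = j then 1 else 0)"

lemma cartan_braiding_nth:
  "cartan_braiding a d q x $ (k, l) = - (q powi (d l * a l k + 1)) * x $ (l, k)"
proof -
  have "cartan_braiding a d q x $ (k, l) =
      (\<Sum>i\<in>UNIV. \<Sum>j\<in>UNIV. if j = k then if i = l
         then - (q powi (d l * a l k + 1)) * x $ (l, k) else 0 else 0)"
    unfolding cartan_braiding_def sum_component
    by (intro sum.cong refl) (auto simp: axis_def)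
  also have "\<dots> = - (q powi (d l * a l k + 1)) * x $ (l, k)"
    by simp
  finally show ?thesis .
qed

lemma cartan_braiding_axis:
  "cartan_braiding a d q (axis (i, j) 1) = - (q powi (d i * a i j + 1)) *s axis (j, i) 1"
  by (auto simp: vec_eq_iff cartan_braiding_nth axis_def)

lemma braiding_cartan_braiding:
  assumes "q \<noteq> 0"
  shows "braiding (cartan_braiding a d q)"
proof -
  let ?s = "cartan_braiding a d q"
  let ?t = "\<lambda>x. \<chi> p. - inverse (q powi (d (fst p) * a (fst p) (snd p) + 1)) * x $ (snd p, fst p)"
  have "Vector_Spaces.linear (*s) (*s) ?s"
    by unfold_locales (auto simp: vec_eq_iff cartan_braiding_nth algebra_simps)
  moreover have "bij ?s"
  proof (rule o_bij)
    show "?t \<circ> ?s = id" "?s \<circ> ?t = id"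
      using assms by (auto simp: fun_eq_iff vec_eq_iff cartan_braiding_nth)
  qed
  moreover have "leg12 ?s \<circ> leg23 ?s \<circ> leg12 ?s = leg23 ?s \<circ> leg12 ?s \<circ> leg23 ?s"
    by (auto simp: fun_eq_iff vec_eq_iff leg12_def leg23_def cartan_braiding_nth)
  ultimately show ?thesis
    unfolding braiding_def by blast
qed

end

theory Submission
  imports Defs
begin

text \<open>Put \<open>b\<^sub>i\<^sub>j = d\<^sub>i a\<^sub>i\<^sub>j\<close>. For the given braiding the FRT relations read
  \<open>q\<^bsup>b\<^sub>i\<^sub>j\<^esup> T\<^sup>m\<^sub>j T\<^sup>n\<^sub>i = q\<^bsup>b\<^sub>n\<^sub>m\<^esup> T\<^sup>n\<^sub>i T\<^sup>m\<^sub>j\<close>. Since \<open>b\<close> is symmetric, exchanging the two factors gives a second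
  relation between the same two products, and as \<open>q\<^sup>2\<close> is not a root of unity, all generators of
  \<open>\<A>(\<sigma>)\<close> commute and \<open>T\<^sup>n\<^sub>i T\<^sup>m\<^sub>j = 0\<close> unless \<open>b\<^sub>n\<^sub>m = b\<^sub>i\<^sub>j\<close>. The elements
  \<open>E\<^sub>i = \<Sum>\<^sub>r e\<^sub>r \<otimes> T\<^sup>r\<^sub>i\<close> are therefore sums of pairwise orthogonal terms, because \<open>b\<^sub>r\<^sub>s \<le> 0 < b\<^sub>i\<^sub>i\<close> for
  \<open>r \<noteq> s\<close>, and the Serre expression in \<open>E\<^sub>i, E\<^sub>j\<close> collapses to the sum over \<open>r, s\<close> of the Serre
  expression in \<open>e\<^sub>r, e\<^sub>s\<close> tensored with \<open>(T\<^sup>r\<^sub>i)\<^sup>m T\<^sup>s\<^sub>j\<close>. If the latter monomial is nonzero, then the former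
  expression is the Serre relation of \<open>r, s\<close>. All axioms of bialgebras and comodules are equalities of
  algebra homomorphisms, so that it suffices to check them on generators.\<close>

section \<open>Algebras and linear maps\<close>

text \<open>The structure maps are given by \<open>THE\<close> and \<open>the_elem\<close>, so
  nothing can be said of them before the universal properties of presented algebras and of tensor
  products are available. Checking an axiom on generators also presupposes that
  \<open>tensor_map\<close>, \<open>tensor_assoc\<close> and the maps applying the counit are
  multiplicative, although they are defined only as linear lifts. The product on a tensor product
  comes from a monoid algebra: the span of the bilinearity relations is a two-sided ideal in the
  algebra of the monoid \<open>A \<times>\<times> B\<close>, so one quotient construction serves
  both presentations and tensor products. Write \<open>c = -q^(b+1)\<close> for the scalars of the
  braiding. The FRT relation and its exchanged form combine to \<open>c_ij^2 y = c_nm^2 y\<close>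
  for a product \<open>y\<close> of two generators; the sign and the shift by 1 drop out of the
  quotient of the squares, which is \<open>q^(2(b_ij - b_nm))\<close>. A nonzero monomial
  \<open>(T^r_i)^m T^s_j\<close> determines the Serre relation because its factors can be compared
  in pairs: \<open>T^r_i T^s_j\<close> fixes \<open>b_rs\<close>, and \<open>T^r_i T^r_i\<close>,
  present once \<open>m \<ge> 2\<close>, fixes \<open>d_r\<close>; together they fix
  \<open>a_rs\<close>.\<close>

lemma complex_alg_simps [simp]:
  "carrier complex_alg = UNIV" "x \<otimes>\<^bsub>complex_alg\<^esub> y = x * y" "\<one>\<^bsub>complex_alg\<^esub> = 1"
  "\<zero>\<^bsub>complex_alg\<^esub> = 0" "x \<oplus>\<^bsub>complex_alg\<^esub> y = x + y" "c \<odot>\<^bsub>complex_alg\<^esub> x = c * x"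
  by (simp_all add: complex_alg_def)

lemma cring_complex_alg: "cring complex_alg"
  by (intro cringI abelian_groupI comm_monoidI)
    (auto simp: algebra_simps intro: exI[of _ "- _"] left_minus)

lemma complex_algebraI:
  fixes A (structure)
  assumes "ring A"
    and "\<And>c x. x \<in> carrier A \<Longrightarrow> c \<odot> x \<in> carrier A"
    and "\<And>b c x. x \<in> carrier A \<Longrightarrow> (b + c) \<odot> x = b \<odot> x \<oplus> c \<odot> x"
    and "\<And>c x y. \<lbrakk>x \<in> carrier A; y \<in> carrier A\<rbrakk> \<Longrightarrow> c \<odot> (x \<oplus> y) = c \<odot> x \<oplus> c \<odot> y"
    and "\<And>b c x. x \<in> carrier A \<Longrightarrow> (b * c) \<odot> x = b \<odot> (c \<odot> x)"
    and "\<And>x. x \<in> carrier A \<Longrightarrow> 1 \<odot> x = x"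
    and "\<And>c x y. \<lbrakk>x \<in> carrier A; y \<in> carrier A\<rbrakk> \<Longrightarrow> (c \<odot> x) \<otimes> y = c \<odot> (x \<otimes> y)"
    and "\<And>c x y. \<lbrakk>x \<in> carrier A; y \<in> carrier A\<rbrakk> \<Longrightarrow> x \<otimes> (c \<odot> y) = c \<odot> (x \<otimes> y)"
  shows "complex_algebra A"
  using assms
  by (intro complex_algebra.intro complex_algebra_axioms.intro moduleI cring_complex_alg)
    (auto intro: ring.is_abelian_group)

lemma complex_algebra_complex_alg: "complex_algebra complex_alg"
  by (rule complex_algebraI) (auto simp: algebra_simps intro: cring.axioms cring_complex_alg)

context complex_algebra
begin

lemma ring_A: "ring A" ..

lemma smult_add_left: "x \<in> carrier A \<Longrightarrow> (b + c) \<odot> x = b \<odot> x \<oplus> c \<odot> x"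
  using smult_l_distr[of b c x] by simp

lemma smult_add_right:
  "\<lbrakk>x \<in> carrier A; y \<in> carrier A\<rbrakk> \<Longrightarrow> c \<odot> (x \<oplus> y) = c \<odot> x \<oplus> c \<odot> y"
  using smult_r_distr[of c x y] by simp

lemma smult_smult: "x \<in> carrier A \<Longrightarrow> b \<odot> (c \<odot> x) = (b * c) \<odot> x"
  using smult_assoc1[of b c x] by simp

lemma smult_1 [simp]: "x \<in> carrier A \<Longrightarrow> 1 \<odot> x = x"
  using smult_one[of x] by simp

lemma smult_0 [simp]: "x \<in> carrier A \<Longrightarrow> 0 \<odot> x = \<zero>"
  using smult_l_null[of x] by simp

lemma smult_zero [simp]: "c \<odot> \<zero> = \<zero>"
  using smult_r_null[of c] by simp

lemma minus_eq_smult: "x \<in> carrier A \<Longrightarrow> \<ominus> x = (-1) \<odot> x"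
  using smult_add_left[of x "-1" 1] by (intro minus_equality) auto

lemma smult_finsum:
  "\<lbrakk>finite I; f \<in> I \<rightarrow> carrier A\<rbrakk> \<Longrightarrow> c \<odot> (\<Oplus>i\<in>I. f i) = (\<Oplus>i\<in>I. c \<odot> f i)"
  using finsum_smult_ldistr[of I c f] by simp

text \<open>Scalars act through multiples of the unit, so an ideal of the ring is automatically a
  linear subspace.\<close>

lemma smult_ideal:
  assumes "ideal I A" "x \<in> I"
  shows "c \<odot> x \<in> I"
proof -
  interpret ideal I A by fact
  have "c \<odot> x = (c \<odot> \<one>) \<otimes> x"
    using a_Hcarr[OF assms(2)] by (simp add: smult_mult_left)
  then show ?thesis
    using assms(2) I_l_closed by simp
qed

end

text \<open>Linearity is kept apart from multiplicativity because the slices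
  \<open>\<lambda>x. \<beta> x y\<close> of a bilinear map are linear but in general not
  multiplicative.\<close>

definition lin_hom :: "(complex, 'a) module \<Rightarrow> (complex, 'b) module \<Rightarrow> ('a \<Rightarrow> 'b) set" where
  "lin_hom A B = {f \<in> carrier A \<rightarrow> carrier B.
     (\<forall>x\<in>carrier A. \<forall>y\<in>carrier A. f (x \<oplus>\<^bsub>A\<^esub> y) = f x \<oplus>\<^bsub>B\<^esub> f y) \<and>
     (\<forall>c. \<forall>x\<in>carrier A. f (c \<odot>\<^bsub>A\<^esub> x) = c \<odot>\<^bsub>B\<^esub> f x)}"

lemma lin_homI:
  assumes "\<And>x. x \<in> carrier A \<Longrightarrow> f x \<in> carrier B"
    and "\<And>x y. \<lbrakk>x \<in> carrier A; y \<in> carrier A\<rbrakk> \<Longrightarrow> f (x \<oplus>\<^bsub>A\<^esub> y) = f x \<oplus>\<^bsub>B\<^esub> f y"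
    and "\<And>c x. x \<in> carrier A \<Longrightarrow> f (c \<odot>\<^bsub>A\<^esub> x) = c \<odot>\<^bsub>B\<^esub> f x"
  shows "f \<in> lin_hom A B"
  using assms by (auto simp: lin_hom_def)

lemma lin_homD:
  assumes "f \<in> lin_hom A B"
  shows "x \<in> carrier A \<Longrightarrow> f x \<in> carrier B"
    and "\<lbrakk>x \<in> carrier A; y \<in> carrier A\<rbrakk> \<Longrightarrow> f (x \<oplus>\<^bsub>A\<^esub> y) = f x \<oplus>\<^bsub>B\<^esub> f y"
    and "x \<in> carrier A \<Longrightarrow> f (c \<odot>\<^bsub>A\<^esub> x) = c \<odot>\<^bsub>B\<^esub> f x"
  using assms by (auto simp: lin_hom_def)

lemma alg_hom_iff_lin_hom:
  "f \<in> alg_hom A B \<longleftrightarrow> f \<in> lin_hom A B \<and> f \<one>\<^bsub>A\<^esub> = \<one>\<^bsub>B\<^esub> \<and>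
     (\<forall>x\<in>carrier A. \<forall>y\<in>carrier A. f (x \<otimes>\<^bsub>A\<^esub> y) = f x \<otimes>\<^bsub>B\<^esub> f y)"
  by (auto simp: alg_hom_def lin_hom_def ring_hom_def)

lemma alg_homD:
  assumes "f \<in> alg_hom A B"
  shows "f \<in> lin_hom A B" "f \<one>\<^bsub>A\<^esub> = \<one>\<^bsub>B\<^esub>"
    and "\<lbrakk>x \<in> carrier A; y \<in> carrier A\<rbrakk> \<Longrightarrow> f (x \<otimes>\<^bsub>A\<^esub> y) = f x \<otimes>\<^bsub>B\<^esub> f y"
  using assms by (auto simp: alg_hom_iff_lin_hom)

lemma alg_hom_cong:
  assumes "complex_algebra A" "f \<in> alg_hom A B" "\<And>x. x \<in> carrier A \<Longrightarrow> f x = g x"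
  shows "g \<in> alg_hom A B"
proof -
  interpret complex_algebra A by fact
  show ?thesis
    using assms(2) by (auto simp: alg_hom_def ring_hom_def Pi_def simp flip: assms(3))
qed

lemma id_alg_hom: "(\<lambda>x. x) \<in> alg_hom A A"
  by (auto simp: alg_hom_def ring_hom_def)

lemma lin_hom_comp: "\<lbrakk>f \<in> lin_hom A B; g \<in> lin_hom B C\<rbrakk> \<Longrightarrow> (\<lambda>x. g (f x)) \<in> lin_hom A C"
  by (auto simp: lin_hom_def Pi_def)

lemma alg_hom_comp: "\<lbrakk>f \<in> alg_hom A B; g \<in> alg_hom B C\<rbrakk> \<Longrightarrow> (\<lambda>x. g (f x)) \<in> alg_hom A C"
  by (auto simp: alg_hom_def ring_hom_def Pi_def)

locale linear_map = A?: complex_algebra A + B?: complex_algebra B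
  for A (structure) and B (structure) +
  fixes f
  assumes lin_hom: "f \<in> lin_hom A B"
begin

lemmas map_closed [simp] = lin_homD(1)[OF lin_hom]
lemmas map_add = lin_homD(2)[OF lin_hom]
lemmas map_smult = lin_homD(3)[OF lin_hom]

lemma map_zero [simp]: "f \<zero>\<^bsub>A\<^esub> = \<zero>\<^bsub>B\<^esub>"
  using map_smult[of "\<zero>\<^bsub>A\<^esub>" 0] by simp

lemma map_minus: "x \<in> carrier A \<Longrightarrow> f (\<ominus>\<^bsub>A\<^esub> x) = \<ominus>\<^bsub>B\<^esub> f x"
  by (simp add: A.minus_eq_smult B.minus_eq_smult map_smult)

lemma map_finsum:
  assumes "finite I" "g \<in> I \<rightarrow> carrier A"
  shows "f (\<Oplus>\<^bsub>A\<^esub>i\<in>I. g i) = (\<Oplus>\<^bsub>B\<^esub>i\<in>I. f (g i))"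
  using assms
proof (induction I)
  case (insert i I)
  then have "g \<in> I \<rightarrow> carrier A" "g i \<in> carrier A" "(\<lambda>i. f (g i)) \<in> I \<rightarrow> carrier B"
    by (auto simp: Pi_def)
  then show ?case
    using insert by (simp add: map_add)
qed simp

end

lemma lin_hom_finsum:
  assumes "complex_algebra A" "complex_algebra B" "f \<in> lin_hom A B" "finite I" "g \<in> I \<rightarrow> carrier A"
  shows "f (\<Oplus>\<^bsub>A\<^esub>i\<in>I. g i) = (\<Oplus>\<^bsub>B\<^esub>i\<in>I. f (g i))"
  using assms by (intro linear_map.map_finsum linear_map.intro linear_map_axioms.intro)

lemma lin_hom_zero:
  assumes "complex_algebra A" "complex_algebra B" "f \<in> lin_hom A B"
  shows "f \<zero>\<^bsub>A\<^esub> = \<zero>\<^bsub>B\<^esub>"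
  using assms by (intro linear_map.map_zero linear_map.intro linear_map_axioms.intro)

lemma submodule_lin_kernel:
  assumes "complex_algebra A" "complex_algebra B" "f \<in> lin_hom A B"
  shows "submodule {x \<in> carrier A. f x = \<zero>\<^bsub>B\<^esub>} complex_alg A"
proof -
  interpret linear_map A B f
    using assms by (intro linear_map.intro linear_map_axioms.intro)
  show ?thesis
    by (rule A.submoduleI) (auto simp: map_add map_smult map_minus)
qed

lemma ideal_alg_kernel:
  assumes "complex_algebra A" "complex_algebra B" "f \<in> alg_hom A B"
  shows "ideal {x \<in> carrier A. f x = \<zero>\<^bsub>B\<^esub>} A"
proof -
  interpret linear_map A B f
    using assms by (intro linear_map.intro linear_map_axioms.intro alg_homD)
  show ?thesis
  proof (rule idealI)
    show "subgroup {x \<in> carrier A. f x = \<zero>\<^bsub>B\<^esub>} (add_monoid A)"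
      using submodule_lin_kernel[OF assms(1,2) lin_hom] by (simp add: submodule_def)
  qed (auto simp: alg_homD(3)[OF assms(3)] intro: A.ring_A)
qed

section \<open>Linear spans, and when they are ideals\<close>

lemma linear_span_least:
  assumes "submodule W complex_alg A" "S \<subseteq> W"
  shows "linear_span A S \<subseteq> W"
  using assms by (auto simp: linear_span_def)

lemma linear_span_superset: "S \<subseteq> linear_span A S"
  by (auto simp: linear_span_def)

lemma submodule_linear_span:
  assumes "complex_algebra A" "S \<subseteq> carrier A"
  shows "submodule (linear_span A S) complex_alg A"
proof -
  interpret complex_algebra A by fact
  have A: "submodule (carrier A) complex_alg A"
    by (rule carrier_is_submodule)
  have *: "submodule W complex_alg A \<Longrightarrow> \<zero>\<^bsub>A\<^esub> \<in> W" for W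
    using subgroup.one_closed[of W "add_monoid A"] by (simp add: submodule_def)
  show ?thesis
  proof (rule submoduleI)
    show "linear_span A S \<subseteq> carrier A"
      by (rule linear_span_least[OF A assms(2)])
  qed (auto simp: linear_span_def * submoduleE(3,4,5))
qed

text \<open>The product is bilinear, so stability of the span under multiplication has to be tested
  only on a spanning set \<open>G\<close> of the algebra and the spanning set \<open>S\<close> of
  the subspace.\<close>

lemma ideal_linear_span:
  fixes A (structure)
  assumes A: "complex_algebra A" and S: "S \<subseteq> carrier A"
    and G: "G \<subseteq> carrier A" and span: "carrier A \<subseteq> linear_span A G"
    and left: "\<And>g s. \<lbrakk>g \<in> G; s \<in> S\<rbrakk> \<Longrightarrow> g \<otimes> s \<in> linear_span A S"
    and right: "\<And>g s. \<lbrakk>g \<in> G; s \<in> S\<rbrakk> \<Longrightarrow> s \<otimes> g \<in> linear_span A S"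
  shows "ideal (linear_span A S) A"
proof -
  interpret complex_algebra A by fact
  let ?I = "linear_span A S"
  have I: "submodule ?I complex_alg A"
    by (rule submodule_linear_span[OF A S])
  note I' = submoduleE[OF I]
  have z: "\<zero> \<in> ?I"
    using I subgroup.one_closed[of ?I "add_monoid A"] by (simp add: submodule_def)
  \<comment> \<open>With \<open>g\<close> in \<open>G\<close> fixed, the elements that
    \<open>g\<close> multiplies into the span form a subspace; it contains \<open>S\<close>.\<close>
  have l1: "g \<otimes> x \<in> ?I" if "g \<in> G" "x \<in> ?I" for g x
  proof -
    have "submodule {x \<in> carrier A. g \<otimes> x \<in> ?I} complex_alg A"
      using that G by (intro submoduleI)
        (auto simp: r_distr smult_mult_right r_minus subset_iff I'(3,4,5) z)
    moreover have "S \<subseteq> {x \<in> carrier A. g \<otimes> x \<in> ?I}"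
      using left[OF that(1)] S by blast
    ultimately show ?thesis
      using linear_span_least[of "{x \<in> carrier A. g \<otimes> x \<in> ?I}" A S] that(2) by blast
  qed
  have r1: "x \<otimes> g \<in> ?I" if "g \<in> G" "x \<in> ?I" for g x
  proof -
    have "submodule {x \<in> carrier A. x \<otimes> g \<in> ?I} complex_alg A"
      using that G by (intro submoduleI)
        (auto simp: l_distr smult_mult_left l_minus subset_iff I'(3,4,5) z)
    moreover have "S \<subseteq> {x \<in> carrier A. x \<otimes> g \<in> ?I}"
      using right[OF that(1)] S by blast
    ultimately show ?thesis
      using linear_span_least[of "{x \<in> carrier A. x \<otimes> g \<in> ?I}" A S] that(2) by blast
  qed
  \<comment> \<open>Now \<open>x\<close> in the span is fixed and the multiplier varies: the
    admissible multipliers form a subspace, which contains \<open>G\<close> by \<open>l1\<close> and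
    hence is everything.\<close>
  have l2: "y \<otimes> x \<in> ?I" if "y \<in> carrier A" "x \<in> ?I" for x y
  proof -
    have "submodule {y \<in> carrier A. y \<otimes> x \<in> ?I} complex_alg A"
      using that I'(1) by (intro submoduleI)
        (auto simp: l_distr smult_mult_left l_minus subset_iff I'(3,4,5) z)
    moreover have "G \<subseteq> {y \<in> carrier A. y \<otimes> x \<in> ?I}"
      using l1[OF _ that(2)] G by blast
    ultimately show ?thesis
      using linear_span_least[of "{y \<in> carrier A. y \<otimes> x \<in> ?I}" A G] that(1) span by blast
  qed
  have r2: "x \<otimes> y \<in> ?I" if "y \<in> carrier A" "x \<in> ?I" for x y
  proof -
    have "submodule {y \<in> carrier A. x \<otimes> y \<in> ?I} complex_alg A"
      using that I'(1) by (intro submoduleI)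
        (auto simp: r_distr smult_mult_right r_minus subset_iff I'(3,4,5) z)
    moreover have "G \<subseteq> {y \<in> carrier A. x \<otimes> y \<in> ?I}"
      using r1[OF _ that(2)] G by blast
    ultimately show ?thesis
      using linear_span_least[of "{y \<in> carrier A. x \<otimes> y \<in> ?I}" A G] that(1) span by blast
  qed
  show ?thesis
    by (rule idealI[OF ring_A]) (use I in \<open>simp_all add: submodule_def l2 r2\<close>)
qed

section \<open>Monoid algebras\<close>

text \<open>Only singles at keys of the given \<open>f\<close> occur, so that the induction can be
  confined to the carrier of a monoid algebra.\<close>

lemma poly_mapping_induct [case_names zero single add]:
  fixes f :: "'m \<Rightarrow>\<^sub>0 'b::comm_monoid_add"
  assumes "P 0" "\<And>x c. x \<in> Poly_Mapping.keys f \<Longrightarrow> P (Poly_Mapping.single x c)"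
    and "\<And>g h. P g \<Longrightarrow> P h \<Longrightarrow> P (g + h)"
  shows "P f"
proof -
  have "P (\<Sum>x\<in>X. Poly_Mapping.single x (Poly_Mapping.lookup f x))"
    if "X \<subseteq> Poly_Mapping.keys f" for X
    using finite_subset[OF that finite_keys] that
    by (induction X) (auto intro: assms)
  moreover have "f = (\<Sum>x\<in>Poly_Mapping.keys f. Poly_Mapping.single x (Poly_Mapping.lookup f x))"
    by (rule poly_mapping_eqI)
      (auto simp: lookup_sum lookup_single when_def in_keys_iff)
  ultimately show ?thesis
    by (metis order_refl)
qed

lemma monoid_alg_simps [simp]:
  "f \<in> carrier (monoid_alg M) \<longleftrightarrow> Poly_Mapping.keys f \<subseteq> carrier M"
  "\<one>\<^bsub>monoid_alg M\<^esub> = Poly_Mapping.single \<one>\<^bsub>M\<^esub> 1"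
  "\<zero>\<^bsub>monoid_alg M\<^esub> = 0"
  "f \<oplus>\<^bsub>monoid_alg M\<^esub> g = f + g"
  by (simp_all add: monoid_alg_def)

lemma lookup_monoid_alg_smult [simp]:
  "Poly_Mapping.lookup (c \<odot>\<^bsub>monoid_alg M\<^esub> f) x = c * Poly_Mapping.lookup f x"
  by (simp add: monoid_alg_def Poly_Mapping.map.rep_eq when_def)

lemma keys_monoid_alg_smult:
  "Poly_Mapping.keys (c \<odot>\<^bsub>monoid_alg M\<^esub> f) \<subseteq> Poly_Mapping.keys f"
  by (auto simp: in_keys_iff)

lemma monoid_alg_smult_add:
  "c \<odot>\<^bsub>monoid_alg M\<^esub> (f + g) = c \<odot>\<^bsub>monoid_alg M\<^esub> f + c \<odot>\<^bsub>monoid_alg M\<^esub> g"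
  by (rule poly_mapping_eqI) (simp add: lookup_add algebra_simps)

lemma monoid_alg_smult_single [simp]:
  "c \<odot>\<^bsub>monoid_alg M\<^esub> Poly_Mapping.single x b = Poly_Mapping.single x (c * b)"
  by (rule poly_mapping_eqI) (simp add: lookup_single when_def)

text \<open>The defining sum runs over the keys of the factors, which change under addition and
  scaling. Summing over a common finite superset puts such products over the same index set.\<close>

lemma monoid_alg_mult_superset:
  assumes "finite X" "Poly_Mapping.keys f \<subseteq> X" "finite Y" "Poly_Mapping.keys g \<subseteq> Y"
  shows "f \<otimes>\<^bsub>monoid_alg M\<^esub> g = (\<Sum>x\<in>X. \<Sum>y\<in>Y.
    Poly_Mapping.single (x \<otimes>\<^bsub>M\<^esub> y) (Poly_Mapping.lookup f x * Poly_Mapping.lookup g y))"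
proof -
  have "f \<otimes>\<^bsub>monoid_alg M\<^esub> g = (\<Sum>x\<in>Poly_Mapping.keys f. \<Sum>y\<in>Y.
    Poly_Mapping.single (x \<otimes>\<^bsub>M\<^esub> y) (Poly_Mapping.lookup f x * Poly_Mapping.lookup g y))"
    using assms unfolding monoid_alg_def monoid.simps
    by (intro sum.cong sum.mono_neutral_left) (auto simp: in_keys_iff)
  also have "\<dots> = (\<Sum>x\<in>X. \<Sum>y\<in>Y.
    Poly_Mapping.single (x \<otimes>\<^bsub>M\<^esub> y) (Poly_Mapping.lookup f x * Poly_Mapping.lookup g y))"
    using assms by (intro sum.mono_neutral_left) (auto simp: in_keys_iff)
  finally show ?thesis .
qed

lemma monoid_alg_mult_single [simp]:
  "Poly_Mapping.single x a \<otimes>\<^bsub>monoid_alg M\<^esub> Poly_Mapping.single y b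
     = Poly_Mapping.single (x \<otimes>\<^bsub>M\<^esub> y) (a * b)"
  by (subst monoid_alg_mult_superset[of "{x}" _ "{y}"]) auto

lemma monoid_alg_distrib:
  shows "(f + g) \<otimes>\<^bsub>monoid_alg M\<^esub> h = f \<otimes>\<^bsub>monoid_alg M\<^esub> h + g \<otimes>\<^bsub>monoid_alg M\<^esub> h"
    and "h \<otimes>\<^bsub>monoid_alg M\<^esub> (f + g) = h \<otimes>\<^bsub>monoid_alg M\<^esub> f + h \<otimes>\<^bsub>monoid_alg M\<^esub> g"
proof -
  let ?X = "Poly_Mapping.keys f \<union> Poly_Mapping.keys g" and ?Y = "Poly_Mapping.keys h"
  have k: "finite ?X" "finite ?Y" "Poly_Mapping.keys f \<subseteq> ?X" "Poly_Mapping.keys g \<subseteq> ?X"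
    "Poly_Mapping.keys (f + g) \<subseteq> ?X" "?Y \<subseteq> ?Y"
    using keys_add[of f g] by auto
  show "(f + g) \<otimes>\<^bsub>monoid_alg M\<^esub> h = f \<otimes>\<^bsub>monoid_alg M\<^esub> h + g \<otimes>\<^bsub>monoid_alg M\<^esub> h"
    using k by (simp add: monoid_alg_mult_superset[of ?X _ ?Y] lookup_add distrib_right single_add
        sum.distrib)
  show "h \<otimes>\<^bsub>monoid_alg M\<^esub> (f + g) = h \<otimes>\<^bsub>monoid_alg M\<^esub> f + h \<otimes>\<^bsub>monoid_alg M\<^esub> g"
    using k by (simp add: monoid_alg_mult_superset[of ?Y _ ?X] lookup_add distrib_left single_add
        sum.distrib)
qed

lemma monoid_alg_mult_zero [simp]:
  "0 \<otimes>\<^bsub>monoid_alg M\<^esub> f = 0" "f \<otimes>\<^bsub>monoid_alg M\<^esub> 0 = 0"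
  by (simp_all add: monoid_alg_def)

lemma monoid_alg_mult_diff:
  shows "(f - g) \<otimes>\<^bsub>monoid_alg M\<^esub> h = f \<otimes>\<^bsub>monoid_alg M\<^esub> h - g \<otimes>\<^bsub>monoid_alg M\<^esub> h"
    and "h \<otimes>\<^bsub>monoid_alg M\<^esub> (f - g) = h \<otimes>\<^bsub>monoid_alg M\<^esub> f - h \<otimes>\<^bsub>monoid_alg M\<^esub> g"
  using monoid_alg_distrib[where M = M and f = "f - g" and g = g and h = h] by (simp_all add: eq_diff_eq)

lemma monoid_alg_induct [consumes 1, case_names zero single add]:
  assumes "f \<in> carrier (monoid_alg M)"
    and "P 0" "\<And>x c. x \<in> carrier M \<Longrightarrow> P (Poly_Mapping.single x c)"
    and "\<And>g h. \<lbrakk>g \<in> carrier (monoid_alg M); P g; h \<in> carrier (monoid_alg M); P h\<rbrakk> \<Longrightarrow> P (g + h)"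
  shows "P f"
proof -
  have "f \<in> carrier (monoid_alg M) \<and> P f"
  proof (rule poly_mapping_induct[of _ f])
    fix g h assume "g \<in> carrier (monoid_alg M) \<and> P g" "h \<in> carrier (monoid_alg M) \<and> P h"
    then show "g + h \<in> carrier (monoid_alg M) \<and> P (g + h)"
      using assms(4)[of g h] keys_add[of g h] by auto
  qed (use assms in auto)
  then show ?thesis
    by blast
qed

lemma keys_monoid_alg_mult:
  assumes "Group.monoid M" "Poly_Mapping.keys f \<subseteq> carrier M" "Poly_Mapping.keys g \<subseteq> carrier M"
  shows "Poly_Mapping.keys (f \<otimes>\<^bsub>monoid_alg M\<^esub> g) \<subseteq> carrier M"
proof -
  have "Poly_Mapping.keys (Poly_Mapping.single (x \<otimes>\<^bsub>M\<^esub> y)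
      (Poly_Mapping.lookup f x * Poly_Mapping.lookup g y)) \<subseteq> carrier M" if "x \<in> Poly_Mapping.keys f" "y \<in> Poly_Mapping.keys g" for x y
    using monoid.m_closed[OF assms(1), of x y] that assms(2,3)
    by (auto simp: subset_iff split: if_splits)
  then show ?thesis
    by (simp add: monoid_alg_def) (intro order_trans[OF keys_sum] UN_least; simp)
qed

lemma complex_algebra_monoid_alg:
  assumes "Group.monoid M"
  shows "complex_algebra (monoid_alg M)"
proof -
  interpret M: Group.monoid M by fact
  let ?A = "monoid_alg M"
  have closed: "f + g \<in> carrier ?A" if "f \<in> carrier ?A" "g \<in> carrier ?A" for f g
    using that keys_add[of f g] by auto
  \<comment> \<open>Both sides are trilinear, so three nested inductions lead to monomials, where
    the claim is associativity in \<open>M\<close>.\<close>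
  have assoc: "f \<otimes>\<^bsub>?A\<^esub> g \<otimes>\<^bsub>?A\<^esub> h = f \<otimes>\<^bsub>?A\<^esub> (g \<otimes>\<^bsub>?A\<^esub> h)"
    if f: "f \<in> carrier ?A" and g: "g \<in> carrier ?A" and h: "h \<in> carrier ?A" for f g h
    using f
  proof (induction f rule: monoid_alg_induct)
    case (single x a)
    show ?case
      using g
    proof (induction g rule: monoid_alg_induct)
      case (single y b)
      show ?case
        using h
      proof (induction h rule: monoid_alg_induct)
        case (single z c)
        then show ?case
          using \<open>x \<in> carrier M\<close> \<open>y \<in> carrier M\<close> by (simp add: M.m_assoc mult.assoc)
      qed (auto simp: monoid_alg_distrib)
    qed (auto simp: monoid_alg_distrib)
  qed (auto simp: monoid_alg_distrib)
  have one: "Poly_Mapping.single \<one>\<^bsub>M\<^esub> 1 \<otimes>\<^bsub>?A\<^esub> f = f" "f \<otimes>\<^bsub>?A\<^esub> Poly_Mapping.single \<one>\<^bsub>M\<^esub> 1 = f"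
    if "f \<in> carrier ?A" for f
    using that by (induction f rule: monoid_alg_induct) (auto simp: monoid_alg_distrib)
  have smult: "(c \<odot>\<^bsub>?A\<^esub> f) \<otimes>\<^bsub>?A\<^esub> g = c \<odot>\<^bsub>?A\<^esub> (f \<otimes>\<^bsub>?A\<^esub> g)" "f \<otimes>\<^bsub>?A\<^esub> (c \<odot>\<^bsub>?A\<^esub> g) = c \<odot>\<^bsub>?A\<^esub> (f \<otimes>\<^bsub>?A\<^esub> g)"
    for c f g
  proof -
    have k: "finite (Poly_Mapping.keys f)" "Poly_Mapping.keys f \<subseteq> Poly_Mapping.keys f"
      "finite (Poly_Mapping.keys g)" "Poly_Mapping.keys g \<subseteq> Poly_Mapping.keys g"
      "Poly_Mapping.keys (c \<odot>\<^bsub>?A\<^esub> f) \<subseteq> Poly_Mapping.keys f"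
      "Poly_Mapping.keys (c \<odot>\<^bsub>?A\<^esub> g) \<subseteq> Poly_Mapping.keys g"
      by (simp_all add: keys_monoid_alg_smult)
    have sum: "c \<odot>\<^bsub>?A\<^esub> (\<Sum>i\<in>I. F i) = (\<Sum>i\<in>I. c \<odot>\<^bsub>?A\<^esub> F i)" if "finite I" for I and F :: "'i \<Rightarrow> _"
      using that
    proof induction
      case empty
      show ?case by (rule poly_mapping_eqI) simp
    qed (auto simp: monoid_alg_smult_add)
    show "(c \<odot>\<^bsub>?A\<^esub> f) \<otimes>\<^bsub>?A\<^esub> g = c \<odot>\<^bsub>?A\<^esub> (f \<otimes>\<^bsub>?A\<^esub> g)" "f \<otimes>\<^bsub>?A\<^esub> (c \<odot>\<^bsub>?A\<^esub> g) = c \<odot>\<^bsub>?A\<^esub> (f \<otimes>\<^bsub>?A\<^esub> g)"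
      using k
      by (simp_all add: monoid_alg_mult_superset[of "Poly_Mapping.keys f" _ "Poly_Mapping.keys g"]
          sum mult_ac)
  qed
  show ?thesis
  proof (rule complex_algebraI)
    show "ring ?A"
    proof (rule ringI)
      show "abelian_group ?A"
      proof (rule abelian_groupI)
        fix f assume "f \<in> carrier ?A"
        then show "\<exists>g\<in>carrier ?A. g \<oplus>\<^bsub>?A\<^esub> f = \<zero>\<^bsub>?A\<^esub>"
          by (intro bexI[of _ "- f"]) auto
      qed (use closed in \<open>auto simp: algebra_simps simp del: monoid_alg_simps(1)\<close>, simp_all)
      show "Group.monoid ?A"
        using assoc one keys_monoid_alg_mult[OF assms] by (intro monoidI) auto
    qed (auto simp: monoid_alg_distrib)
  next
    fix c f assume "f \<in> carrier ?A"
    then show "c \<odot>\<^bsub>?A\<^esub> f \<in> carrier ?A"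
      using keys_monoid_alg_smult[where M = M] by auto
  qed (auto simp: smult monoid_alg_smult_add intro!: poly_mapping_eqI
      simp: lookup_add algebra_simps)
qed

text \<open>This is literally the sum inside \<open>tensor_lift\<close>, so that the same facts
  serve free algebras and tensor products.\<close>

definition linear_extension ::
  "(complex, 'b) module \<Rightarrow> ('m \<Rightarrow> 'b) \<Rightarrow> ('m \<Rightarrow>\<^sub>0 complex) \<Rightarrow> 'b" where
  "linear_extension B \<phi> f =
     (\<Oplus>\<^bsub>B\<^esub>x\<in>Poly_Mapping.keys f. Poly_Mapping.lookup f x \<odot>\<^bsub>B\<^esub> \<phi> x)"

lemma linear_extension_superset:
  assumes "complex_algebra B" "\<phi> \<in> X \<rightarrow> carrier B" "finite X" "Poly_Mapping.keys f \<subseteq> X"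
  shows "linear_extension B \<phi> f = (\<Oplus>\<^bsub>B\<^esub>x\<in>X. Poly_Mapping.lookup f x \<odot>\<^bsub>B\<^esub> \<phi> x)"
proof -
  interpret B: complex_algebra B by fact
  show ?thesis
    unfolding linear_extension_def
    using assms(2-) by (intro B.add.finprod_mono_neutral_cong_left) (auto simp: in_keys_iff Pi_def)
qed

lemma linear_extension_lin_hom:
  assumes B: "complex_algebra B" and \<phi>: "\<phi> \<in> carrier M \<rightarrow> carrier B"
  shows "linear_extension B \<phi> \<in> lin_hom (monoid_alg M) B"
proof -
  interpret B: complex_algebra B by fact
  show ?thesis
  proof (rule lin_homI)
    fix f assume "f \<in> carrier (monoid_alg M)"
    then show "linear_extension B \<phi> f \<in> carrier B"
      unfolding linear_extension_def using \<phi> by (intro B.finsum_closed) (auto simp: Pi_def subset_iff)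
  next
    fix f g assume fg: "f \<in> carrier (monoid_alg M)" "g \<in> carrier (monoid_alg M)"
    let ?X = "Poly_Mapping.keys f \<union> Poly_Mapping.keys g"
    have k: "\<phi> \<in> ?X \<rightarrow> carrier B" "finite ?X" "Poly_Mapping.keys f \<subseteq> ?X" "Poly_Mapping.keys g \<subseteq> ?X"
      "Poly_Mapping.keys (f + g) \<subseteq> ?X"
      using keys_add[of f g] fg \<phi> by auto
    have "linear_extension B \<phi> (f + g)
        = (\<Oplus>\<^bsub>B\<^esub>x\<in>?X. Poly_Mapping.lookup f x \<odot>\<^bsub>B\<^esub> \<phi> x \<oplus>\<^bsub>B\<^esub> Poly_Mapping.lookup g x \<odot>\<^bsub>B\<^esub> \<phi> x)"
      unfolding linear_extension_superset[OF B k(1,2,5)]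
      using k(1) by (intro B.finsum_cong') (auto simp: lookup_add B.smult_add_left Pi_def)
    also have "\<dots> = linear_extension B \<phi> f \<oplus>\<^bsub>B\<^esub> linear_extension B \<phi> g"
      unfolding linear_extension_superset[OF B k(1,2,3)] linear_extension_superset[OF B k(1,2,4)]
      using k(1) by (intro B.finsum_addf) auto
    finally show "linear_extension B \<phi> (f \<oplus>\<^bsub>monoid_alg M\<^esub> g)
        = linear_extension B \<phi> f \<oplus>\<^bsub>B\<^esub> linear_extension B \<phi> g"
      by simp
  next
    fix c f assume f: "f \<in> carrier (monoid_alg M)"
    have "linear_extension B \<phi> (c \<odot>\<^bsub>monoid_alg M\<^esub> f)
        = (\<Oplus>\<^bsub>B\<^esub>x\<in>Poly_Mapping.keys f. c \<odot>\<^bsub>B\<^esub> (Poly_Mapping.lookup f x \<odot>\<^bsub>B\<^esub> \<phi> x))"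
      using f \<phi>
      by (subst linear_extension_superset[OF B _ finite_keys keys_monoid_alg_smult])
        (auto intro!: B.finsum_cong' simp: B.smult_smult Pi_def subset_iff)
    also have "\<dots> = c \<odot>\<^bsub>B\<^esub> linear_extension B \<phi> f"
      unfolding linear_extension_def using f \<phi>
      by (subst B.smult_finsum) (auto simp: Pi_def subset_iff)
    finally show "linear_extension B \<phi> (c \<odot>\<^bsub>monoid_alg M\<^esub> f) = c \<odot>\<^bsub>B\<^esub> linear_extension B \<phi> f" .
  qed
qed

lemma linear_extension_single:
  assumes "complex_algebra B" "\<phi> x \<in> carrier B"
  shows "linear_extension B \<phi> (Poly_Mapping.single x c) = c \<odot>\<^bsub>B\<^esub> \<phi> x"
proof -
  interpret B: complex_algebra B by fact
  show ?thesis
    using assms(2) by (subst linear_extension_superset[OF assms(1), of _ "{x}"]) auto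
qed

text \<open>Multiplicativity is bilinear in the two factors and therefore only concerns monomials,
  where it is the assumption that \<open>\<phi>\<close> is a monoid homomorphism.\<close>

lemma linear_extension_alg_hom:
  assumes B: "complex_algebra B" and M: "Group.monoid M" and \<phi>: "\<phi> \<in> carrier M \<rightarrow> carrier B"
    and mult: "\<And>x y. \<lbrakk>x \<in> carrier M; y \<in> carrier M\<rbrakk> \<Longrightarrow> \<phi> (x \<otimes>\<^bsub>M\<^esub> y) = \<phi> x \<otimes>\<^bsub>B\<^esub> \<phi> y"
    and one: "\<phi> \<one>\<^bsub>M\<^esub> = \<one>\<^bsub>B\<^esub>"
  shows "linear_extension B \<phi> \<in> alg_hom (monoid_alg M) B"
proof -
  interpret M: Group.monoid M by fact
  let ?e = "linear_extension B \<phi>" and ?A = "monoid_alg M"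
  interpret linear_map ?A B ?e
    by (intro linear_map.intro linear_map_axioms.intro complex_algebra_monoid_alg
        linear_extension_lin_hom B M \<phi>)
  have single': "?e (Poly_Mapping.single x c) = c \<odot>\<^bsub>B\<^esub> \<phi> x" if "x \<in> carrier M" for x c
    using that \<phi> by (intro linear_extension_single B) auto
  have add': "?e (f + g) = ?e f \<oplus>\<^bsub>B\<^esub> ?e g" if "f \<in> carrier ?A" "g \<in> carrier ?A" for f g
    using map_add[OF that] by simp
  have \<phi>': "x \<in> carrier M \<Longrightarrow> \<phi> x \<in> carrier B" for x
    using \<phi> by auto
  have "?e (f \<otimes>\<^bsub>?A\<^esub> g) = ?e f \<otimes>\<^bsub>B\<^esub> ?e g" if f: "f \<in> carrier ?A" and g: "g \<in> carrier ?A" for f g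
    using f
  proof (induction f rule: monoid_alg_induct)
    case zero
    then show ?case
      using g map_zero by simp
  next
    case (single x a)
    show ?case
      using g
    proof (induction g rule: monoid_alg_induct)
      case zero
      then show ?case
        using single map_zero by (simp add: \<phi>' B.smult_closed)
    next
      case (single y b)
      then show ?case
        using \<open>x \<in> carrier M\<close>
        by (simp add: single' mult \<phi>' B.smult_mult_left B.smult_mult_right B.smult_smult mult.commute)
    next
      case (add g h)
      then show ?case
        using A.m_closed[of "Poly_Mapping.single x a"] single map_closed add'
        by (simp add: monoid_alg_distrib B.r_distr)
    qed
  next
    case (add f h)
    then show ?case
      using A.m_closed[OF _ g] map_closed g add' by (simp add: monoid_alg_distrib B.l_distr)
  qed
  then show ?thesis
    using lin_hom single'[of "\<one>\<^bsub>M\<^esub>" 1] one B.one_closed by (auto simp: alg_hom_iff_lin_hom)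
qed

section \<open>Quotients and presentations\<close>

locale quotient_by_ideal = A?: complex_algebra A + I?: ideal I A
  for A :: "(complex, 'a) module" (structure) and I
begin

abbreviation "Q \<equiv> quot_alg A I"

lemma coset_eq_iff:
  "\<lbrakk>x \<in> carrier A; y \<in> carrier A\<rbrakk> \<Longrightarrow> I +> x = I +> y \<longleftrightarrow> x \<ominus> y \<in> I"
  using A.quotient_eq_iff_same_a_r_cos[OF is_ideal] by blast

lemma carrier_quot: "carrier Q = (\<lambda>x. I +> x) ` carrier A"
  by (auto simp: quot_alg_def FactRing_simps)

lemma coset_closed [simp]: "x \<in> carrier A \<Longrightarrow> I +> x \<in> carrier Q"
  by (simp add: carrier_quot)

lemma coset_cases:
  assumes "X \<in> carrier Q"
  obtains x where "x \<in> carrier A" "X = I +> x"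
  using assms by (auto simp: carrier_quot)

lemma zero_quot: "\<zero>\<^bsub>Q\<^esub> = I +> \<zero>"
  by (simp add: quot_alg_def FactRing_def a_coset_add_zero a_subset)

lemma one_quot: "\<one>\<^bsub>Q\<^esub> = I +> \<one>"
  by (simp add: quot_alg_def FactRing_def)

lemma add_quot: "\<lbrakk>x \<in> carrier A; y \<in> carrier A\<rbrakk> \<Longrightarrow> (I +> x) \<oplus>\<^bsub>Q\<^esub> (I +> y) = I +> (x \<oplus> y)"
  by (simp add: quot_alg_def FactRing_def a_rcos_sum)

lemma mult_quot: "\<lbrakk>x \<in> carrier A; y \<in> carrier A\<rbrakk> \<Longrightarrow> (I +> x) \<otimes>\<^bsub>Q\<^esub> (I +> y) = I +> (x \<otimes> y)"
  by (simp add: quot_alg_def FactRing_def rcoset_mult_add)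

lemma coset_elem:
  assumes "x \<in> carrier A" "z \<in> I +> x"
  obtains i where "i \<in> I" "z = i \<oplus> x"
  using assms by (auto simp: a_r_coset_def')

text \<open>A scalar multiple of a coset is defined as a union over all its representatives. As the
  ideal absorbs scalars, each representative contributes the same coset and the union is that
  coset.\<close>

lemma smult_quot:
  assumes x: "x \<in> carrier A"
  shows "c \<odot>\<^bsub>Q\<^esub> (I +> x) = I +> (c \<odot> x)"
proof -
  have "I +> (c \<odot> z) = I +> (c \<odot> x)" if z: "z \<in> I +> x" for z
  proof -
    obtain i where i: "i \<in> I" "z = i \<oplus> x"
      by (rule coset_elem[OF x z])
    then have "c \<odot> z \<in> I +> (c \<odot> x)"
      using A.smult_ideal[OF is_ideal i(1), of c] x
      by (auto simp: a_r_coset_def' A.smult_add_right a_Hcarr)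
    then show ?thesis
      using x by (intro a_repr_independence'[symmetric]) auto
  qed
  then have "(\<Union>z\<in>I +> x. I +> (c \<odot> z)) = (\<Union>z\<in>I +> x. I +> (c \<odot> x))"
    by (rule SUP_cong[OF refl])
  moreover have "x \<in> I +> x"
    using x by (rule a_rcos_self)
  ultimately show ?thesis
    by (auto simp: quot_alg_def)
qed

lemmas quot_simps = zero_quot one_quot add_quot mult_quot smult_quot

lemma complex_algebra_quot: "complex_algebra Q"
proof (rule complex_algebraI)
  show "ring Q"
  proof (rule ringI)
    show "abelian_group Q"
    proof (rule abelian_groupI)
      fix X Y assume "X \<in> carrier Q" "Y \<in> carrier Q"
      then show "X \<oplus>\<^bsub>Q\<^esub> Y \<in> carrier Q" "X \<oplus>\<^bsub>Q\<^esub> Y = Y \<oplus>\<^bsub>Q\<^esub> X"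
        by (auto simp: carrier_quot add_quot A.M.a_comm)
    next
      fix X assume "X \<in> carrier Q"
      then obtain x where "x \<in> carrier A" "X = I +> x"
        by (rule coset_cases)
      then show "\<exists>Y\<in>carrier Q. Y \<oplus>\<^bsub>Q\<^esub> X = \<zero>\<^bsub>Q\<^esub>"
        by (intro bexI[of _ "I +> \<ominus> x"]) (auto simp: quot_simps A.M.l_neg)
    qed (auto simp: carrier_quot zero_quot add_quot A.M.a_assoc)
    show "Group.monoid Q"
      by (rule monoidI) (auto simp: carrier_quot one_quot mult_quot A.m_assoc)
  qed (auto simp: carrier_quot add_quot mult_quot A.l_distr A.r_distr)
qed (auto simp: carrier_quot add_quot mult_quot smult_quot A.smult_add_left A.smult_add_right
      A.smult_smult A.smult_mult_left A.smult_mult_right)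

lemma coset_alg_hom: "(\<lambda>x. I +> x) \<in> alg_hom A Q"
  by (auto simp: alg_hom_def ring_hom_def quot_simps)

lemma coset_eq_zero_iff: "x \<in> carrier A \<Longrightarrow> I +> x = \<zero>\<^bsub>Q\<^esub> \<longleftrightarrow> x \<in> I"
  using coset_eq_iff[of x \<zero>] by (simp add: zero_quot a_minus_def)

end

text \<open>Meaningful only when \<open>f\<close> is constant on \<open>X\<close>; the locale
  \<open>quotient_map\<close> guarantees this by letting a linear \<open>f\<close> vanish on the
  ideal.\<close>

definition coset_map :: "('a \<Rightarrow> 'b) \<Rightarrow> 'a set \<Rightarrow> 'b" where
  "coset_map f X = the_elem (f ` X)"

locale quotient_map = quotient_by_ideal A I + B?: complex_algebra B
  for A :: "(complex, 'a) module" (structure) and I and B :: "(complex, 'b) module" (structure) +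
  fixes f
  assumes lin: "f \<in> lin_hom A B" and kills: "\<And>x. x \<in> I \<Longrightarrow> f x = \<zero>\<^bsub>B\<^esub>"
begin

lemma coset_map_coset:
  assumes x: "x \<in> carrier A"
  shows "coset_map f (I +> x) = f x"
proof -
  have "f z = f x" if z: "z \<in> I +> x" for z
  proof -
    obtain i where "i \<in> I" "z = i \<oplus> x"
      by (rule coset_elem[OF x z])
    then show ?thesis
      using x by (simp add: lin_homD[OF lin] kills)
  qed
  then have "f ` (I +> x) = (\<lambda>z. f x) ` (I +> x)"
    by (rule image_cong[OF refl])
  also have "\<dots> = {f x}"
    using a_rcos_self[OF x] by auto
  finally have "f ` (I +> x) = {f x}" .
  then show ?thesis
    by (simp add: coset_map_def)
qed

lemma coset_map_lin_hom: "coset_map f \<in> lin_hom Q B"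
  by (rule lin_homI)
    (auto simp: carrier_quot add_quot smult_quot coset_map_coset lin_homD[OF lin])

lemma coset_map_alg_hom: "f \<in> alg_hom A B \<Longrightarrow> coset_map f \<in> alg_hom Q B"
  using coset_map_lin_hom
  by (auto simp: alg_hom_iff_lin_hom carrier_quot one_quot mult_quot coset_map_coset)

end

section \<open>Free algebras and the universal property of a presentation\<close>

lemma carrier_free_alg [simp]: "f \<in> carrier free_alg"
  by (simp add: free_alg_def)

lemma monoid_list: "Group.monoid \<lparr>carrier = UNIV, mult = (@), one = []\<rparr>"
  by (rule monoidI) auto

lemma complex_algebra_free_alg: "complex_algebra free_alg"
  unfolding free_alg_def by (rule complex_algebra_monoid_alg[OF monoid_list])

text \<open>A word is the product of its letters, so the unit and the generators yield everything
  under exactly those operations that homomorphisms preserve.\<close>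

lemma free_alg_induct [case_names one gen add smult mult]:
  assumes "P \<one>\<^bsub>free_alg\<^esub>" "\<And>x. P (free_gen x)"
    and "\<And>f g. P f \<Longrightarrow> P g \<Longrightarrow> P (f \<oplus>\<^bsub>free_alg\<^esub> g)" "\<And>c f. P f \<Longrightarrow> P (c \<odot>\<^bsub>free_alg\<^esub> f)"
    and "\<And>f g. P f \<Longrightarrow> P g \<Longrightarrow> P (f \<otimes>\<^bsub>free_alg\<^esub> g)"
  shows "P f"
proof (induction f rule: poly_mapping_induct)
  case zero
  show ?case
    using assms(4)[OF assms(1), of 0] by (simp add: free_alg_def)
next
  case (single xs c)
  have "P (Poly_Mapping.single xs 1)"
  proof (induction xs)
    case Nil
    show ?case
      using assms(1) by (simp add: free_alg_def)
  next
    case (Cons x xs)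
    show ?case
      using assms(5)[OF assms(2)[of x] Cons] by (simp add: free_alg_def free_gen_def)
  qed
  then show ?case
    using assms(4)[of "Poly_Mapping.single xs 1" c] by (simp add: free_alg_def)
next
  case (add g h)
  then show ?case
    using assms(3) by (simp add: free_alg_def)
qed

lemma quotient_presented:
  fixes S :: "('x list \<Rightarrow>\<^sub>0 complex) set"
  shows "quotient_by_ideal free_alg (Idl\<^bsub>free_alg\<^esub> S)"
proof -
  interpret complex_algebra "free_alg :: (complex, 'x list \<Rightarrow>\<^sub>0 complex) module"
    by (rule complex_algebra_free_alg)
  show ?thesis
    by (intro quotient_by_ideal.intro complex_algebra_free_alg genideal_ideal) auto
qed

lemma complex_algebra_presented_alg: "complex_algebra (presented_alg S)"
  unfolding presented_alg_def by (rule quotient_by_ideal.complex_algebra_quot[OF quotient_presented])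

definition presented_proj :: "('x list \<Rightarrow>\<^sub>0 complex) set \<Rightarrow> ('x list \<Rightarrow>\<^sub>0 complex) \<Rightarrow> ('x list \<Rightarrow>\<^sub>0 complex) set"
  where "presented_proj S f = Idl\<^bsub>free_alg\<^esub> S +>\<^bsub>free_alg\<^esub> f"

lemma presented_proj_alg_hom: "presented_proj S \<in> alg_hom free_alg (presented_alg S)"
  unfolding presented_proj_def presented_alg_def
  by (rule quotient_by_ideal.coset_alg_hom[OF quotient_presented])

lemma presented_proj_free_gen: "presented_proj S (free_gen x) = presented_gen S x"
  by (simp add: presented_proj_def presented_gen_def)

lemma presented_proj_rel:
  fixes S :: "('x list \<Rightarrow>\<^sub>0 complex) set"
  assumes "r \<in> S"
  shows "presented_proj S r = \<zero>\<^bsub>presented_alg S\<^esub>"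
proof -
  interpret complex_algebra "free_alg :: (complex, 'x list \<Rightarrow>\<^sub>0 complex) module"
    by (rule complex_algebra_free_alg)
  have "r \<in> Idl\<^bsub>free_alg\<^esub> S"
    using genideal_self[of S] assms by (auto simp: subset_iff)
  then show ?thesis
    unfolding presented_proj_def presented_alg_def
    by (simp add: quotient_by_ideal.coset_eq_zero_iff[OF quotient_presented])
qed

lemma presented_gen_closed [simp]: "presented_gen S x \<in> carrier (presented_alg S)"
  unfolding presented_proj_free_gen[symmetric]
  by (rule lin_homD(1)[OF alg_homD(1)[OF presented_proj_alg_hom]]) simp

lemma presented_alg_cases:
  assumes "X \<in> carrier (presented_alg S)"
  obtains f where "X = presented_proj S f"
  using quotient_by_ideal.coset_cases[OF quotient_presented] assms
  unfolding presented_proj_def presented_alg_def by metis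

text \<open>Both maps are composed with the projection from the free algebra and compared there by
  \<open>free_alg_induct\<close>. Besides uniqueness in the universal property, this gives the
  reduction of every coassociativity and counit axiom to generators.\<close>

lemma alg_hom_eq_on_generators:
  assumes B: "complex_algebra B" and f: "f \<in> alg_hom (presented_alg S) B"
    and g: "g \<in> alg_hom (presented_alg S) B"
    and eq: "\<And>x. f (presented_gen S x) = g (presented_gen S x)"
    and X: "X \<in> carrier (presented_alg S)"
  shows "f X = g X"
proof -
  obtain u where u: "X = presented_proj S u"
    using presented_alg_cases[OF X] .
  note f' = alg_hom_comp[OF presented_proj_alg_hom f] and g' = alg_hom_comp[OF presented_proj_alg_hom g]
  have "f (presented_proj S u) = g (presented_proj S u)"
    by (induction u rule: free_alg_induct)
      (simp_all add: eq presented_proj_free_gen alg_homD(2,3)[OF f'] alg_homD(2,3)[OF g']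
        lin_homD[OF alg_homD(1)[OF f']] lin_homD[OF alg_homD(1)[OF g']])
  then show ?thesis
    using u by simp
qed

definition free_hom :: "(complex, 'b) module \<Rightarrow> ('x \<Rightarrow> 'b) \<Rightarrow> ('x list \<Rightarrow>\<^sub>0 complex) \<Rightarrow> 'b" where
  "free_hom B h = linear_extension B (\<lambda>xs. foldr (\<lambda>x y. h x \<otimes>\<^bsub>B\<^esub> y) xs \<one>\<^bsub>B\<^esub>)"

lemma
  assumes B: "complex_algebra B" and h: "\<And>x. h x \<in> carrier B"
  shows free_hom_alg_hom: "free_hom B h \<in> alg_hom free_alg B"
    and free_hom_free_gen: "free_hom B h (free_gen x) = h x"
proof -
  interpret B: complex_algebra B by fact
  let ?\<phi> = "\<lambda>xs. foldr (\<lambda>x y. h x \<otimes>\<^bsub>B\<^esub> y) xs \<one>\<^bsub>B\<^esub>"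
  have closed: "?\<phi> xs \<in> carrier B" for xs
    by (induction xs) (auto simp: h)
  have "?\<phi> (xs @ ys) = ?\<phi> xs \<otimes>\<^bsub>B\<^esub> ?\<phi> ys" for xs ys
    by (induction xs) (use closed in \<open>auto simp: h B.m_assoc\<close>)
  then show "free_hom B h \<in> alg_hom free_alg B"
    unfolding free_hom_def free_alg_def using closed
    by (intro linear_extension_alg_hom B monoid_list) (auto simp del: foldr_append)
  show "free_hom B h (free_gen x) = h x"
    unfolding free_hom_def free_gen_def by (simp add: linear_extension_single B h)
qed

text \<open>The kernel of \<open>free_hom\<close> is an ideal containing the relations, hence
  contains the ideal they generate, and the map descends to the quotient.\<close>

lemma extends_to_hom_presented:
  fixes S :: "('x list \<Rightarrow>\<^sub>0 complex) set"
  assumes B: "complex_algebra B" and h: "\<And>x. h x \<in> carrier B"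
    and rels: "\<And>r. r \<in> S \<Longrightarrow> free_hom B h r = \<zero>\<^bsub>B\<^esub>"
  shows "\<exists>!f. extends_to_hom (presented_alg S) B (presented_gen S) h f"
proof -
  let ?I = "Idl\<^bsub>free_alg\<^esub> S"
  interpret F: complex_algebra "free_alg :: (complex, 'x list \<Rightarrow>\<^sub>0 complex) module"
    by (rule complex_algebra_free_alg)
  note hom = free_hom_alg_hom[where h = h, OF B h]
  have "?I \<subseteq> {u \<in> carrier free_alg. free_hom B h u = \<zero>\<^bsub>B\<^esub>}"
    by (intro F.genideal_minimal ideal_alg_kernel complex_algebra_free_alg B hom) (auto simp: rels)
  then interpret quotient_map free_alg ?I B "free_hom B h"
    by (intro quotient_map.intro quotient_presented B quotient_map_axioms.intro alg_homD(1)[OF hom]) auto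
  \<comment> \<open>Restricting to the carrier makes the map extensional, so that agreement on the
    carrier amounts to equality of functions.\<close>
  let ?f = "restrict (coset_map (free_hom B h)) (carrier (presented_alg S))"
  have P: "complex_algebra (presented_alg S)"
    by (rule complex_algebra_presented_alg)
  have "?f \<in> alg_hom (presented_alg S) B"
    by (rule alg_hom_cong[OF P coset_map_alg_hom[OF hom, folded presented_alg_def]]) simp
  moreover have "?f (presented_gen S x) = h x" for x
    using coset_map_coset[of "free_gen x"] free_hom_free_gen[where h = h, OF B h]
    by (simp add: presented_gen_def[symmetric])
  ultimately have "extends_to_hom (presented_alg S) B (presented_gen S) h ?f"
    by (auto simp: extends_to_hom_def)
  moreover have "f = g" if "extends_to_hom (presented_alg S) B (presented_gen S) h f"
    "extends_to_hom (presented_alg S) B (presented_gen S) h g" for f g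
    using that alg_hom_eq_on_generators[OF B, of f S g]
    by (auto simp: extends_to_hom_def intro: extensionalityI)
  ultimately show ?thesis
    by blast
qed

lemma extends_to_hom_induced_hom:
  assumes "\<exists>!f. extends_to_hom A B g h f"
  shows "induced_hom A B g h \<in> alg_hom A B" "induced_hom A B g h (g x) = h x"
  using theI'[OF assms] by (auto simp: induced_hom_def extends_to_hom_def)

section \<open>Tensor products\<close>

lemma lin_hom_cong:
  assumes "complex_algebra A" "f \<in> lin_hom A B" "\<And>x. x \<in> carrier A \<Longrightarrow> f x = g x"
  shows "g \<in> lin_hom A B"
proof -
  interpret complex_algebra A by fact
  show ?thesis
    using assms(2) by (auto simp: lin_hom_def Pi_def simp flip: assms(3))
qed

lemma lin_hom_add:
  assumes "complex_algebra B" "f \<in> lin_hom A B" "g \<in> lin_hom A B"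
  shows "(\<lambda>x. f x \<oplus>\<^bsub>B\<^esub> g x) \<in> lin_hom A B"
proof -
  interpret complex_algebra B by fact
  show ?thesis
    using lin_homD[OF assms(2)] lin_homD[OF assms(3)]
    by (intro lin_homI) (auto simp: smult_add_right a_ac)
qed

section \<open>The tensor product of two algebras and its universal property\<close>

definition bilin ::
  "(complex, 'a) module \<Rightarrow> (complex, 'b) module \<Rightarrow> (complex, 'c) module \<Rightarrow> ('a \<Rightarrow> 'b \<Rightarrow> 'c) \<Rightarrow> bool"
  where "bilin A B M \<beta> \<longleftrightarrow>
    (\<forall>y\<in>carrier B. (\<lambda>x. \<beta> x y) \<in> lin_hom A M) \<and> (\<forall>x\<in>carrier A. \<beta> x \<in> lin_hom B M)"

lemma bilinD:
  assumes "bilin A B M \<beta>"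
  shows "y \<in> carrier B \<Longrightarrow> (\<lambda>x. \<beta> x y) \<in> lin_hom A M" "x \<in> carrier A \<Longrightarrow> \<beta> x \<in> lin_hom B M"
    and "\<lbrakk>x \<in> carrier A; y \<in> carrier B\<rbrakk> \<Longrightarrow> \<beta> x y \<in> carrier M"
  using assms by (auto simp: bilin_def lin_hom_def)

lemma bilinear_rels_intros:
  "\<lbrakk>x \<in> carrier A; x' \<in> carrier A; y \<in> carrier B\<rbrakk> \<Longrightarrow>
    Poly_Mapping.single (x \<oplus>\<^bsub>A\<^esub> x', y) 1 - Poly_Mapping.single (x, y) 1
      - Poly_Mapping.single (x', y) 1 \<in> bilinear_rels A B"
  "\<lbrakk>x \<in> carrier A; y \<in> carrier B; y' \<in> carrier B\<rbrakk> \<Longrightarrow>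
    Poly_Mapping.single (x, y \<oplus>\<^bsub>B\<^esub> y') 1 - Poly_Mapping.single (x, y) 1
      - Poly_Mapping.single (x, y') 1 \<in> bilinear_rels A B"
  "\<lbrakk>x \<in> carrier A; y \<in> carrier B\<rbrakk> \<Longrightarrow>
    Poly_Mapping.single (c \<odot>\<^bsub>A\<^esub> x, y) 1 - Poly_Mapping.single (x, y) c \<in> bilinear_rels A B"
  "\<lbrakk>x \<in> carrier A; y \<in> carrier B\<rbrakk> \<Longrightarrow>
    Poly_Mapping.single (x, c \<odot>\<^bsub>B\<^esub> y) 1 - Poly_Mapping.single (x, y) c \<in> bilinear_rels A B"
  unfolding bilinear_rels_def by blast+

lemma bilinear_rels_cases:
  assumes "r \<in> bilinear_rels A B"
  obtains x x' y where "r = Poly_Mapping.single (x \<oplus>\<^bsub>A\<^esub> x', y) 1 - Poly_Mapping.single (x, y) 1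
      - Poly_Mapping.single (x', y) 1" "x \<in> carrier A" "x' \<in> carrier A" "y \<in> carrier B"
  | x y y' where "r = Poly_Mapping.single (x, y \<oplus>\<^bsub>B\<^esub> y') 1 - Poly_Mapping.single (x, y) 1
      - Poly_Mapping.single (x, y') 1" "x \<in> carrier A" "y \<in> carrier B" "y' \<in> carrier B"
  | c x y where "r = Poly_Mapping.single (c \<odot>\<^bsub>A\<^esub> x, y) 1 - Poly_Mapping.single (x, y) c"
      "x \<in> carrier A" "y \<in> carrier B"
  | c x y where "r = Poly_Mapping.single (x, c \<odot>\<^bsub>B\<^esub> y) 1 - Poly_Mapping.single (x, y) c"
      "x \<in> carrier A" "y \<in> carrier B"
  using assms unfolding bilinear_rels_def by blast

lemma tensor_lift_eq_coset_map:
  "tensor_lift A B M \<beta> = coset_map (linear_extension M (\<lambda>p. \<beta> (fst p) (snd p)))"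
  by (simp add: fun_eq_iff tensor_lift_def coset_map_def linear_extension_def)

context
  fixes A :: "(complex, 'a) module" and B :: "(complex, 'b) module"
  assumes A: "complex_algebra A" and B: "complex_algebra B"
begin

interpretation A: complex_algebra A by (rule A)
interpretation B: complex_algebra B by (rule B)

private abbreviation (input) "F \<equiv> monoid_alg (A \<times>\<times> B)"
private abbreviation (input) "pt \<equiv> pure_tensor A B"

private lemma monoid_AB: "Group.monoid (A \<times>\<times> B)"
  by (rule DirProd_monoid) (rule A.monoid_axioms B.monoid_axioms)+

interpretation F: complex_algebra F
  by (rule complex_algebra_monoid_alg[OF monoid_AB])

text \<open>The negation of the record is a definite description inside the carrier, whereas the
  bilinearity relations use the subtraction of polynomial mappings; the two have to be
  reconciled.\<close>

private lemma minus_F: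
  assumes "Poly_Mapping.keys f \<subseteq> carrier A \<times> carrier B" "Poly_Mapping.keys g \<subseteq> carrier A \<times> carrier B"
  shows "f \<ominus>\<^bsub>F\<^esub> g = f - g"
proof -
  have "\<ominus>\<^bsub>F\<^esub> g = - g"
    using assms by (intro F.minus_equality) auto
  then show ?thesis
    by (simp add: a_minus_def)
qed

lemma bilinear_rels_carrier: "bilinear_rels A B \<subseteq> carrier F"
proof -
  have "f - g \<in> carrier F" if "f \<in> carrier F" "g \<in> carrier F" for f g
    using that minus_F[of f g] F.minus_closed[OF that] by simp
  then show ?thesis
    by (auto simp only: bilinear_rels_def) (auto simp: A.smult_closed B.smult_closed)
qed

text \<open>Multiplying a bilinearity relation by a basis pair \<open>(u, v)\<close> yields a
  bilinearity relation again, by distributivity and the scalar laws in \<open>A\<close> and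
  \<open>B\<close>. Thus the span used for the underlying vector space is a two-sided ideal.\<close>

lemma quotient_tensor: "quotient_by_ideal F (tensor_null A B)"
proof -
  let ?G = "{Poly_Mapping.single p (1 :: complex) | p. p \<in> carrier (A \<times>\<times> B)}"
  let ?S = "bilinear_rels A B"
  have G: "?G \<subseteq> carrier F"
    by auto
  have "ideal (linear_span F ?S) F"
  proof (rule ideal_linear_span[OF _ bilinear_rels_carrier G])
    show "complex_algebra F"
      by (rule complex_algebra_monoid_alg[OF monoid_AB])
    have W: "submodule (linear_span F ?G) complex_alg F"
      by (rule submodule_linear_span[OF complex_algebra_monoid_alg[OF monoid_AB] G])
    note W' = F.submoduleE[OF W]
    show "carrier F \<subseteq> linear_span F ?G"
    proof
      fix f assume "f \<in> carrier F"
      then show "f \<in> linear_span F ?G"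
      proof (induction f rule: monoid_alg_induct)
        case zero
        have "\<zero>\<^bsub>F\<^esub> \<in> linear_span F ?G"
          using subgroup.one_closed[OF submodule.axioms(1)[OF W]] by simp
        then show ?case
          by simp
      next
        case (single p c)
        then have "Poly_Mapping.single p 1 \<in> linear_span F ?G"
          by (intro subsetD[OF linear_span_superset]) blast
        from W'(4)[OF _ this, of c] show ?case
          by simp
      next
        case (add g h)
        then show ?case
          using W'(5)[of g h] by simp
      qed
    qed
  next
    fix g s assume "g \<in> ?G" and s: "s \<in> ?S"
    then obtain u v where g: "g = Poly_Mapping.single (u, v) 1" "u \<in> carrier A" "v \<in> carrier B"
      by (auto simp: DirProd_def)
    note simps = monoid_alg_mult_diff monoid_alg_mult_single mult_DirProd mult_1_left mult_1_right
      A.l_distr A.r_distr B.l_distr B.r_distr A.smult_mult_left A.smult_mult_right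
      B.smult_mult_left B.smult_mult_right
    have "g \<otimes>\<^bsub>F\<^esub> s \<in> ?S \<and> s \<otimes>\<^bsub>F\<^esub> g \<in> ?S"
      using s
    proof (cases rule: bilinear_rels_cases)
      case (1 x x' y)
      show ?thesis
        unfolding 1(1) g(1) using 1(2-) g(2,3)
        by (simp only: simps) (intro conjI bilinear_rels_intros A.m_closed B.m_closed)
    next
      case (2 x y y')
      show ?thesis
        unfolding 2(1) g(1) using 2(2-) g(2,3)
        by (simp only: simps) (intro conjI bilinear_rels_intros A.m_closed B.m_closed)
    next
      case (3 c x y)
      show ?thesis
        unfolding 3(1) g(1) using 3(2-) g(2,3)
        by (simp only: simps) (intro conjI bilinear_rels_intros A.m_closed B.m_closed)
    next
      case (4 c x y)
      show ?thesis
        unfolding 4(1) g(1) using 4(2-) g(2,3)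
        by (simp only: simps) (intro conjI bilinear_rels_intros A.m_closed B.m_closed)
    qed
    then show "g \<otimes>\<^bsub>F\<^esub> s \<in> linear_span F ?S" "s \<otimes>\<^bsub>F\<^esub> g \<in> linear_span F ?S"
      using linear_span_superset[of ?S F] by auto
  qed
  then show ?thesis
    unfolding tensor_null_def
    by (intro quotient_by_ideal.intro complex_algebra_monoid_alg monoid_AB)
qed


interpretation T: quotient_by_ideal F "tensor_null A B"
  by (rule quotient_tensor)

lemma complex_algebra_tensor_alg: "complex_algebra (tensor_alg A B)"
  unfolding tensor_alg_def by (rule T.complex_algebra_quot)

interpretation AB: complex_algebra "tensor_alg A B"
  by (rule complex_algebra_tensor_alg)

lemma pure_tensor_closed:
  "\<lbrakk>x \<in> carrier A; y \<in> carrier B\<rbrakk> \<Longrightarrow> pt x y \<in> carrier (tensor_alg A B)"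
  unfolding tensor_alg_def pure_tensor_def by (rule T.coset_closed) simp

lemma bilin_pure_tensor: "bilin A B (tensor_alg A B) pt"
proof -
  \<comment> \<open>Each bilinearity relation, read as a difference \<open>f - g\<close>, identifies
    the cosets of \<open>f\<close> and \<open>g\<close>.\<close>
  have eq: "tensor_null A B +>\<^bsub>F\<^esub> f = tensor_null A B +>\<^bsub>F\<^esub> g"
    if "f - g \<in> bilinear_rels A B" "f \<in> carrier F" "g \<in> carrier F" for f g
  proof -
    have "f - g \<in> tensor_null A B"
      using that(1) linear_span_superset[of "bilinear_rels A B" F] by (auto simp: tensor_null_def)
    then show ?thesis
      using that(2,3) by (subst T.coset_eq_iff) (simp_all add: minus_F)
  qed
  have "pt (x \<oplus>\<^bsub>A\<^esub> x') y = pt x y \<oplus>\<^bsub>tensor_alg A B\<^esub> pt x' y"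
    if "x \<in> carrier A" "x' \<in> carrier A" "y \<in> carrier B" for x x' y
    using that bilinear_rels_intros(1)[OF that]
    unfolding pure_tensor_def tensor_alg_def
    by (subst T.add_quot; (intro eq)?)
      (auto simp: diff_diff_add split: if_splits dest!: subsetD[OF keys_add])
  moreover have "pt x (y \<oplus>\<^bsub>B\<^esub> y') = pt x y \<oplus>\<^bsub>tensor_alg A B\<^esub> pt x y'"
    if "x \<in> carrier A" "y \<in> carrier B" "y' \<in> carrier B" for x y y'
    using that bilinear_rels_intros(2)[OF that]
    unfolding pure_tensor_def tensor_alg_def
    by (subst T.add_quot; (intro eq)?)
      (auto simp: diff_diff_add split: if_splits dest!: subsetD[OF keys_add])
  moreover have "pt (c \<odot>\<^bsub>A\<^esub> x) y = c \<odot>\<^bsub>tensor_alg A B\<^esub> pt x y"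
    if "x \<in> carrier A" "y \<in> carrier B" for c x y
    using that bilinear_rels_intros(3)[OF that]
    unfolding pure_tensor_def tensor_alg_def
    by (subst T.smult_quot; (intro eq)?) (auto split: if_splits)
  moreover have "pt x (c \<odot>\<^bsub>B\<^esub> y) = c \<odot>\<^bsub>tensor_alg A B\<^esub> pt x y"
    if "x \<in> carrier A" "y \<in> carrier B" for c x y
    using that bilinear_rels_intros(4)[OF that]
    unfolding pure_tensor_def tensor_alg_def
    by (subst T.smult_quot; (intro eq)?) (auto split: if_splits)
  ultimately show ?thesis
    by (auto simp: bilin_def pure_tensor_closed intro!: lin_homI)
qed

lemma pure_tensor_mult:
  "\<lbrakk>x \<in> carrier A; y \<in> carrier B; x' \<in> carrier A; y' \<in> carrier B\<rbrakk> \<Longrightarrow>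
    pt x y \<otimes>\<^bsub>tensor_alg A B\<^esub> pt x' y' = pt (x \<otimes>\<^bsub>A\<^esub> x') (y \<otimes>\<^bsub>B\<^esub> y')"
  unfolding pure_tensor_def tensor_alg_def by (subst T.mult_quot) auto

lemma one_tensor_alg: "\<one>\<^bsub>tensor_alg A B\<^esub> = pt \<one>\<^bsub>A\<^esub> \<one>\<^bsub>B\<^esub>"
  unfolding pure_tensor_def tensor_alg_def by (simp add: T.one_quot)

lemma pure_tensor_smult:
  assumes "x \<in> carrier A" "y \<in> carrier B"
  shows "c \<odot>\<^bsub>tensor_alg A B\<^esub> pt x y = pt (c \<odot>\<^bsub>A\<^esub> x) y"
  using lin_homD(3)[OF bilinD(1)[OF bilin_pure_tensor assms(2)] assms(1)] by simp

text \<open>A scalar moves into the left factor, so multiples of pure tensors are pure, and zero is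
  the pure tensor of two zeros. Every element is therefore a sum of pure tensors.\<close>

lemma tensor_induct [consumes 1, case_names pure add]:
  assumes X: "X \<in> carrier (tensor_alg A B)"
    and pure: "\<And>x y. \<lbrakk>x \<in> carrier A; y \<in> carrier B\<rbrakk> \<Longrightarrow> P (pt x y)"
    and add: "\<And>X Y. \<lbrakk>X \<in> carrier (tensor_alg A B); P X; Y \<in> carrier (tensor_alg A B); P Y\<rbrakk>
      \<Longrightarrow> P (X \<oplus>\<^bsub>tensor_alg A B\<^esub> Y)"
  shows "P X"
proof -
  obtain f where f: "f \<in> carrier F" "X = tensor_null A B +>\<^bsub>F\<^esub> f"
    using X unfolding tensor_alg_def by (rule T.coset_cases)
  have "P (tensor_null A B +>\<^bsub>F\<^esub> f)"
    using f(1)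
  proof (induction f rule: monoid_alg_induct)
    case zero
    have "tensor_null A B +>\<^bsub>F\<^esub> 0 = \<zero>\<^bsub>tensor_alg A B\<^esub>"
      by (simp add: tensor_alg_def T.zero_quot)
    also have "\<dots> = pt \<zero>\<^bsub>A\<^esub> \<zero>\<^bsub>B\<^esub>"
      using pure_tensor_smult[of "\<zero>\<^bsub>A\<^esub>" "\<zero>\<^bsub>B\<^esub>" 0] by (simp add: pure_tensor_closed)
    finally show ?case
      by (simp add: pure)
  next
    case (single p c)
    obtain x y where p: "p = (x, y)" "x \<in> carrier A" "y \<in> carrier B"
      using single by (auto simp: DirProd_def)
    have "tensor_null A B +>\<^bsub>F\<^esub> Poly_Mapping.single p c = c \<odot>\<^bsub>tensor_alg A B\<^esub> pt x y"
      using p unfolding pure_tensor_def tensor_alg_def by (subst T.smult_quot) auto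
    then show ?case
      using p by (simp add: pure_tensor_smult pure)
  next
    case (add g h)
    then show ?case
      using assms(3)[of "tensor_null A B +>\<^bsub>F\<^esub> g" "tensor_null A B +>\<^bsub>F\<^esub> h"]
      by (simp add: tensor_alg_def T.add_quot)
  qed
  then show ?thesis
    using f by simp
qed

context
  fixes M :: "(complex, 'c) module" and \<beta>
  assumes M: "complex_algebra M" and \<beta>: "bilin A B M \<beta>"
begin

interpretation M: complex_algebra M by (rule M)

private abbreviation (input) "ext \<equiv> linear_extension M (\<lambda>p. \<beta> (fst p) (snd p))"

private lemma ext_lin: "ext \<in> lin_hom F M"
  using bilinD(3)[OF \<beta>] by (intro linear_extension_lin_hom M) (auto simp: DirProd_def)

private lemma ext_single:
  "\<lbrakk>x \<in> carrier A; y \<in> carrier B\<rbrakk> \<Longrightarrow> ext (Poly_Mapping.single (x, y) c) = c \<odot>\<^bsub>M\<^esub> \<beta> x y"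
  using bilinD(3)[OF \<beta>, of x y] by (subst linear_extension_single[OF M]) auto

text \<open>Bilinearity of \<open>\<beta>\<close> makes its linear extension vanish on the four
  families of relations. The kernel is a subspace, so the extension vanishes on their span and is
  constant on cosets.\<close>

interpretation quotient_map F "tensor_null A B" M ext
proof (intro quotient_map.intro quotient_tensor M quotient_map_axioms.intro ext_lin)
  fix f assume f: "f \<in> tensor_null A B"
  interpret E: linear_map F M ext
    by (intro linear_map.intro linear_map_axioms.intro complex_algebra_monoid_alg monoid_AB M ext_lin)
  have minus: "ext (f - g) = ext f \<ominus>\<^bsub>M\<^esub> ext g" if "f \<in> carrier F" "g \<in> carrier F" for f g
    using that minus_F[of f g] E.map_add[of f "\<ominus>\<^bsub>F\<^esub> g"] E.map_minus[of g]
    by (simp add: a_minus_def)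
  have minus_closed: "Poly_Mapping.keys (f - g) \<subseteq> carrier A \<times> carrier B"
    if "Poly_Mapping.keys f \<subseteq> carrier A \<times> carrier B" "Poly_Mapping.keys g \<subseteq> carrier A \<times> carrier B"
    for f g :: "'a \<times> 'b \<Rightarrow>\<^sub>0 complex"
    using keys_diff[of f g] that by auto
  have cancel: "u \<oplus>\<^bsub>M\<^esub> v \<ominus>\<^bsub>M\<^esub> u \<ominus>\<^bsub>M\<^esub> v = \<zero>\<^bsub>M\<^esub>" if "u \<in> carrier M" "v \<in> carrier M" for u v
    using that by (simp add: a_minus_def M.a_assoc M.a_comm[of u v] M.r_neg M.r_neg2)
  have "bilinear_rels A B \<subseteq> {f \<in> carrier F. ext f = \<zero>\<^bsub>M\<^esub>}"
  proof
    fix r assume "r \<in> bilinear_rels A B"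
    then have "ext r = \<zero>\<^bsub>M\<^esub>"
    proof (cases rule: bilinear_rels_cases)
      case (1 x x' y)
      then show ?thesis
        using lin_homD(2)[OF bilinD(1)[OF \<beta> 1(4)] 1(2,3)] bilinD(3)[OF \<beta>]
        by (simp add: minus minus_closed ext_single cancel)
    next
      case (2 x y y')
      then show ?thesis
        using lin_homD(2)[OF bilinD(2)[OF \<beta> 2(2)] 2(3,4)] bilinD(3)[OF \<beta>]
        by (simp add: minus minus_closed ext_single cancel)
    next
      case (3 c x y)
      then show ?thesis
        using lin_homD(3)[OF bilinD(1)[OF \<beta> 3(3)] 3(2)] bilinD(3)[OF \<beta>]
        by (simp add: minus ext_single M.r_neg a_minus_def)
    next
      case (4 c x y)
      then show ?thesis
        using lin_homD(3)[OF bilinD(2)[OF \<beta> 4(2)] 4(3)] bilinD(3)[OF \<beta>]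
        by (simp add: minus ext_single M.r_neg a_minus_def)
    qed
    then show "r \<in> {f \<in> carrier F. ext f = \<zero>\<^bsub>M\<^esub>}"
      using bilinear_rels_carrier \<open>r \<in> bilinear_rels A B\<close> by blast
  qed
  then have "tensor_null A B \<subseteq> {f \<in> carrier F. ext f = \<zero>\<^bsub>M\<^esub>}"
    unfolding tensor_null_def
    by (intro linear_span_least submodule_lin_kernel complex_algebra_monoid_alg monoid_AB M ext_lin)
  then show "ext f = \<zero>\<^bsub>M\<^esub>"
    using f by auto
qed

lemma tensor_lift_pure_tensor:
  "\<lbrakk>x \<in> carrier A; y \<in> carrier B\<rbrakk> \<Longrightarrow> tensor_lift A B M \<beta> (pt x y) = \<beta> x y"
  unfolding tensor_lift_eq_coset_map pure_tensor_def
  by (subst coset_map_coset) (auto simp: ext_single bilinD(3)[OF \<beta>])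

lemma tensor_lift_lin_hom: "tensor_lift A B M \<beta> \<in> lin_hom (tensor_alg A B) M"
  unfolding tensor_lift_eq_coset_map tensor_alg_def by (rule coset_map_lin_hom)

text \<open>The assumptions say that \<open>\<beta>\<close> is a monoid homomorphism on
  \<open>A \<times>\<times> B\<close>; its linear extension is then multiplicative, and so is the
  map induced on cosets.\<close>

lemma tensor_lift_alg_hom:
  assumes "\<And>x y x' y'. \<lbrakk>x \<in> carrier A; x' \<in> carrier A; y \<in> carrier B; y' \<in> carrier B\<rbrakk> \<Longrightarrow>
      \<beta> (x \<otimes>\<^bsub>A\<^esub> x') (y \<otimes>\<^bsub>B\<^esub> y') = \<beta> x y \<otimes>\<^bsub>M\<^esub> \<beta> x' y'"
    and "\<beta> \<one>\<^bsub>A\<^esub> \<one>\<^bsub>B\<^esub> = \<one>\<^bsub>M\<^esub>"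
  shows "tensor_lift A B M \<beta> \<in> alg_hom (tensor_alg A B) M"
proof -
  have "ext \<in> alg_hom F M"
    using bilinD(3)[OF \<beta>] assms
    by (intro linear_extension_alg_hom M monoid_AB) (auto simp: DirProd_def)
  then show ?thesis
    unfolding tensor_lift_eq_coset_map tensor_alg_def by (rule coset_map_alg_hom)
qed

end

end

lemma (in abelian_monoid) finsum_swap:
  assumes "finite I" "finite J" "\<And>i j. i \<in> I \<Longrightarrow> j \<in> J \<Longrightarrow> f i j \<in> carrier G"
  shows "(\<Oplus>i\<in>I. \<Oplus>j\<in>J. f i j) = (\<Oplus>j\<in>J. \<Oplus>i\<in>I. f i j)"
  using assms(1,3)
proof (induction I)
  case empty
  show ?case
    by (simp add: finsum_zero)
next
  case (insert i I)
  have "(\<Oplus>j\<in>J. \<Oplus>i'\<in>insert i I. f i' j) = (\<Oplus>j\<in>J. f i j \<oplus> (\<Oplus>i'\<in>I. f i' j))"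
    using insert by (intro finsum_cong') (auto intro!: finsum_closed simp: Pi_def)
  also have "\<dots> = (\<Oplus>j\<in>J. f i j) \<oplus> (\<Oplus>j\<in>J. \<Oplus>i'\<in>I. f i' j)"
    using insert by (intro finsum_addf) (auto intro!: finsum_closed simp: Pi_def)
  also have "\<dots> = (\<Oplus>i'\<in>insert i I. \<Oplus>j\<in>J. f i' j)"
    using insert by (subst finsum_insert) (auto intro!: finsum_closed simp: Pi_def)
  finally show ?case ..
qed

lemma bilin_comp:
  assumes "bilin C D M \<beta>" "f \<in> lin_hom A C" "g \<in> lin_hom B D"
  shows "bilin A B M (\<lambda>x y. \<beta> (f x) (g y))"
  using assms lin_homD(1)[OF assms(2)] lin_homD(1)[OF assms(3)]
  by (auto simp: bilin_def intro: lin_hom_comp[of f A C] lin_hom_comp[of g B D])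

lemma pure_tensor_finsum_left:
  assumes A: "complex_algebra A" and B: "complex_algebra B"
    and "finite I" "f \<in> I \<rightarrow> carrier A" "y \<in> carrier B"
  shows "pure_tensor A B (\<Oplus>\<^bsub>A\<^esub>i\<in>I. f i) y = (\<Oplus>\<^bsub>tensor_alg A B\<^esub>i\<in>I. pure_tensor A B (f i) y)"
  using lin_hom_finsum[OF A complex_algebra_tensor_alg[OF A B] bilinD(1)[OF bilin_pure_tensor[OF A B]]]
    assms by blast

lemma pure_tensor_finsum_right:
  assumes A: "complex_algebra A" and B: "complex_algebra B"
    and "finite I" "f \<in> I \<rightarrow> carrier B" "x \<in> carrier A"
  shows "pure_tensor A B x (\<Oplus>\<^bsub>B\<^esub>i\<in>I. f i) = (\<Oplus>\<^bsub>tensor_alg A B\<^esub>i\<in>I. pure_tensor A B x (f i))"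
  using lin_hom_finsum[OF B complex_algebra_tensor_alg[OF A B] bilinD(2)[OF bilin_pure_tensor[OF A B]]]
    assms by blast

lemma pure_tensor_zero_left:
  assumes A: "complex_algebra A" and B: "complex_algebra B" and "y \<in> carrier B"
  shows "pure_tensor A B \<zero>\<^bsub>A\<^esub> y = \<zero>\<^bsub>tensor_alg A B\<^esub>"
  using lin_hom_zero[OF A complex_algebra_tensor_alg[OF A B] bilinD(1)[OF bilin_pure_tensor[OF A B]]]
    assms by blast

lemma pure_tensor_zero_right:
  assumes A: "complex_algebra A" and B: "complex_algebra B" and "x \<in> carrier A"
  shows "pure_tensor A B x \<zero>\<^bsub>B\<^esub> = \<zero>\<^bsub>tensor_alg A B\<^esub>"
  using lin_hom_zero[OF B complex_algebra_tensor_alg[OF A B] bilinD(2)[OF bilin_pure_tensor[OF A B]]]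
    assms by blast

lemma pure_tensor_pow:
  assumes A: "complex_algebra A" and B: "complex_algebra B" and x: "x \<in> carrier A" and y: "y \<in> carrier B"
  shows "pure_tensor A B x y [^]\<^bsub>tensor_alg A B\<^esub> (k :: nat) =
    pure_tensor A B (x [^]\<^bsub>A\<^esub> k) (y [^]\<^bsub>B\<^esub> k)"
proof -
  interpret A: complex_algebra A by (rule A)
  interpret B: complex_algebra B by (rule B)
  interpret AB: complex_algebra "tensor_alg A B" by (rule complex_algebra_tensor_alg[OF A B])
  show ?thesis
    using x y by (induction k) (simp_all add: one_tensor_alg[OF A B] pure_tensor_mult[OF A B])
qed

section \<open>Tensor products of homomorphisms\<close>

context
  fixes A :: "(complex, 'a) module" and B :: "(complex, 'b) module"
    and C :: "(complex, 'c) module" and D :: "(complex, 'd) module" and f g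
  assumes A: "complex_algebra A" and B: "complex_algebra B"
    and C: "complex_algebra C" and D: "complex_algebra D"
    and f: "f \<in> alg_hom A C" and g: "g \<in> alg_hom B D"
begin

lemma bilin_tensor_map: "bilin A B (tensor_alg C D) (\<lambda>x y. pure_tensor C D (f x) (g y))"
  by (rule bilin_comp[OF bilin_pure_tensor[OF C D] alg_homD(1)[OF f] alg_homD(1)[OF g]])

lemma tensor_map_pure_tensor:
  "\<lbrakk>x \<in> carrier A; y \<in> carrier B\<rbrakk> \<Longrightarrow>
    tensor_map A B C D f g (pure_tensor A B x y) = pure_tensor C D (f x) (g y)"
  unfolding tensor_map_def
  by (rule tensor_lift_pure_tensor[OF A B complex_algebra_tensor_alg[OF C D] bilin_tensor_map])

lemma tensor_map_alg_hom: "tensor_map A B C D f g \<in> alg_hom (tensor_alg A B) (tensor_alg C D)"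
  unfolding tensor_map_def
  by (rule tensor_lift_alg_hom[OF A B complex_algebra_tensor_alg[OF C D] bilin_tensor_map])
    (simp_all add: alg_homD(2,3)[OF f] alg_homD(2,3)[OF g] lin_homD(1)[OF alg_homD(1)[OF f]]
      lin_homD(1)[OF alg_homD(1)[OF g]] pure_tensor_mult[OF C D] one_tensor_alg[OF C D])

end

section \<open>The associativity map of triple tensor products\<close>

context
  fixes A :: "(complex, 'a) module" and B :: "(complex, 'b) module" and C :: "(complex, 'c) module"
  assumes A: "complex_algebra A" and B: "complex_algebra B" and C: "complex_algebra C"
begin

interpretation A: complex_algebra A by (rule A)
interpretation B: complex_algebra B by (rule B)
interpretation C: complex_algebra C by (rule C)

private abbreviation (input) "AB \<equiv> tensor_alg A B"
private abbreviation (input) "BC \<equiv> tensor_alg B C"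
private abbreviation (input) "A_BC \<equiv> tensor_alg A (tensor_alg B C)"

private lemma AB: "complex_algebra AB" and BC: "complex_algebra BC"
  by (rule complex_algebra_tensor_alg A B C)+

private lemma A_BC: "complex_algebra A_BC"
  by (rule complex_algebra_tensor_alg[OF A BC])

interpretation AB: complex_algebra AB by (rule AB)
interpretation BC: complex_algebra BC by (rule BC)
interpretation A_BC: complex_algebra A_BC by (rule A_BC)

private abbreviation (input) "\<beta> \<equiv> \<lambda>z x y. pure_tensor A BC x (pure_tensor B C y z)"
private abbreviation (input) "\<gamma> \<equiv> \<lambda>u z. tensor_lift A B A_BC (\<beta> z) u"

private lemma bilin_\<beta>: "z \<in> carrier C \<Longrightarrow> bilin A B A_BC (\<beta> z)"
  using bilin_comp[OF bilin_pure_tensor[OF A BC] alg_homD(1)[OF id_alg_hom]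
      bilinD(1)[OF bilin_pure_tensor[OF B C]]]
  by blast

private lemma \<gamma>_pure: "\<lbrakk>x \<in> carrier A; y \<in> carrier B; z \<in> carrier C\<rbrakk> \<Longrightarrow> \<gamma> (pure_tensor A B x y) z = \<beta> z x y"
  by (rule tensor_lift_pure_tensor[OF A B A_BC bilin_\<beta>])

private lemma \<gamma>_lin: "z \<in> carrier C \<Longrightarrow> (\<lambda>u. \<gamma> u z) \<in> lin_hom AB A_BC"
  by (rule tensor_lift_lin_hom[OF A B A_BC bilin_\<beta>])

text \<open>The inner lift treats \<open>z\<close> as a parameter, so linearity in \<open>z\<close>
  does not come with it. It is proved by tensor induction on \<open>u\<close>: for pure
  \<open>u\<close> the map is a composite of two linear slices, and sums of linear maps are
  linear.\<close>

private lemma bilin_\<gamma>: "bilin AB C A_BC \<gamma>"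
proof -
  have "\<gamma> u \<in> lin_hom C A_BC" if "u \<in> carrier AB" for u
    using that
  proof (induction u rule: tensor_induct[OF A B, consumes 1, case_names pure add])
    case (pure x y)
    have "(\<lambda>z. \<beta> z x y) \<in> lin_hom C A_BC"
      using bilinD(2)[OF bilin_pure_tensor[OF B C] pure(2)]
        bilinD(2)[OF bilin_pure_tensor[OF A BC] pure(1)] by (rule lin_hom_comp)
    then show ?case
      by (rule lin_hom_cong[OF C]) (simp add: \<gamma>_pure pure)
  next
    case (add u v)
    from lin_hom_add[OF A_BC add.IH] show ?case
      by (rule lin_hom_cong[OF C]) (simp add: lin_homD(2)[OF \<gamma>_lin] add.hyps)
  qed
  then show ?thesis
    using \<gamma>_lin by (simp add: bilin_def)
qed

lemma tensor_assoc_pure_tensor: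
  "\<lbrakk>x \<in> carrier A; y \<in> carrier B; z \<in> carrier C\<rbrakk> \<Longrightarrow>
    tensor_assoc A B C (pure_tensor AB C (pure_tensor A B x y) z) = pure_tensor A BC x (pure_tensor B C y z)"
  unfolding tensor_assoc_def
  by (subst tensor_lift_pure_tensor[OF AB C A_BC bilin_\<gamma>]) (simp_all add: \<gamma>_pure pure_tensor_closed[OF A B])

text \<open>The outer lift is multiplicative as soon as \<open>\<gamma>\<close> is multiplicative on
  pairs. Since \<open>\<gamma>\<close> is given explicitly only on pure tensors, both
  \<open>u\<close> and \<open>u'\<close> are reduced to these by additivity.\<close>

lemma tensor_assoc_alg_hom: "tensor_assoc A B C \<in> alg_hom (tensor_alg AB C) A_BC"
  unfolding tensor_assoc_def
proof (rule tensor_lift_alg_hom[OF AB C A_BC bilin_\<gamma>])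
  note \<gamma>_add = lin_homD(2)[OF \<gamma>_lin]
  note \<gamma>_closed = bilinD(3)[OF bilin_\<gamma>]
  fix u z u' z'
  assume u: "u \<in> carrier AB" and u': "u' \<in> carrier AB" and z: "z \<in> carrier C" "z' \<in> carrier C"
  show "\<gamma> (u \<otimes>\<^bsub>AB\<^esub> u') (z \<otimes>\<^bsub>C\<^esub> z') = \<gamma> u z \<otimes>\<^bsub>A_BC\<^esub> \<gamma> u' z'"
    using u
  proof (induction u rule: tensor_induct[OF A B, consumes 1, case_names pure add])
    case (pure x y)
    show ?case
      using u'
    proof (induction u' rule: tensor_induct[OF A B, consumes 1, case_names pure add])
      case (pure x' y')
      then show ?case
        using \<open>x \<in> carrier A\<close> \<open>y \<in> carrier B\<close> z
        by (simp add: \<gamma>_pure pure_tensor_mult[OF A B] pure_tensor_mult[OF B C] pure_tensor_mult[OF A BC]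
            pure_tensor_closed[OF B C])
    next
      case (add u v)
      then show ?case
        using pure_tensor_closed[OF A B pure] z by (simp add: \<gamma>_add \<gamma>_closed AB.r_distr A_BC.r_distr)
    qed
  next
    case (add u v)
    then show ?case
      using z u' by (simp add: \<gamma>_add \<gamma>_closed AB.l_distr A_BC.l_distr)
  qed
next
  show "\<gamma> \<one>\<^bsub>AB\<^esub> \<one>\<^bsub>C\<^esub> = \<one>\<^bsub>A_BC\<^esub>"
    by (simp add: one_tensor_alg[OF A B] one_tensor_alg[OF B C] one_tensor_alg[OF A BC] \<gamma>_pure)
qed

end

text \<open>Both sides equal the sum over \<open>k\<close> and \<open>l\<close> of
  \<open>v l \<otimes> (T l k \<otimes> T k j)\<close>. Keeping \<open>A\<close> and
  \<open>v\<close> general covers two uses: the comultiplication, where \<open>v\<close> is a row of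
  \<open>T\<close>, and the coaction on the generators of the quantum algebra.\<close>

lemma coassociative_on_matrix_coaction:
  fixes v :: "'n::finite \<Rightarrow> 'a" and T :: "'n \<Rightarrow> 'n \<Rightarrow> 'h"
  assumes A: "complex_algebra A" and H: "complex_algebra H"
    and \<delta>: "\<delta> \<in> alg_hom A (tensor_alg A H)" and \<Delta>: "\<Delta> \<in> alg_hom H (tensor_alg H H)"
    and v: "\<And>i. v i \<in> carrier A" and T: "\<And>i j. T i j \<in> carrier H"
    and \<delta>v: "\<And>j. \<delta> (v j) = (\<Oplus>\<^bsub>tensor_alg A H\<^esub>k\<in>UNIV. pure_tensor A H (v k) (T k j))"
    and \<Delta>T: "\<And>i j. \<Delta> (T i j) = (\<Oplus>\<^bsub>tensor_alg H H\<^esub>k\<in>UNIV. pure_tensor H H (T i k) (T k j))"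
  shows "tensor_assoc A H H (tensor_map A H (tensor_alg A H) H \<delta> (\<lambda>h. h) (\<delta> (v j))) =
    tensor_map A H A (tensor_alg H H) (\<lambda>y. y) \<Delta> (\<delta> (v j))"
proof -
  let ?AH = "tensor_alg A H" and ?HH = "tensor_alg H H"
  let ?L = "tensor_alg ?AH H" and ?R = "tensor_alg A ?HH"
  note AH = complex_algebra_tensor_alg[OF A H] and HH = complex_algebra_tensor_alg[OF H H]
  note L = complex_algebra_tensor_alg[OF AH H] and R = complex_algebra_tensor_alg[OF A HH]
  interpret R: complex_algebra ?R by (rule R)
  note closed = v T pure_tensor_closed[OF A H] pure_tensor_closed[OF H H] pure_tensor_closed[OF AH H]
    pure_tensor_closed[OF A HH]
  have \<delta>_closed: "\<delta> (v k) \<in> carrier ?AH" for k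
    using lin_homD(1)[OF alg_homD(1)[OF \<delta>]] v .
  let ?a = "tensor_assoc A H H"
  note a = alg_homD(1)[OF tensor_assoc_alg_hom[OF A H H]]
  note map1 = tensor_map_alg_hom[OF A H AH H \<delta> id_alg_hom]
  note map2 = tensor_map_alg_hom[OF A H A HH id_alg_hom \<Delta>]
  have "tensor_map A H ?AH H \<delta> (\<lambda>h. h) (\<delta> (v j)) = (\<Oplus>\<^bsub>?L\<^esub>k\<in>UNIV. pure_tensor ?AH H (\<delta> (v k)) (T k j))"
    unfolding \<delta>v[of j]
    by (subst lin_hom_finsum[OF AH L alg_homD(1)[OF map1]])
      (simp_all add: closed tensor_map_pure_tensor[OF A H AH H \<delta> id_alg_hom])
  also have "?a \<dots> = (\<Oplus>\<^bsub>?R\<^esub>k\<in>UNIV. ?a (pure_tensor ?AH H (\<delta> (v k)) (T k j)))"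
    by (rule lin_hom_finsum[OF L R a]) (simp_all add: closed \<delta>_closed)
  also have "\<dots> = (\<Oplus>\<^bsub>?R\<^esub>k\<in>UNIV. \<Oplus>\<^bsub>?R\<^esub>l\<in>UNIV. pure_tensor A ?HH (v l) (pure_tensor H H (T l k) (T k j)))"
  proof (rule R.finsum_cong')
    fix k
    have "pure_tensor ?AH H (\<delta> (v k)) (T k j)
        = (\<Oplus>\<^bsub>?L\<^esub>l\<in>UNIV. pure_tensor ?AH H (pure_tensor A H (v l) (T l k)) (T k j))"
      unfolding \<delta>v by (rule pure_tensor_finsum_left[OF AH H]) (simp_all add: closed)
    also have "?a \<dots> = (\<Oplus>\<^bsub>?R\<^esub>l\<in>UNIV. ?a (pure_tensor ?AH H (pure_tensor A H (v l) (T l k)) (T k j)))"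
      by (rule lin_hom_finsum[OF L R a]) (simp_all add: closed)
    finally show "?a (pure_tensor ?AH H (\<delta> (v k)) (T k j)) =
        (\<Oplus>\<^bsub>?R\<^esub>l\<in>UNIV. pure_tensor A ?HH (v l) (pure_tensor H H (T l k) (T k j)))"
      by (simp add: tensor_assoc_pure_tensor[OF A H H] closed)
  qed (auto intro!: R.finsum_closed simp: closed)
  \<comment> \<open>After the exchange the inner sum over \<open>k\<close>, for fixed
    \<open>l\<close>, is the comultiplication of \<open>T l j\<close>.\<close>
  also have "\<dots> = (\<Oplus>\<^bsub>?R\<^esub>l\<in>UNIV. \<Oplus>\<^bsub>?R\<^esub>k\<in>UNIV. pure_tensor A ?HH (v l) (pure_tensor H H (T l k) (T k j)))"
    by (rule R.finsum_swap) (simp_all add: closed)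
  also have "\<dots> = (\<Oplus>\<^bsub>?R\<^esub>l\<in>UNIV. pure_tensor A ?HH (v l) (\<Delta> (T l j)))"
    unfolding \<Delta>T by (simp add: pure_tensor_finsum_right[OF A HH] closed)
  also have "\<dots> = tensor_map A H A ?HH (\<lambda>y. y) \<Delta> (\<delta> (v j))"
    unfolding \<delta>v[of j]
    by (subst lin_hom_finsum[OF AH R alg_homD(1)[OF map2]])
      (simp_all add: closed tensor_map_pure_tensor[OF A H A HH id_alg_hom \<Delta>])
  finally show ?thesis .
qed

section \<open>The FRT bialgebra\<close>

lemma pure_tensor_smult_right:
  assumes A: "complex_algebra A" and B: "complex_algebra B" and "x \<in> carrier A" "y \<in> carrier B"
  shows "c \<odot>\<^bsub>tensor_alg A B\<^esub> pure_tensor A B x y = pure_tensor A B x (c \<odot>\<^bsub>B\<^esub> y)"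
  using lin_homD(3)[OF bilinD(2)[OF bilin_pure_tensor[OF A B] assms(3)] assms(4)] by simp

context
  fixes A :: "(complex, 'a) module" and H :: "(complex, 'h) module" and \<epsilon> :: "'h \<Rightarrow> complex"
  assumes A: "complex_algebra A" and H: "complex_algebra H" and \<epsilon>: "\<epsilon> \<in> alg_hom H complex_alg"
begin

interpretation A: complex_algebra A by (rule A)
interpretation H: complex_algebra H by (rule H)

private lemmas \<epsilon>_simps = alg_homD(2,3)[OF \<epsilon>] lin_homD[OF alg_homD(1)[OF \<epsilon>]]

private lemma bilin_counit_right: "bilin A H A (\<lambda>y h. \<epsilon> h \<odot>\<^bsub>A\<^esub> y)"
  by (auto simp: bilin_def \<epsilon>_simps A.smult_add_left A.smult_add_right A.smult_smult mult.commute
      intro!: lin_homI)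

private lemma bilin_counit_left: "bilin H A A (\<lambda>h y. \<epsilon> h \<odot>\<^bsub>A\<^esub> y)"
  by (auto simp: bilin_def \<epsilon>_simps A.smult_add_left A.smult_add_right A.smult_smult mult.commute
      intro!: lin_homI)

lemma counit_right_pure_tensor:
  "\<lbrakk>y \<in> carrier A; h \<in> carrier H\<rbrakk> \<Longrightarrow>
    tensor_lift A H A (\<lambda>y h. \<epsilon> h \<odot>\<^bsub>A\<^esub> y) (pure_tensor A H y h) = \<epsilon> h \<odot>\<^bsub>A\<^esub> y"
  by (rule tensor_lift_pure_tensor[OF A H A bilin_counit_right])

lemma counit_left_pure_tensor:
  "\<lbrakk>h \<in> carrier H; y \<in> carrier A\<rbrakk> \<Longrightarrow>
    tensor_lift H A A (\<lambda>h y. \<epsilon> h \<odot>\<^bsub>A\<^esub> y) (pure_tensor H A h y) = \<epsilon> h \<odot>\<^bsub>A\<^esub> y"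
  by (rule tensor_lift_pure_tensor[OF H A A bilin_counit_left])

lemma counit_right_alg_hom: "tensor_lift A H A (\<lambda>y h. \<epsilon> h \<odot>\<^bsub>A\<^esub> y) \<in> alg_hom (tensor_alg A H) A"
  by (rule tensor_lift_alg_hom[OF A H A bilin_counit_right])
    (simp_all add: \<epsilon>_simps A.smult_mult_left A.smult_mult_right A.smult_smult mult.commute)

lemma counit_left_alg_hom: "tensor_lift H A A (\<lambda>h y. \<epsilon> h \<odot>\<^bsub>A\<^esub> y) \<in> alg_hom (tensor_alg H A) A"
  by (rule tensor_lift_alg_hom[OF H A A bilin_counit_left])
    (simp_all add: \<epsilon>_simps A.smult_mult_left A.smult_mult_right A.smult_smult mult.commute)

text \<open>The counit turns the matrix \<open>T\<close> into the identity matrix, which leaves the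
  term \<open>k = j\<close>. The two versions serve the right and the left counit axiom.\<close>

lemma counit_on_matrix_coaction:
  fixes v :: "'n::finite \<Rightarrow> 'a" and T :: "'n \<Rightarrow> 'n \<Rightarrow> 'h"
  assumes v: "\<And>i. v i \<in> carrier A" and T: "\<And>i j. T i j \<in> carrier H"
    and \<epsilon>T: "\<And>i j. \<epsilon> (T i j) = (if i = j then 1 else 0)"
  shows "tensor_lift A H A (\<lambda>y h. \<epsilon> h \<odot>\<^bsub>A\<^esub> y)
      (\<Oplus>\<^bsub>tensor_alg A H\<^esub>k\<in>UNIV. pure_tensor A H (v k) (T k j)) = v j"
    and "tensor_lift H A A (\<lambda>h y. \<epsilon> h \<odot>\<^bsub>A\<^esub> y)
      (\<Oplus>\<^bsub>tensor_alg H A\<^esub>k\<in>UNIV. pure_tensor H A (T j k) (v k)) = v j"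
proof -
  have "tensor_lift A H A (\<lambda>y h. \<epsilon> h \<odot>\<^bsub>A\<^esub> y)
      (\<Oplus>\<^bsub>tensor_alg A H\<^esub>k\<in>UNIV. pure_tensor A H (v k) (T k j))
      = (\<Oplus>\<^bsub>A\<^esub>k\<in>UNIV. if j = k then v k else \<zero>\<^bsub>A\<^esub>)"
    by (subst lin_hom_finsum[OF complex_algebra_tensor_alg[OF A H] A alg_homD(1)[OF counit_right_alg_hom]])
      (auto simp: counit_right_pure_tensor v T \<epsilon>T pure_tensor_closed[OF A H] intro!: A.finsum_cong')
  then show "tensor_lift A H A (\<lambda>y h. \<epsilon> h \<odot>\<^bsub>A\<^esub> y)
      (\<Oplus>\<^bsub>tensor_alg A H\<^esub>k\<in>UNIV. pure_tensor A H (v k) (T k j)) = v j"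
    using A.finsum_singleton[of j UNIV v] by (simp add: v)
  have "tensor_lift H A A (\<lambda>h y. \<epsilon> h \<odot>\<^bsub>A\<^esub> y)
      (\<Oplus>\<^bsub>tensor_alg H A\<^esub>k\<in>UNIV. pure_tensor H A (T j k) (v k))
      = (\<Oplus>\<^bsub>A\<^esub>k\<in>UNIV. if j = k then v k else \<zero>\<^bsub>A\<^esub>)"
    by (subst lin_hom_finsum[OF complex_algebra_tensor_alg[OF H A] A alg_homD(1)[OF counit_left_alg_hom]])
      (auto simp: counit_left_pure_tensor v T \<epsilon>T pure_tensor_closed[OF H A] intro!: A.finsum_cong')
  then show "tensor_lift H A A (\<lambda>h y. \<epsilon> h \<odot>\<^bsub>A\<^esub> y)
      (\<Oplus>\<^bsub>tensor_alg H A\<^esub>k\<in>UNIV. pure_tensor H A (T j k) (v k)) = v j"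
    using A.finsum_singleton[of j UNIV v] by (simp add: v)
qed

end

text \<open>Equal squares give \<open>q^(2(x - y)) = 1\<close>, which for
  \<open>x \<noteq> y\<close> makes \<open>q^(-2)\<close> a root of unity.\<close>

lemma power_int_square_inj:
  fixes q :: complex
  assumes q: "q \<noteq> 0" and root: "\<forall>n::nat. n > 0 \<longrightarrow> (q powi (-2)) ^ n \<noteq> 1"
    and eq: "(q powi x)\<^sup>2 = (q powi y)\<^sup>2"
  shows "x = y"
proof -
  \<comment> \<open>The hypothesis \<open>root\<close> speaks of positive natural exponents, so one
    order of the two integers is treated and the other follows by exchange.\<close>
  have *: "\<not> x < y" if eq: "(q powi x)\<^sup>2 = (q powi y)\<^sup>2" for x y
  proof
    assume "x < y"
    have "(q powi (-2)) ^ nat (y - x) = q powi (-2 * (y - x))"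
      using \<open>x < y\<close> power_int_mult[of q "-2" "int (nat (y - x))"] by (simp add: power_int_def[of _ "y - x"])
    also have "\<dots> = q powi (x * 2) / q powi (y * 2)"
      using q by (simp add: power_int_diff[symmetric] algebra_simps)
    also have "\<dots> = 1"
      using eq q by (simp add: power_int_mult)
    finally show False
      using root \<open>x < y\<close> by simp
  qed
  show ?thesis
    using *[of x y] *[of y x] eq by force
qed

text \<open>The coefficient of \<open>v_j \<otimes> v_i\<close> in the image of
  \<open>v_i \<otimes> v_j\<close>. Naming it lets an FRT relation be read as an exchange of two
  generators up to two scalars.\<close>

definition braid_scalar :: "('n::finite \<Rightarrow> 'n \<Rightarrow> int) \<Rightarrow> ('n \<Rightarrow> int) \<Rightarrow> complex \<Rightarrow> 'n \<Rightarrow> 'n \<Rightarrow> complex"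
  where "braid_scalar a d q i j = - (q powi (d i * a i j + 1))"

lemma braid_coeff_cartan_braiding:
  "braid_coeff (cartan_braiding a d q) i j k l =
    (if j = k then if i = l then braid_scalar a d q i j else 0 else 0)"
  by (auto simp: braid_coeff_def cartan_braiding_nth axis_def braid_scalar_def)

lemma (in abelian_monoid) finsum_singleton2:
  assumes "finite I" "finite J" "i \<in> I" "j \<in> J" "\<And>k l. f k l \<in> carrier G"
  shows "(\<Oplus>k\<in>I. \<Oplus>l\<in>J. if i = k then if j = l then f k l else \<zero> else \<zero>) = f i j"
proof -
  have "(\<Oplus>k\<in>I. \<Oplus>l\<in>J. if i = k then if j = l then f k l else \<zero> else \<zero>)
      = (\<Oplus>k\<in>I. if i = k then f k j else \<zero>)"
    using assms finsum_singleton[of j J "f i"]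
    by (intro finsum_cong') (auto simp: finsum_zero)
  then show ?thesis
    using assms finsum_singleton[of i I "\<lambda>k. f k j"] by simp
qed

text \<open>The braiding is a flip up to scalars, so one term of each double sum survives:
  \<open>k = j\<close>, \<open>l = i\<close> in the first and \<open>k = n\<close>,
  \<open>l = m\<close> in the second. With the projection as \<open>\<phi>\<close> this yields the
  relations of the FRT algebra; with \<open>free_hom\<close> it is the test that proposed images of
  the generators respect them.\<close>

lemma alg_hom_frt_rel:
  fixes \<phi> :: "(('n::finite \<times> 'n) list \<Rightarrow>\<^sub>0 complex) \<Rightarrow> 'b"
  assumes B: "complex_algebra B" and \<phi>: "\<phi> \<in> alg_hom free_alg B"
    and X: "\<And>i j. \<phi> (free_gen (i, j)) = X i j"
  shows "\<phi> (frt_rel (cartan_braiding a d q) i j m n) =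
    braid_scalar a d q i j \<odot>\<^bsub>B\<^esub> (X m j \<otimes>\<^bsub>B\<^esub> X n i) \<ominus>\<^bsub>B\<^esub> braid_scalar a d q n m \<odot>\<^bsub>B\<^esub> (X n i \<otimes>\<^bsub>B\<^esub> X m j)"
proof -
  let ?F = "free_alg :: (complex, ('n \<times> 'n) list \<Rightarrow>\<^sub>0 complex) module"
  let ?c = "braid_coeff (cartan_braiding a d q)"
  have F: "complex_algebra ?F" by (rule complex_algebra_free_alg)
  interpret linear_map ?F B \<phi>
    by (intro linear_map.intro linear_map_axioms.intro F B alg_homD(1)[OF \<phi>])
  have X_closed: "X i j \<in> carrier B" for i j
    using map_closed[of "free_gen (i, j)"] by (simp add: X)
  have sum2: "\<phi> (\<Oplus>\<^bsub>?F\<^esub>k\<in>UNIV. \<Oplus>\<^bsub>?F\<^esub>l\<in>UNIV. g k l) = (\<Oplus>\<^bsub>B\<^esub>k\<in>UNIV. \<Oplus>\<^bsub>B\<^esub>l\<in>UNIV. \<phi> (g k l))" for g :: "'n \<Rightarrow> 'n \<Rightarrow> _"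
    by (simp add: map_finsum)
  have l: "\<phi> (\<Oplus>\<^bsub>?F\<^esub>k\<in>UNIV. \<Oplus>\<^bsub>?F\<^esub>l\<in>UNIV. ?c i j k l \<odot>\<^bsub>?F\<^esub> (free_gen (m, k) \<otimes>\<^bsub>?F\<^esub> free_gen (n, l)))
      = braid_scalar a d q i j \<odot>\<^bsub>B\<^esub> (X m j \<otimes>\<^bsub>B\<^esub> X n i)" (is "?l = _")
  proof -
    have "?l = (\<Oplus>\<^bsub>B\<^esub>k\<in>UNIV. \<Oplus>\<^bsub>B\<^esub>l\<in>UNIV. if j = k then if i = l then
        braid_scalar a d q i j \<odot>\<^bsub>B\<^esub> (X m k \<otimes>\<^bsub>B\<^esub> X n l) else \<zero>\<^bsub>B\<^esub> else \<zero>\<^bsub>B\<^esub>)"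
      unfolding sum2
      by (intro B.M.finsum_cong' B.M.finsum_closed refl)
        (auto simp: map_smult alg_homD(3)[OF \<phi>] X X_closed braid_coeff_cartan_braiding)
    then show ?thesis
      by (simp add: B.M.finsum_singleton2 X_closed)
  qed
  have r: "\<phi> (\<Oplus>\<^bsub>?F\<^esub>k\<in>UNIV. \<Oplus>\<^bsub>?F\<^esub>l\<in>UNIV. ?c k l m n \<odot>\<^bsub>?F\<^esub> (free_gen (k, i) \<otimes>\<^bsub>?F\<^esub> free_gen (l, j)))
      = braid_scalar a d q n m \<odot>\<^bsub>B\<^esub> (X n i \<otimes>\<^bsub>B\<^esub> X m j)" (is "?r = _")
  proof -
    have "?r = (\<Oplus>\<^bsub>B\<^esub>k\<in>UNIV. \<Oplus>\<^bsub>B\<^esub>l\<in>UNIV. if n = k then if m = l then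
        braid_scalar a d q k l \<odot>\<^bsub>B\<^esub> (X k i \<otimes>\<^bsub>B\<^esub> X l j) else \<zero>\<^bsub>B\<^esub> else \<zero>\<^bsub>B\<^esub>)"
      unfolding sum2
      by (intro B.M.finsum_cong' B.M.finsum_closed refl)
        (auto simp: map_smult alg_homD(3)[OF \<phi>] X X_closed braid_coeff_cartan_braiding)
    then show ?thesis
      by (simp add: B.M.finsum_singleton2 X_closed)
  qed
  show ?thesis
    unfolding frt_rel_def a_minus_def
    by (subst map_add) (simp_all add: l r map_minus)
qed

lemma frt_gen_closed: "frt_gen \<sigma> i j \<in> carrier (frt_alg \<sigma>)"
  by (simp add: frt_gen_def frt_alg_def)

lemma complex_algebra_frt_alg: "complex_algebra (frt_alg \<sigma>)"
  by (simp add: frt_alg_def complex_algebra_presented_alg)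

section \<open>Structure maps of the FRT algebra and products of its generators\<close>

context
  fixes a :: "'n::finite \<Rightarrow> 'n \<Rightarrow> int" and d :: "'n \<Rightarrow> int" and q :: complex
begin

private abbreviation (input) "\<sigma> \<equiv> cartan_braiding a d q"
private abbreviation (input) "H \<equiv> frt_alg \<sigma>"
private abbreviation (input) "t \<equiv> frt_gen \<sigma>"
private abbreviation (input) "c \<equiv> braid_scalar a d q"

private lemma H: "complex_algebra H" by (rule complex_algebra_frt_alg)
private lemma HH: "complex_algebra (tensor_alg H H)" by (rule complex_algebra_tensor_alg[OF H H])

interpretation H: complex_algebra H by (rule H)
interpretation HH: complex_algebra "tensor_alg H H" by (rule HH)

lemma T_rel: "c i j \<odot>\<^bsub>H\<^esub> (t m j \<otimes>\<^bsub>H\<^esub> t n i) = c n m \<odot>\<^bsub>H\<^esub> (t n i \<otimes>\<^bsub>H\<^esub> t m j)"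
proof -
  have "presented_proj (frt_rels \<sigma>) (frt_rel \<sigma> i j m n) = \<zero>\<^bsub>H\<^esub>"
    unfolding frt_alg_def by (rule presented_proj_rel) (auto simp: frt_rels_def)
  then have "c i j \<odot>\<^bsub>H\<^esub> (t m j \<otimes>\<^bsub>H\<^esub> t n i) \<ominus>\<^bsub>H\<^esub> c n m \<odot>\<^bsub>H\<^esub> (t n i \<otimes>\<^bsub>H\<^esub> t m j) = \<zero>\<^bsub>H\<^esub>"
    using alg_hom_frt_rel[OF H presented_proj_alg_hom[of "frt_rels \<sigma>", folded frt_alg_def], of t a d q i j m n]
    by (simp add: presented_proj_free_gen frt_gen_def)
  then show ?thesis
    unfolding a_minus_def
    by (metis H.M.minus_equality H.M.minus_minus H.M.a_inv_closed H.m_closed H.smult_closed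
        complex_alg_simps(1) UNIV_I frt_gen_closed)
qed

text \<open>Both products in a relation vanish under the assignment unless \<open>m = j\<close> and
  \<open>n = i\<close>, and then the two scalars coincide.\<close>

lemma counit_exists:
  "\<exists>!f. extends_to_hom H complex_alg (\<lambda>(i, j). t i j) (\<lambda>(i, j). if i = j then 1 else 0) f"
proof -
  let ?h = "\<lambda>(i :: 'n, j). if i = j then 1 else 0 :: complex"
  note C = complex_algebra_complex_alg
  interpret C: complex_algebra complex_alg by (rule C)
  have minus: "x \<ominus>\<^bsub>complex_alg\<^esub> y = x - y" for x y
    using C.minus_eq_smult[of y] by (simp add: a_minus_def)
  have "free_hom complex_alg ?h r = \<zero>\<^bsub>complex_alg\<^esub>" if rel_r: "r \<in> frt_rels \<sigma>" for r
  proof -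
    obtain i j m n where r: "r = frt_rel \<sigma> i j m n"
      using rel_r by (auto simp: frt_rels_def)
    show ?thesis
      unfolding r
      by (subst alg_hom_frt_rel[OF C free_hom_alg_hom[OF C], where X = "\<lambda>i j. ?h (i, j)"])
        (auto simp: free_hom_free_gen[OF C] minus)
  qed
  then show ?thesis
    using extends_to_hom_presented[OF C, of ?h "frt_rels \<sigma>"]
    by (simp add: frt_alg_def frt_gen_def case_prod_unfold)
qed

text \<open>The proposed images \<open>X i j\<close> are the entries of a matrix product, one copy
  of \<open>T\<close> in each tensor factor. They satisfy the exchange relation because it can be
  applied in the two factors one after the other.\<close>

lemma comult_exists:
  "\<exists>!f. extends_to_hom H (tensor_alg H H) (\<lambda>(i, j). t i j)
    (\<lambda>(i, j). \<Oplus>\<^bsub>tensor_alg H H\<^esub>k\<in>UNIV. pure_tensor H H (t i k) (t k j)) f"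
proof -
  let ?HH = "tensor_alg H H"
  define X where "X i j = (\<Oplus>\<^bsub>?HH\<^esub>k\<in>UNIV. pure_tensor H H (t i k) (t k j))" for i j
  have closed: "pure_tensor H H (t i k) (t l j) \<in> carrier ?HH" for i j k l
    by (simp add: pure_tensor_closed[OF H H] frt_gen_closed)
  have X: "X i j \<in> carrier ?HH" for i j
    unfolding X_def by (rule HH.finsum_closed) (simp add: closed)
  have XX: "X m j \<otimes>\<^bsub>?HH\<^esub> X n i = (\<Oplus>\<^bsub>?HH\<^esub>r\<in>UNIV. \<Oplus>\<^bsub>?HH\<^esub>s\<in>UNIV.
      pure_tensor H H (t m r \<otimes>\<^bsub>H\<^esub> t n s) (t r j \<otimes>\<^bsub>H\<^esub> t s i))" for m n i j
    unfolding X_def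
    by (subst HH.finsum_ldistr, simp, simp add: closed HH.finsum_closed, simp add: closed,
      subst HH.finsum_rdistr, simp, simp add: closed HH.finsum_closed, simp add: closed)
     (simp add: pure_tensor_mult[OF H H] frt_gen_closed)
  have rel: "c i j \<odot>\<^bsub>?HH\<^esub> (X m j \<otimes>\<^bsub>?HH\<^esub> X n i) = c n m \<odot>\<^bsub>?HH\<^esub> (X n i \<otimes>\<^bsub>?HH\<^esub> X m j)" for i j m n
  proof -
    note TT = H.m_closed[OF frt_gen_closed frt_gen_closed]
    note smult = pure_tensor_smult[OF H H TT TT] pure_tensor_smult_right[OF H H TT TT]
    have "c i j \<odot>\<^bsub>?HH\<^esub> (X m j \<otimes>\<^bsub>?HH\<^esub> X n i) = (\<Oplus>\<^bsub>?HH\<^esub>r\<in>UNIV. \<Oplus>\<^bsub>?HH\<^esub>s\<in>UNIV.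
        c i j \<odot>\<^bsub>?HH\<^esub> pure_tensor H H (t m r \<otimes>\<^bsub>H\<^esub> t n s) (t r j \<otimes>\<^bsub>H\<^esub> t s i))"
      unfolding XX by (simp add: HH.smult_finsum HH.finsum_closed pure_tensor_closed[OF H H] TT)
    also have "\<dots> = (\<Oplus>\<^bsub>?HH\<^esub>r\<in>UNIV. \<Oplus>\<^bsub>?HH\<^esub>s\<in>UNIV.
        c n m \<odot>\<^bsub>?HH\<^esub> pure_tensor H H (t n s \<otimes>\<^bsub>H\<^esub> t m r) (t s i \<otimes>\<^bsub>H\<^esub> t r j))"
    proof -
      \<comment> \<open>The intermediate scalar is \<open>c s r\<close>: exchanging in the right
        factor replaces \<open>c i j\<close> by \<open>c s r\<close>, and exchanging in the left
        factor then replaces \<open>c s r\<close> by \<open>c n m\<close>.\<close>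
      have "c i j \<odot>\<^bsub>?HH\<^esub> pure_tensor H H (t m r \<otimes>\<^bsub>H\<^esub> t n s) (t r j \<otimes>\<^bsub>H\<^esub> t s i)
        = c n m \<odot>\<^bsub>?HH\<^esub> pure_tensor H H (t n s \<otimes>\<^bsub>H\<^esub> t m r) (t s i \<otimes>\<^bsub>H\<^esub> t r j)" for r s
        by (metis T_rel smult)
      then show ?thesis
        by simp
    qed
    also have "\<dots> = (\<Oplus>\<^bsub>?HH\<^esub>s\<in>UNIV. \<Oplus>\<^bsub>?HH\<^esub>r\<in>UNIV.
        c n m \<odot>\<^bsub>?HH\<^esub> pure_tensor H H (t n s \<otimes>\<^bsub>H\<^esub> t m r) (t s i \<otimes>\<^bsub>H\<^esub> t r j))"
      by (rule HH.finsum_swap) (simp_all add: pure_tensor_closed[OF H H] TT)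
    also have "\<dots> = c n m \<odot>\<^bsub>?HH\<^esub> (X n i \<otimes>\<^bsub>?HH\<^esub> X m j)"
      unfolding XX by (simp add: HH.smult_finsum HH.finsum_closed pure_tensor_closed[OF H H] TT)
    finally show ?thesis .
  qed
  have gen: "free_hom ?HH (\<lambda>(i, j). X i j) (free_gen (i, j)) = X i j" for i j
    by (subst free_hom_free_gen[OF HH]) (auto simp: X)
  have "free_hom ?HH (\<lambda>(i, j). X i j) r = \<zero>\<^bsub>?HH\<^esub>" if rel_r: "r \<in> frt_rels \<sigma>" for r
  proof -
    obtain i j m n where r: "r = frt_rel \<sigma> i j m n"
      using rel_r by (auto simp: frt_rels_def)
    show ?thesis
      unfolding r using rel[of i j m n]
      by (subst alg_hom_frt_rel[OF HH free_hom_alg_hom[OF HH], where X = X])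
        (auto simp: gen X HH.r_neg a_minus_def)
  qed
  then show ?thesis
    using extends_to_hom_presented[OF HH, of "\<lambda>(i, j). X i j" "frt_rels \<sigma>"] X
    by (simp add: frt_alg_def frt_gen_def case_prod_unfold X_def)
qed

context
  assumes sym: "symmetrization a d" and q: "q \<noteq> 0"
    and root: "\<forall>n::nat. n > 0 \<longrightarrow> (q powi (-2)) ^ n \<noteq> 1"
begin

lemma braid_scalar_sym: "c i j = c j i"
  using sym by (simp add: symmetrization_def braid_scalar_def)

lemma braid_scalar_nonzero: "c i j \<noteq> 0"
  using q by (simp add: braid_scalar_def)

text \<open>Squaring removes the sign, and the \<open>+ 1\<close> common to both exponents
  cancels.\<close>

lemma braid_scalar_square_inj: "(c i j)\<^sup>2 = (c r s)\<^sup>2 \<Longrightarrow> d i * a i j = d r * a r s"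
  using power_int_square_inj[OF q root, of "d i * a i j + 1" "d r * a r s + 1"]
  by (simp add: braid_scalar_def)

lemma
  shows frt_gen_mult_zero: "d n * a n m \<noteq> d i * a i j \<Longrightarrow> t n i \<otimes>\<^bsub>H\<^esub> t m j = \<zero>\<^bsub>H\<^esub>"
    and frt_gen_commute: "t n i \<otimes>\<^bsub>H\<^esub> t m j = t m j \<otimes>\<^bsub>H\<^esub> t n i"
proof -
  note t = frt_gen_closed[of \<sigma>]
  define x where "x = t m j \<otimes>\<^bsub>H\<^esub> t n i"
  define y where "y = t n i \<otimes>\<^bsub>H\<^esub> t m j"
  have xy: "x \<in> carrier H" "y \<in> carrier H"
    by (simp_all add: x_def y_def t)
  have 1: "c i j \<odot>\<^bsub>H\<^esub> x = c n m \<odot>\<^bsub>H\<^esub> y"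
    using T_rel[of i j m n] by (simp add: x_def y_def)
  have 2: "c i j \<odot>\<^bsub>H\<^esub> y = c n m \<odot>\<^bsub>H\<^esub> x"
    using T_rel[of j i n m] by (simp add: x_def y_def braid_scalar_sym[of j i] braid_scalar_sym[of m n])
  have cancel: "u = v" if "k \<odot>\<^bsub>H\<^esub> u = k \<odot>\<^bsub>H\<^esub> v" "k \<noteq> 0" "u \<in> carrier H" "v \<in> carrier H" for k u v
  proof -
    have "inverse k \<odot>\<^bsub>H\<^esub> (k \<odot>\<^bsub>H\<^esub> u) = inverse k \<odot>\<^bsub>H\<^esub> (k \<odot>\<^bsub>H\<^esub> v)"
      using that(1) by simp
    then show ?thesis
      using that(2-) by (simp add: H.smult_smult)
  qed
  \<comment> \<open>Eliminates \<open>x\<close> from the relations \<open>1\<close> and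
    \<open>2\<close>.\<close>
  have sq: "(c i j)\<^sup>2 \<odot>\<^bsub>H\<^esub> y = (c n m)\<^sup>2 \<odot>\<^bsub>H\<^esub> y"
    using arg_cong[OF 2, of "\<lambda>z. c i j \<odot>\<^bsub>H\<^esub> z"] arg_cong[OF 1, of "\<lambda>z. c n m \<odot>\<^bsub>H\<^esub> z"] xy
    by (simp add: H.smult_smult power2_eq_square mult.commute)
  \<comment> \<open>The difference of the squares is a nonzero scalar that annihilates
    \<open>y\<close>, so cancelling it against zero gives \<open>y = 0\<close>.\<close>
  have zero: "y = \<zero>\<^bsub>H\<^esub>" if "d n * a n m \<noteq> d i * a i j"
  proof (rule cancel)
    show "(c i j)\<^sup>2 - (c n m)\<^sup>2 \<noteq> 0"
      using braid_scalar_square_inj[of i j n m] that by auto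
    have "((c i j)\<^sup>2 - (c n m)\<^sup>2) \<odot>\<^bsub>H\<^esub> y = (c i j)\<^sup>2 \<odot>\<^bsub>H\<^esub> y \<oplus>\<^bsub>H\<^esub> (- (c n m)\<^sup>2) \<odot>\<^bsub>H\<^esub> y"
      using xy by (subst H.smult_add_left[symmetric]) auto
    also have "\<dots> = \<zero>\<^bsub>H\<^esub>"
      unfolding sq using xy by (subst H.smult_add_left[symmetric]) auto
    finally show "((c i j)\<^sup>2 - (c n m)\<^sup>2) \<odot>\<^bsub>H\<^esub> y = ((c i j)\<^sup>2 - (c n m)\<^sup>2) \<odot>\<^bsub>H\<^esub> \<zero>\<^bsub>H\<^esub>"
      by simp
  qed (use xy in auto)
  then show "d n * a n m \<noteq> d i * a i j \<Longrightarrow> t n i \<otimes>\<^bsub>H\<^esub> t m j = \<zero>\<^bsub>H\<^esub>"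
    by (simp add: y_def)
  have "y = x"
  proof (cases "d n * a n m = d i * a i j")
    case True
    then have "c i j \<odot>\<^bsub>H\<^esub> x = c i j \<odot>\<^bsub>H\<^esub> y"
      using 1 by (simp add: braid_scalar_def)
    then show ?thesis
      using cancel[OF _ braid_scalar_nonzero] xy by metis
  next
    \<comment> \<open>Here \<open>y\<close> is zero, so the first relation makes
      \<open>c i j\<close> times \<open>x\<close> zero as well.\<close>
    case False
    then have "c i j \<odot>\<^bsub>H\<^esub> x = c i j \<odot>\<^bsub>H\<^esub> y"
      using 1 zero by simp
    then show ?thesis
      using cancel[OF _ braid_scalar_nonzero] xy by metis
  qed
  then show "t n i \<otimes>\<^bsub>H\<^esub> t m j = t m j \<otimes>\<^bsub>H\<^esub> t n i"
    by (simp add: x_def y_def)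
qed

end

end

lemma bialgebra_frt_alg:
  fixes a :: "'n::finite \<Rightarrow> 'n \<Rightarrow> int" and d :: "'n \<Rightarrow> int" and q :: complex
  defines "\<sigma> \<equiv> cartan_braiding a d q"
  shows "bialgebra (frt_alg \<sigma>) (frt_comult \<sigma>) (frt_counit \<sigma>)"
    and "frt_comult \<sigma> (frt_gen \<sigma> i j) = (\<Oplus>\<^bsub>tensor_alg (frt_alg \<sigma>) (frt_alg \<sigma>)\<^esub>k\<in>UNIV.
      pure_tensor (frt_alg \<sigma>) (frt_alg \<sigma>) (frt_gen \<sigma> i k) (frt_gen \<sigma> k j))"
    and "frt_counit \<sigma> (frt_gen \<sigma> i j) = (if i = j then 1 else 0)"
proof -
  let ?H = "frt_alg \<sigma>" and ?T = "frt_gen \<sigma>" and ?\<Delta> = "frt_comult \<sigma>" and ?\<epsilon> = "frt_counit \<sigma>"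
  let ?HH = "tensor_alg ?H ?H"
  have H: "complex_algebra ?H" by (rule complex_algebra_frt_alg)
  note HH = complex_algebra_tensor_alg[OF H H]
  note T = frt_gen_closed[of \<sigma>]
  note \<Delta>' = extends_to_hom_induced_hom[OF comult_exists[of a d q, folded \<sigma>_def]]
  note \<epsilon>' = extends_to_hom_induced_hom[OF counit_exists[of a d q, folded \<sigma>_def]]
  have \<Delta>: "?\<Delta> \<in> alg_hom ?H ?HH" and \<epsilon>: "?\<epsilon> \<in> alg_hom ?H complex_alg"
    using \<Delta>'(1) \<epsilon>'(1) by (simp_all add: frt_comult_def frt_counit_def Let_def)
  show \<Delta>T: "?\<Delta> (?T i j) = (\<Oplus>\<^bsub>?HH\<^esub>k\<in>UNIV. pure_tensor ?H ?H (?T i k) (?T k j))" for i j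
    using \<Delta>'(2)[of "(i, j)"] by (simp add: frt_comult_def Let_def)
  show \<epsilon>T: "?\<epsilon> (?T i j) = (if i = j then 1 else 0)" for i j
    using \<epsilon>'(2)[of "(i, j)"] by (simp add: frt_counit_def)
  note HH_H = complex_algebra_tensor_alg[OF HH H] and H_HH = complex_algebra_tensor_alg[OF H HH]
  have eq_on_H: "f x = g x"
    if "complex_algebra B" "f \<in> alg_hom ?H B" "g \<in> alg_hom ?H B" "\<And>i j. f (?T i j) = g (?T i j)"
      "x \<in> carrier ?H" for f g x and B :: "(complex, 'b) module"
    using that alg_hom_eq_on_generators[of B f "frt_rels \<sigma>" g x]
    by (auto simp: frt_alg_def frt_gen_def)
  have "tensor_assoc ?H ?H ?H (tensor_map ?H ?H ?HH ?H ?\<Delta> (\<lambda>y. y) (?\<Delta> x)) =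
        tensor_map ?H ?H ?H ?HH (\<lambda>y. y) ?\<Delta> (?\<Delta> x)" if x: "x \<in> carrier ?H" for x
    using x
  proof (rule alg_hom_eq_on_generators[OF H_HH, of _ "frt_rels \<sigma>", folded frt_alg_def, rotated 3])
    show "(\<lambda>x. tensor_assoc ?H ?H ?H (tensor_map ?H ?H ?HH ?H ?\<Delta> (\<lambda>y. y) (?\<Delta> x)))
        \<in> alg_hom ?H (tensor_alg ?H ?HH)"
      by (rule alg_hom_comp[OF alg_hom_comp[OF \<Delta> tensor_map_alg_hom[OF H H HH H \<Delta> id_alg_hom]]
          tensor_assoc_alg_hom[OF H H H]])
    show "(\<lambda>x. tensor_map ?H ?H ?H ?HH (\<lambda>y. y) ?\<Delta> (?\<Delta> x)) \<in> alg_hom ?H (tensor_alg ?H ?HH)"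
      by (rule alg_hom_comp[OF \<Delta> tensor_map_alg_hom[OF H H H HH id_alg_hom \<Delta>]])
    fix p :: "'n \<times> 'n"
    show "tensor_assoc ?H ?H ?H (tensor_map ?H ?H ?HH ?H ?\<Delta> (\<lambda>y. y) (?\<Delta> (presented_gen (frt_rels \<sigma>) p))) =
        tensor_map ?H ?H ?H ?HH (\<lambda>y. y) ?\<Delta> (?\<Delta> (presented_gen (frt_rels \<sigma>) p))"
      using coassociative_on_matrix_coaction[where v = "?T (fst p)" and T = ?T and j = "snd p",
          OF H H \<Delta> \<Delta> T T \<Delta>T \<Delta>T]
      by (simp add: frt_gen_def)
  qed
  moreover have "tensor_lift ?H ?H ?H (\<lambda>y z. ?\<epsilon> y \<odot>\<^bsub>?H\<^esub> z) (?\<Delta> x) = x" if x: "x \<in> carrier ?H" for x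
    using x
  proof (rule eq_on_H[OF H alg_hom_comp[OF \<Delta> counit_left_alg_hom[OF H H \<epsilon>]] id_alg_hom, rotated])
    fix i j
    show "tensor_lift ?H ?H ?H (\<lambda>y z. ?\<epsilon> y \<odot>\<^bsub>?H\<^esub> z) (?\<Delta> (?T i j)) = ?T i j"
      \<comment> \<open>The left counit consumes the first factor of
        \<open>T i k \<otimes> T k j\<close>, so \<open>v\<close> is column \<open>j\<close> here;
        for the right counit below it is row \<open>i\<close>.\<close>
      unfolding \<Delta>T by (rule counit_on_matrix_coaction(2)[where v = "\<lambda>k. ?T k j", OF H H \<epsilon> T T \<epsilon>T])
  qed
  moreover have "tensor_lift ?H ?H ?H (\<lambda>y z. ?\<epsilon> z \<odot>\<^bsub>?H\<^esub> y) (?\<Delta> x) = x" if x: "x \<in> carrier ?H" for x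
    using x
  proof (rule eq_on_H[OF H alg_hom_comp[OF \<Delta> counit_right_alg_hom[OF H H \<epsilon>]] id_alg_hom, rotated])
    fix i j
    show "tensor_lift ?H ?H ?H (\<lambda>y z. ?\<epsilon> z \<odot>\<^bsub>?H\<^esub> y) (?\<Delta> (?T i j)) = ?T i j"
      unfolding \<Delta>T by (rule counit_on_matrix_coaction(1)[where v = "?T i", OF H H \<epsilon> T T \<epsilon>T])
  qed
  ultimately show "bialgebra ?H ?\<Delta> ?\<epsilon>"
    using H \<Delta> \<epsilon> by (simp add: bialgebra_def)
qed

section \<open>The coaction\<close>

lemma (in ring) finsum_mult_singleton:
  assumes "finite I" "r \<in> I" "\<And>s. s \<in> I \<Longrightarrow> f s \<in> carrier R" "x \<in> carrier R"
    and "\<And>s. \<lbrakk>s \<in> I; r \<noteq> s\<rbrakk> \<Longrightarrow> x \<otimes> f s = \<zero>"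
  shows "x \<otimes> (\<Oplus>s\<in>I. f s) = x \<otimes> f r"
proof -
  have "x \<otimes> (\<Oplus>s\<in>I. f s) = (\<Oplus>s\<in>I. x \<otimes> f s)"
    using assms(1,3,4) by (intro finsum_rdistr) auto
  also have "\<dots> = (\<Oplus>s\<in>I. if r = s then x \<otimes> f s else \<zero>)"
    using assms(3-5) by (intro finsum_cong') auto
  also have "\<dots> = x \<otimes> f r"
    using assms(1-4) by (intro finsum_singleton) auto
  finally show ?thesis .
qed

text \<open>Every mixed term of the expansion contains two adjacent distinct factors. The exponent
  is a successor because at exponent 0 the right-hand side would add up one unit for each
  index.\<close>

lemma (in ring) pow_finsum_orthogonal:
  assumes I: "finite I" and P: "\<And>r. r \<in> I \<Longrightarrow> P r \<in> carrier R"
    and orth: "\<And>r s. \<lbrakk>r \<in> I; s \<in> I; r \<noteq> s\<rbrakk> \<Longrightarrow> P r \<otimes> P s = \<zero>"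
  shows "(\<Oplus>r\<in>I. P r) [^] Suc k = (\<Oplus>r\<in>I. P r [^] Suc k)"
proof (induction k)
  case 0
  have "(\<Oplus>r\<in>I. P r [^] Suc 0) = (\<Oplus>r\<in>I. P r)"
    using P by (intro finsum_cong') auto
  moreover have "(\<Oplus>r\<in>I. P r) \<in> carrier R"
    using P by (intro finsum_closed) auto
  ultimately show ?case
    by simp
next
  case (Suc k)
  have "(P r [^] Suc k) \<otimes> (\<Oplus>s\<in>I. P s) = P r [^] Suc (Suc k)" if r: "r \<in> I" for r
  proof -
    have "(P r [^] Suc k) \<otimes> P s = \<zero>" if "s \<in> I" "r \<noteq> s" for s
      using that r P orth[of r s] by (simp add: m_assoc)
    then show ?thesis
      using I P r finsum_mult_singleton[of I r P "P r [^] Suc k"] by simp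
  qed
  then have "(\<Oplus>r\<in>I. P r [^] Suc k \<otimes> (\<Oplus>s\<in>I. P s)) = (\<Oplus>r\<in>I. P r [^] Suc (Suc k))"
    using P by (intro finsum_cong') auto
  moreover have "(\<Oplus>r\<in>I. P r [^] Suc k) \<otimes> (\<Oplus>s\<in>I. P s) = (\<Oplus>r\<in>I. P r [^] Suc k \<otimes> (\<Oplus>s\<in>I. P s))"
    using I P by (intro finsum_ldistr) (auto intro!: finsum_closed)
  ultimately show ?case
    using Suc by simp
qed

text \<open>If one exponent is zero, the power formula and distributivity suffice; if both are
  positive, \<open>orthY\<close> kills the cross terms. The condition \<open>k + l > 0\<close> rules
  out the case where the right-hand side would repeat \<open>Y\<close> once for each index.\<close>

lemma (in ring) sandwich_finsum_orthogonal:
  assumes I: "finite I" and P: "\<And>r. r \<in> I \<Longrightarrow> P r \<in> carrier R"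
    and orth: "\<And>r s. \<lbrakk>r \<in> I; s \<in> I; r \<noteq> s\<rbrakk> \<Longrightarrow> P r \<otimes> P s = \<zero>"
    and Y: "Y \<in> carrier R" and orthY: "\<And>r s. \<lbrakk>r \<in> I; s \<in> I; r \<noteq> s\<rbrakk> \<Longrightarrow> P r \<otimes> Y \<otimes> P s = \<zero>"
    and kl: "k + l > 0"
  shows "(\<Oplus>r\<in>I. P r) [^] k \<otimes> Y \<otimes> (\<Oplus>r\<in>I. P r) [^] l = (\<Oplus>r\<in>I. P r [^] k \<otimes> Y \<otimes> P r [^] (l :: nat))"
proof -
  have pow: "(\<Oplus>r\<in>I. P r) [^] Suc j = (\<Oplus>r\<in>I. P r [^] Suc j)" for j
    by (rule pow_finsum_orthogonal[OF I]) (use P orth in auto)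
  have sum_closed: "(\<Oplus>r\<in>I. P r [^] (j :: nat)) \<in> carrier R" for j
    using P by (intro finsum_closed) auto
  consider "k = 0" "l > 0" | k' where "k = Suc k'" "l = 0" | k' l' where "k = Suc k'" "l = Suc l'"
    using kl by (cases k; cases l) auto
  then show ?thesis
  proof cases
    case 1
    then obtain l' where l: "l = Suc l'"
      by (cases l) auto
    have "Y \<otimes> (\<Oplus>r\<in>I. P r) [^] l = (\<Oplus>r\<in>I. Y \<otimes> P r [^] l)"
      unfolding l pow using I P Y by (intro finsum_rdistr) auto
    then show ?thesis
      using 1 Y P by (simp cong: finsum_cong)
  next
    case 2
    have "(\<Oplus>r\<in>I. P r) [^] k \<otimes> Y = (\<Oplus>r\<in>I. P r [^] k \<otimes> Y)"
      unfolding 2(1) pow using I P Y by (intro finsum_ldistr) auto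
    moreover have "(\<Oplus>r\<in>I. P r [^] k \<otimes> Y \<otimes> P r [^] l) = (\<Oplus>r\<in>I. P r [^] k \<otimes> Y)"
      using Y P 2(2) by (intro finsum_cong') auto
    moreover have "(\<Oplus>r\<in>I. P r) [^] k \<otimes> Y \<in> carrier R"
      unfolding 2(1) pow using sum_closed Y by (intro m_closed)
    ultimately show ?thesis
      using 2(2) by simp
  next
    case 3
    have single: "P r [^] k \<otimes> Y \<otimes> (\<Oplus>s\<in>I. P s [^] l) = P r [^] k \<otimes> Y \<otimes> P r [^] l" if r: "r \<in> I" for r
    proof (rule finsum_mult_singleton)
      fix s assume s: "s \<in> I" "r \<noteq> s"
      \<comment> \<open>The innermost factors on both sides of \<open>Y\<close> are split off, which
        exposes the vanishing product of \<open>orthY\<close>.\<close>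
      have "P r [^] k \<otimes> Y \<otimes> P s [^] l = P r [^] k' \<otimes> (P r \<otimes> Y \<otimes> P s) \<otimes> P s [^] l'"
        using r s P Y unfolding 3 nat_pow_Suc2[OF P[OF s(1)]] by (simp add: m_assoc)
      then show "P r [^] k \<otimes> Y \<otimes> P s [^] l = \<zero>"
        using orthY[OF r s] r s P by simp
    qed (use I P Y r in auto)
    have "(\<Oplus>r\<in>I. P r [^] k) \<otimes> Y \<otimes> (\<Oplus>r\<in>I. P r [^] l)
        = (\<Oplus>r\<in>I. P r [^] k \<otimes> Y) \<otimes> (\<Oplus>r\<in>I. P r [^] l)"
      using finsum_ldistr[of I Y "\<lambda>r. P r [^] k"] I P Y by auto
    also have "\<dots> = (\<Oplus>r\<in>I. P r [^] k \<otimes> Y \<otimes> (\<Oplus>r\<in>I. P r [^] l))"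
      using I P Y sum_closed by (intro finsum_ldistr) auto
    also have "\<dots> = (\<Oplus>r\<in>I. P r [^] k \<otimes> Y \<otimes> P r [^] l)"
      using P Y single by (intro finsum_cong') auto
    finally show ?thesis
      unfolding 3 pow .
  qed
qed

section \<open>Serre elements under homomorphisms\<close>

lemma alg_hom_pow:
  assumes "complex_algebra A" "complex_algebra B" "f \<in> alg_hom A B" "x \<in> carrier A"
  shows "f (x [^]\<^bsub>A\<^esub> (k :: nat)) = f x [^]\<^bsub>B\<^esub> k"
proof -
  interpret A: complex_algebra A by fact
  interpret B: complex_algebra B by fact
  show ?thesis
    using assms(4) by (induction k) (simp_all add: alg_homD(2,3)[OF assms(3)])
qed

text \<open>Used twice: with the projection it yields the quantum Serre relations of the generators,
  and with \<open>free_hom\<close> it reduces existence of the coaction to the same expression in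
  the proposed images.\<close>

lemma alg_hom_serre_element:
  fixes \<phi> :: "('n::finite list \<Rightarrow>\<^sub>0 complex) \<Rightarrow> 'b"
  assumes B: "complex_algebra B" and \<phi>: "\<phi> \<in> alg_hom free_alg B"
    and X: "\<And>i. \<phi> (free_gen i) = X i" and m: "m = nat (1 - a i j)"
  shows "\<phi> (serre_element a d q i j) = (\<Oplus>\<^bsub>B\<^esub>k\<in>{0..m}. ((-1) ^ k * q_binomial q (d i) m k) \<odot>\<^bsub>B\<^esub>
    (X i [^]\<^bsub>B\<^esub> k \<otimes>\<^bsub>B\<^esub> X j \<otimes>\<^bsub>B\<^esub> X i [^]\<^bsub>B\<^esub> (m - k)))"
  unfolding serre_element_def Let_def m[symmetric]
  by (subst lin_hom_finsum[OF complex_algebra_free_alg B alg_homD(1)[OF \<phi>]])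
    (simp_all add: lin_homD(3)[OF alg_homD(1)[OF \<phi>]] alg_homD(3)[OF \<phi>] X
      alg_hom_pow[OF complex_algebra_free_alg B \<phi>])

text \<open>The hypothesis makes the denominator of the quantum number of 1 nonzero, so that this
  number is 1 whatever \<open>D\<close> is.\<close>

lemma q_binomial_1:
  assumes "k \<le> 1" "q powi D \<noteq> q powi (- D)"
  shows "q_binomial q D 1 k = 1"
  using assms by (cases k) (auto simp: q_binomial_def q_number_def)

lemma (in Group.monoid) pow_commute:
  assumes "x \<in> carrier G" "y \<in> carrier G" "x \<otimes> y = y \<otimes> x"
  shows "y \<otimes> x [^] (k :: nat) = x [^] k \<otimes> y"
proof (induction k)
  case (Suc k)
  have "y \<otimes> x [^] Suc k = x [^] k \<otimes> (y \<otimes> x)"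
    using assms Suc by (simp flip: m_assoc)
  also have "\<dots> = x [^] Suc k \<otimes> y"
    using assms by (simp add: m_assoc)
  finally show ?case .
qed (use assms in simp)

lemma complex_algebra_Uq_plus: "complex_algebra (Uq_plus a d q)"
  by (simp add: Uq_plus_def complex_algebra_presented_alg)

lemma Uq_gen_closed: "Uq_gen a d q i \<in> carrier (Uq_plus a d q)"
  by (simp add: Uq_gen_def Uq_plus_def)

lemma quantum_serre:
  assumes "i \<noteq> j" and m: "m = nat (1 - a i j)"
  shows "(\<Oplus>\<^bsub>Uq_plus a d q\<^esub>k\<in>{0..m}. ((-1) ^ k * q_binomial q (d i) m k) \<odot>\<^bsub>Uq_plus a d q\<^esub>
    (Uq_gen a d q i [^]\<^bsub>Uq_plus a d q\<^esub> k \<otimes>\<^bsub>Uq_plus a d q\<^esub> Uq_gen a d q j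
      \<otimes>\<^bsub>Uq_plus a d q\<^esub> Uq_gen a d q i [^]\<^bsub>Uq_plus a d q\<^esub> (m - k))) = \<zero>\<^bsub>Uq_plus a d q\<^esub>"
proof -
  have "presented_proj (serre_rels a d q) (serre_element a d q i j) = \<zero>\<^bsub>Uq_plus a d q\<^esub>"
    unfolding Uq_plus_def using assms(1) by (intro presented_proj_rel) (auto simp: serre_rels_def)
  moreover have "presented_proj (serre_rels a d q) (free_gen i) = Uq_gen a d q i" for i
    by (simp add: presented_proj_free_gen Uq_gen_def)
  ultimately show ?thesis
    using alg_hom_serre_element[where X = "Uq_gen a d q" and a = a and d = d and q = q, OF
        complex_algebra_Uq_plus[of a d q] presented_proj_alg_hom[of "serre_rels a d q", folded Uq_plus_def] _ m]
    by simp
qed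

section \<open>Serre relations for the images of the generators, and the comodule algebra\<close>

context
  fixes a :: "'n::finite \<Rightarrow> 'n \<Rightarrow> int" and d :: "'n \<Rightarrow> int" and q :: complex
  assumes cartan: "generalized_cartan_matrix a" and sym: "symmetrization a d" and q: "q \<noteq> 0"
    and root: "\<forall>n::nat. n > 0 \<longrightarrow> (q powi (-2)) ^ n \<noteq> 1"
begin

private abbreviation (input) "U \<equiv> Uq_plus a d q"
private abbreviation (input) "e \<equiv> Uq_gen a d q"
private abbreviation (input) "A \<equiv> frt_alg (cartan_braiding a d q)"
private abbreviation (input) "T \<equiv> frt_gen (cartan_braiding a d q)"
private abbreviation (input) "W \<equiv> tensor_alg U A"
private abbreviation (input) "tensor \<equiv> pure_tensor U A"

private lemmas U = complex_algebra_Uq_plus[of a d q]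
private lemmas A = complex_algebra_frt_alg[of "cartan_braiding a d q"]
private lemmas W = complex_algebra_tensor_alg[OF U A]
private lemmas e = Uq_gen_closed[of a d q]
private lemmas T = frt_gen_closed[of "cartan_braiding a d q"]
private lemmas T_zero = frt_gen_mult_zero[OF sym q root]
private lemmas T_commute = frt_gen_commute[OF sym q root]

interpretation U: complex_algebra U by (rule U)
interpretation A: complex_algebra A by (rule A)
interpretation W: complex_algebra W by (rule W)

private lemma d_pos: "d i > 0"
  using sym by (simp add: symmetrization_def)

private lemma a_nonpos: "i \<noteq> j \<Longrightarrow> a i j \<le> 0"
  using cartan by (simp add: generalized_cartan_matrix_def)

private lemma a_diag: "a i i = 2"
  using cartan by (simp add: generalized_cartan_matrix_def)

private lemma q_powi_neq: "q powi d i \<noteq> q powi (- d i)"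
  using power_int_square_inj[OF q root, of "d i" "- d i"] d_pos[of i] by auto

private lemma d_a_nonpos: "i \<noteq> j \<Longrightarrow> d i * a i j \<le> 0"
  using a_nonpos[of i j] d_pos[of i] by (simp add: mult_le_0_iff)

text \<open>The monomials that survive in \<open>A\<close> only occur next to Serre relations of \<open>U\<close> of the same
  shape. For \<open>m = 1\<close> the integers \<open>d r\<close> and \<open>d i\<close> may differ, but then all the quantum binomial
  coefficients are \<open>1\<close>.\<close>

private lemma serre_or_zero:
  assumes ij: "i \<noteq> j" and m: "m = nat (1 - a i j)"
    and nz: "T r i [^]\<^bsub>A\<^esub> m \<otimes>\<^bsub>A\<^esub> T s j \<noteq> \<zero>\<^bsub>A\<^esub>"
  shows "(\<Oplus>\<^bsub>U\<^esub>k\<in>{0..m}. ((-1) ^ k * q_binomial q (d i) m k) \<odot>\<^bsub>U\<^esub>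
    (e r [^]\<^bsub>U\<^esub> k \<otimes>\<^bsub>U\<^esub> e s \<otimes>\<^bsub>U\<^esub> e r [^]\<^bsub>U\<^esub> (m - k))) = \<zero>\<^bsub>U\<^esub>"
proof -
  have "m > 0"
    using m a_nonpos[OF ij] by simp
  then obtain m' where m': "m = Suc m'"
    using gr0_implies_Suc by blast
  \<comment> \<open>As \<open>m \<ge> 1\<close>, a factor \<open>T r i\<close> stands next to
    \<open>T s j\<close>; a nonzero monomial needs this product to be nonzero.\<close>
  have rs: "d r * a r s = d i * a i j"
  proof (rule ccontr)
    assume "d r * a r s \<noteq> d i * a i j"
    then have "T r i \<otimes>\<^bsub>A\<^esub> T s j = \<zero>\<^bsub>A\<^esub>"
      by (rule T_zero)
    then have "T r i [^]\<^bsub>A\<^esub> m \<otimes>\<^bsub>A\<^esub> T s j = \<zero>\<^bsub>A\<^esub>"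
      using T by (simp add: m' A.m_assoc)
    then show False
      using nz by simp
  qed
  \<comment> \<open>Otherwise \<open>2 * d r\<close>, which is positive, would equal
    \<open>d i * a i j\<close>, which is not.\<close>
  have "r \<noteq> s"
  proof
    assume "r = s"
    then show False
      using rs d_pos[of r] d_a_nonpos[OF ij] by (simp add: a_diag)
  qed
  show ?thesis
  proof (cases "a i j = 0")
    case True
    then have "a r s = 0" "m = 1"
      using rs d_pos[of r] m by auto
    then have "q_binomial q (d i) m k = q_binomial q (d r) m k" if "k \<in> {0..m}" for k
      using that q_binomial_1[OF _ q_powi_neq] by simp
    then have "(\<Oplus>\<^bsub>U\<^esub>k\<in>{0..m}. ((-1) ^ k * q_binomial q (d i) m k) \<odot>\<^bsub>U\<^esub>
      (e r [^]\<^bsub>U\<^esub> k \<otimes>\<^bsub>U\<^esub> e s \<otimes>\<^bsub>U\<^esub> e r [^]\<^bsub>U\<^esub> (m - k))) =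
      (\<Oplus>\<^bsub>U\<^esub>k\<in>{0..m}. ((-1) ^ k * q_binomial q (d r) m k) \<odot>\<^bsub>U\<^esub>
      (e r [^]\<^bsub>U\<^esub> k \<otimes>\<^bsub>U\<^esub> e s \<otimes>\<^bsub>U\<^esub> e r [^]\<^bsub>U\<^esub> (m - k)))"
      by (intro U.finsum_cong') (auto simp: e)
    then show ?thesis
      using quantum_serre[OF \<open>r \<noteq> s\<close>, of m a d q] \<open>a r s = 0\<close> \<open>m = 1\<close> by simp
  next
    case False
    then have "m' > 0"
      using m m' a_nonpos[OF ij] by simp
    then obtain m'' where m'': "m' = Suc m''"
      using gr0_implies_Suc by blast
    \<comment> \<open>Now \<open>m \<ge> 2\<close>, so \<open>T r i\<close> occurs twice and its
      square must be nonzero. Both diagonal entries of \<open>a\<close> are 2, whence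
      \<open>d r = d i\<close>.\<close>
    have "d r * a r r = d i * a i i"
    proof (rule ccontr)
      assume "d r * a r r \<noteq> d i * a i i"
      then have "T r i \<otimes>\<^bsub>A\<^esub> T r i = \<zero>\<^bsub>A\<^esub>"
        by (rule T_zero)
      then have "T r i [^]\<^bsub>A\<^esub> m = \<zero>\<^bsub>A\<^esub>"
        using T by (simp add: m' m'' A.m_assoc)
      then show False
        using nz T by simp
    qed
    then have "d r = d i"
      by (simp add: a_diag)
    then have "a r s = a i j"
      using rs d_pos[of r] by simp
    then show ?thesis
      using quantum_serre[OF \<open>r \<noteq> s\<close>, of m a d q] m \<open>d r = d i\<close> by simp
  qed
qed

private definition E :: "'n \<Rightarrow> (('n list \<Rightarrow>\<^sub>0 complex) set \<times> (('n \<times> 'n) list \<Rightarrow>\<^sub>0 complex) set \<Rightarrow>\<^sub>0 complex) set"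
  where "E i = (\<Oplus>\<^bsub>W\<^esub>j\<in>UNIV. tensor (e j) (T j i))"

private lemma tensor_closed: "\<lbrakk>x \<in> carrier U; y \<in> carrier A\<rbrakk> \<Longrightarrow> tensor x y \<in> carrier W"
  by (rule pure_tensor_closed[OF U A])

private lemma E_closed: "E i \<in> carrier W"
  unfolding E_def by (rule W.finsum_closed) (simp add: tensor_closed e T)

text \<open>Commutativity of the generators of \<open>A\<close> gathers the powers of
  \<open>T r i\<close> to the left of \<open>T s j\<close>. The resulting monomial does not depend
  on \<open>k\<close>, so the Serre sum over \<open>k\<close> takes place in the first tensor factor
  alone.\<close>

private lemma sandwich_pure:
  fixes k m :: nat
  assumes "k \<le> m"
  shows "tensor (e r) (T r i) [^]\<^bsub>W\<^esub> k \<otimes>\<^bsub>W\<^esub> tensor (e s) (T s j) \<otimes>\<^bsub>W\<^esub> tensor (e r) (T r i) [^]\<^bsub>W\<^esub> (m - k) =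
    tensor (e r [^]\<^bsub>U\<^esub> k \<otimes>\<^bsub>U\<^esub> e s \<otimes>\<^bsub>U\<^esub> e r [^]\<^bsub>U\<^esub> (m - k)) (T r i [^]\<^bsub>A\<^esub> m \<otimes>\<^bsub>A\<^esub> T s j)"
proof -
  have "T r i [^]\<^bsub>A\<^esub> k \<otimes>\<^bsub>A\<^esub> T s j \<otimes>\<^bsub>A\<^esub> T r i [^]\<^bsub>A\<^esub> (m - k)
      = T r i [^]\<^bsub>A\<^esub> k \<otimes>\<^bsub>A\<^esub> (T r i [^]\<^bsub>A\<^esub> (m - k) \<otimes>\<^bsub>A\<^esub> T s j)"
    using A.pow_commute[OF T[of r i] T[of s j] T_commute, of "m - k"]
    by (simp add: A.m_assoc T)
  also have "\<dots> = T r i [^]\<^bsub>A\<^esub> m \<otimes>\<^bsub>A\<^esub> T s j"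
    using assms T by (simp add: A.nat_pow_mult flip: A.m_assoc)
  finally show ?thesis
    by (simp add: pure_tensor_pow[OF U A] pure_tensor_mult[OF U A] e T)
qed

text \<open>For fixed \<open>i\<close> the terms of \<open>E i\<close> are pairwise orthogonal, even
  with \<open>E j\<close> between them, so both outer powers run over a common index
  \<open>r\<close>. The index \<open>s\<close> of the middle factor remains free.\<close>

private lemma sandwich_E:
  fixes k m :: nat
  assumes "k \<le> m" "m > 0"
  shows "E i [^]\<^bsub>W\<^esub> k \<otimes>\<^bsub>W\<^esub> E j \<otimes>\<^bsub>W\<^esub> E i [^]\<^bsub>W\<^esub> (m - k) = (\<Oplus>\<^bsub>W\<^esub>r\<in>UNIV. \<Oplus>\<^bsub>W\<^esub>s\<in>UNIV.
    tensor (e r [^]\<^bsub>U\<^esub> k \<otimes>\<^bsub>U\<^esub> e s \<otimes>\<^bsub>U\<^esub> e r [^]\<^bsub>U\<^esub> (m - k)) (T r i [^]\<^bsub>A\<^esub> m \<otimes>\<^bsub>A\<^esub> T s j))"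
proof -
  let ?P = "\<lambda>r. tensor (e r) (T r i)"
  have P: "?P r \<in> carrier W" and Q: "tensor (e s) (T s j) \<in> carrier W" for r s
    by (simp_all add: tensor_closed e T)
  have zero: "T r i \<otimes>\<^bsub>A\<^esub> T s i = \<zero>\<^bsub>A\<^esub>" if "r \<noteq> s" for r s
    using d_a_nonpos[OF that] d_pos[of i] by (intro T_zero) (simp add: a_diag)
  have sum_E: "x \<otimes>\<^bsub>W\<^esub> E j \<otimes>\<^bsub>W\<^esub> y = (\<Oplus>\<^bsub>W\<^esub>s\<in>UNIV. x \<otimes>\<^bsub>W\<^esub> tensor (e s) (T s j) \<otimes>\<^bsub>W\<^esub> y)"
    if "x \<in> carrier W" "y \<in> carrier W" for x y
  proof -
    have "x \<otimes>\<^bsub>W\<^esub> E j = (\<Oplus>\<^bsub>W\<^esub>s\<in>UNIV. x \<otimes>\<^bsub>W\<^esub> tensor (e s) (T s j))"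
      unfolding E_def using that Q by (intro W.finsum_rdistr) auto
    then show ?thesis
      using that Q by (simp add: W.finsum_ldistr)
  qed
  have "?P r \<otimes>\<^bsub>W\<^esub> ?P s = \<zero>\<^bsub>W\<^esub>" if "r \<noteq> s" for r s
    using that by (simp add: pure_tensor_mult[OF U A] zero pure_tensor_zero_right[OF U A] e T)
  moreover have "?P r \<otimes>\<^bsub>W\<^esub> E j \<otimes>\<^bsub>W\<^esub> ?P s = \<zero>\<^bsub>W\<^esub>" if "r \<noteq> s" for r s
  proof -
    \<comment> \<open>Moving \<open>T t j\<close> to the right of \<open>T s i\<close> brings the
      vanishing product of \<open>T r i\<close> and \<open>T s i\<close> together.\<close>
    have "T r i \<otimes>\<^bsub>A\<^esub> T t j \<otimes>\<^bsub>A\<^esub> T s i = \<zero>\<^bsub>A\<^esub>" for t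
      using zero[OF that] T by (simp add: T_commute[of t j s i] A.m_assoc flip: A.m_assoc[of _ "T s i"])
    then show ?thesis
      using P by (simp add: sum_E pure_tensor_mult[OF U A] pure_tensor_zero_right[OF U A] e T)
  qed
  ultimately have "E i [^]\<^bsub>W\<^esub> k \<otimes>\<^bsub>W\<^esub> E j \<otimes>\<^bsub>W\<^esub> E i [^]\<^bsub>W\<^esub> (m - k)
      = (\<Oplus>\<^bsub>W\<^esub>r\<in>UNIV. ?P r [^]\<^bsub>W\<^esub> k \<otimes>\<^bsub>W\<^esub> E j \<otimes>\<^bsub>W\<^esub> ?P r [^]\<^bsub>W\<^esub> (m - k))"
    using assms P E_closed unfolding E_def[of i]
    by (intro W.sandwich_finsum_orthogonal) auto
  then show ?thesis
    using P by (simp add: sum_E sandwich_pure[OF assms(1)])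
qed

text \<open>The summations are exchanged so that \<open>k\<close> becomes innermost. For fixed
  \<open>r\<close> and \<open>s\<close> the right factor is constant and the coefficients pass into
  the left factor; by \<open>serre_or_zero\<close> one of the two factors is zero.\<close>

private lemma serre_E:
  assumes ij: "i \<noteq> j" and m: "m = nat (1 - a i j)"
  shows "(\<Oplus>\<^bsub>W\<^esub>k\<in>{0..m}. ((-1) ^ k * q_binomial q (d i) m k) \<odot>\<^bsub>W\<^esub>
    (E i [^]\<^bsub>W\<^esub> k \<otimes>\<^bsub>W\<^esub> E j \<otimes>\<^bsub>W\<^esub> E i [^]\<^bsub>W\<^esub> (m - k))) = \<zero>\<^bsub>W\<^esub>"
proof -
  have m_pos: "m > 0"
    using m a_nonpos[OF ij] by simp
  let ?c = "\<lambda>k. (-1) ^ k * q_binomial q (d i) m k"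
  let ?M = "\<lambda>r s k. e r [^]\<^bsub>U\<^esub> k \<otimes>\<^bsub>U\<^esub> e s \<otimes>\<^bsub>U\<^esub> e r [^]\<^bsub>U\<^esub> (m - k)"
  let ?\<tau> = "\<lambda>r s. T r i [^]\<^bsub>A\<^esub> m \<otimes>\<^bsub>A\<^esub> T s j"
  have M: "?M r s k \<in> carrier U" and \<tau>: "?\<tau> r s \<in> carrier A" for r s k
    by (simp_all add: e T)
  have "(\<Oplus>\<^bsub>W\<^esub>k\<in>{0..m}. ?c k \<odot>\<^bsub>W\<^esub> (E i [^]\<^bsub>W\<^esub> k \<otimes>\<^bsub>W\<^esub> E j \<otimes>\<^bsub>W\<^esub> E i [^]\<^bsub>W\<^esub> (m - k)))
      = (\<Oplus>\<^bsub>W\<^esub>k\<in>{0..m}. \<Oplus>\<^bsub>W\<^esub>r\<in>UNIV. \<Oplus>\<^bsub>W\<^esub>s\<in>UNIV. tensor (?c k \<odot>\<^bsub>U\<^esub> ?M r s k) (?\<tau> r s))"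
    using m_pos M \<tau>
    by (intro W.finsum_cong' refl)
      (auto simp: sandwich_E W.smult_finsum W.finsum_closed tensor_closed pure_tensor_smult[OF U A])
  also have "\<dots> = (\<Oplus>\<^bsub>W\<^esub>r\<in>UNIV. \<Oplus>\<^bsub>W\<^esub>k\<in>{0..m}. \<Oplus>\<^bsub>W\<^esub>s\<in>UNIV. tensor (?c k \<odot>\<^bsub>U\<^esub> ?M r s k) (?\<tau> r s))"
    using M \<tau> by (intro W.finsum_swap) (auto intro!: W.finsum_closed simp: tensor_closed)
  also have "\<dots> = (\<Oplus>\<^bsub>W\<^esub>r\<in>UNIV. \<Oplus>\<^bsub>W\<^esub>s\<in>UNIV. \<Oplus>\<^bsub>W\<^esub>k\<in>{0..m}. tensor (?c k \<odot>\<^bsub>U\<^esub> ?M r s k) (?\<tau> r s))"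
    using M \<tau> by (intro W.finsum_cong' W.finsum_swap) (auto intro!: W.finsum_closed simp: tensor_closed)
  also have "\<dots> = (\<Oplus>\<^bsub>W\<^esub>r\<in>UNIV. \<Oplus>\<^bsub>W\<^esub>s\<in>UNIV. \<zero>\<^bsub>W\<^esub>)"
  proof -
    have "(\<Oplus>\<^bsub>W\<^esub>k\<in>{0..m}. tensor (?c k \<odot>\<^bsub>U\<^esub> ?M r s k) (?\<tau> r s)) = \<zero>\<^bsub>W\<^esub>" for r s
    proof -
      have "(\<Oplus>\<^bsub>W\<^esub>k\<in>{0..m}. tensor (?c k \<odot>\<^bsub>U\<^esub> ?M r s k) (?\<tau> r s))
          = tensor (\<Oplus>\<^bsub>U\<^esub>k\<in>{0..m}. ?c k \<odot>\<^bsub>U\<^esub> ?M r s k) (?\<tau> r s)"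
        using M \<tau> by (intro pure_tensor_finsum_left[OF U A, symmetric]) auto
      also have "\<dots> = \<zero>\<^bsub>W\<^esub>"
      proof (cases "?\<tau> r s = \<zero>\<^bsub>A\<^esub>")
        case True
        then show ?thesis
          using M by (simp add: pure_tensor_zero_right[OF U A] U.finsum_closed)
      next
        case False
        show ?thesis
          unfolding serre_or_zero[OF ij m False] using \<tau> by (rule pure_tensor_zero_left[OF U A])
      qed
      finally show ?thesis .
    qed
    then show ?thesis
      by simp
  qed
  finally show ?thesis
    by (simp add: W.finsum_zero)
qed

lemma coaction_exists:
  "\<exists>!f. extends_to_hom U W e (\<lambda>i. \<Oplus>\<^bsub>W\<^esub>j\<in>UNIV. tensor (e j) (T j i)) f"
proof -
  have "free_hom W E r = \<zero>\<^bsub>W\<^esub>" if r: "r \<in> serre_rels a d q" for r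
  proof -
    obtain i j where ij: "i \<noteq> j" "r = serre_element a d q i j"
      using r by (auto simp: serre_rels_def)
    show ?thesis
      unfolding ij(2)
      using alg_hom_serre_element[where a = a and d = d and q = q and i = i and j = j, OF W
          free_hom_alg_hom[where h = E, OF W E_closed] free_hom_free_gen[where h = E, OF W E_closed] refl]
        serre_E[OF ij(1) refl]
      by simp
  qed
  then have "\<exists>!f. extends_to_hom U W e E f"
    using extends_to_hom_presented[where h = E, OF W E_closed, of "serre_rels a d q"]
    by (simp add: Uq_plus_def Uq_gen_def)
  moreover have "E = (\<lambda>i. \<Oplus>\<^bsub>W\<^esub>j\<in>UNIV. tensor (e j) (T j i))"
    by (simp add: fun_eq_iff E_def)
  ultimately show ?thesis
    by simp
qed

lemma coaction_right_comodule_algebra: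
  "right_comodule_algebra U A (frt_comult (cartan_braiding a d q)) (frt_counit (cartan_braiding a d q))
    (induced_hom U W e (\<lambda>i. \<Oplus>\<^bsub>W\<^esub>j\<in>UNIV. tensor (e j) (T j i)))"
proof -
  let ?\<Delta> = "frt_comult (cartan_braiding a d q)" and ?\<epsilon> = "frt_counit (cartan_braiding a d q)"
  define \<delta> where "\<delta> = induced_hom U W e (\<lambda>i. \<Oplus>\<^bsub>W\<^esub>j\<in>UNIV. tensor (e j) (T j i))"
  note \<delta> = extends_to_hom_induced_hom[OF coaction_exists, folded \<delta>_def]
  note bialg = bialgebra_frt_alg[of a d q]
  have \<Delta>: "?\<Delta> \<in> alg_hom A (tensor_alg A A)" and \<epsilon>: "?\<epsilon> \<in> alg_hom A complex_alg"
    using bialg(1) by (simp_all add: bialgebra_def)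
  note AA = complex_algebra_tensor_alg[OF A A]
  note U_AA = complex_algebra_tensor_alg[OF U AA]
  have eq_on_U: "f x = g x"
    if "complex_algebra B" "f \<in> alg_hom U B" "g \<in> alg_hom U B" "\<And>i. f (e i) = g (e i)"
      "x \<in> carrier U" for f g x and B :: "(complex, 'b) module"
    using that alg_hom_eq_on_generators[of B f "serre_rels a d q" g x]
    by (auto simp: Uq_plus_def Uq_gen_def)
  have "tensor_assoc U A A (tensor_map U A W A \<delta> (\<lambda>h. h) (\<delta> x)) =
        tensor_map U A U (tensor_alg A A) (\<lambda>y. y) ?\<Delta> (\<delta> x)" if x: "x \<in> carrier U" for x
    using x
  proof (rule alg_hom_eq_on_generators[OF U_AA, of _ "serre_rels a d q", folded Uq_plus_def, rotated 3])
    show "(\<lambda>x. tensor_assoc U A A (tensor_map U A W A \<delta> (\<lambda>h. h) (\<delta> x)))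
        \<in> alg_hom U (tensor_alg U (tensor_alg A A))"
      by (rule alg_hom_comp[OF alg_hom_comp[OF \<delta>(1) tensor_map_alg_hom[OF U A W A \<delta>(1) id_alg_hom]]
          tensor_assoc_alg_hom[OF U A A]])
    show "(\<lambda>x. tensor_map U A U (tensor_alg A A) (\<lambda>y. y) ?\<Delta> (\<delta> x))
        \<in> alg_hom U (tensor_alg U (tensor_alg A A))"
      by (rule alg_hom_comp[OF \<delta>(1) tensor_map_alg_hom[OF U A U AA id_alg_hom \<Delta>]])
    fix i
    show "tensor_assoc U A A (tensor_map U A W A \<delta> (\<lambda>h. h) (\<delta> (presented_gen (serre_rels a d q) i))) =
        tensor_map U A U (tensor_alg A A) (\<lambda>y. y) ?\<Delta> (\<delta> (presented_gen (serre_rels a d q) i))"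
      using coassociative_on_matrix_coaction[where v = e and T = T and j = i,
          OF U A \<delta>(1) \<Delta> e T \<delta>(2) bialg(2)]
      by (simp add: Uq_gen_def)
  qed
  moreover have "tensor_lift U A U (\<lambda>y h. ?\<epsilon> h \<odot>\<^bsub>U\<^esub> y) (\<delta> x) = x" if x: "x \<in> carrier U" for x
    using x
  proof (rule eq_on_U[OF U alg_hom_comp[OF \<delta>(1) counit_right_alg_hom[OF U A \<epsilon>]] id_alg_hom, rotated])
    fix i
    show "tensor_lift U A U (\<lambda>y h. ?\<epsilon> h \<odot>\<^bsub>U\<^esub> y) (\<delta> (e i)) = e i"
      unfolding \<delta>(2) by (rule counit_on_matrix_coaction(1)[OF U A \<epsilon> e T bialg(3)])
  qed
  ultimately show ?thesis
    unfolding right_comodule_algebra_def \<delta>_def[symmetric]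
    using U bialg(1) \<delta>(1) by blast
qed

end

text \<open>Since \<open>induced_hom\<close> is a definite description, unique existence is asserted
  along with the axioms: it certifies that the comodule map in the second conjunct is the
  homomorphism extending the assignment.\<close>

theorem theorem4p5:
  fixes a :: "'n::finite \<Rightarrow> 'n \<Rightarrow> int" and d :: "'n \<Rightarrow> int" and q :: complex
  assumes "generalized_cartan_matrix a"
    and "symmetrization a d"
    and "q \<noteq> 0"
    and "\<forall>n::nat. n > 0 \<longrightarrow> (q powi (-2)) ^ n \<noteq> 1"
  shows "let U = Uq_plus a d q;
             e = Uq_gen a d q;
             \<sigma> = cartan_braiding a d q;
             A = frt_alg \<sigma>;
             T = frt_gen \<sigma>;
             h = (\<lambda>i. \<Oplus>\<^bsub>tensor_alg U A\<^esub>j\<in>UNIV. pure_tensor U A (e j) (T j i))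
         in (\<exists>!\<delta>. extends_to_hom U (tensor_alg U A) e h \<delta>) \<and>
            right_comodule_algebra U A (frt_comult \<sigma>) (frt_counit \<sigma>)
              (induced_hom U (tensor_alg U A) e h)"
  unfolding Let_def
  using coaction_exists[OF assms] coaction_right_comodule_algebra[OF assms] by blast

end
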